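(* Let $n,m\ge1$ with $nm>2$, and let $\Psi=(B_q)_{q\in\mathbb{N}}$ be a sequence of balls in $\mathbb{R}^m/\mathbb{Z}^m$. Let $f$ and $g(r):=r^{-m(n-1)}f(r)$ be dimension functions such that $r\mapsto r^{-nm}f(r)$ is monotonic. Then \[ \mathcal{H}^f(\mathcal{A}_{n,m}(\Psi))=\begin{cases}0&\text{if }\sum_{q=1}^\infty q^{n+m-1}g\Bigl(\frac{|B_q|^{1/m}}{2q}\Bigr)<\infty,\\ \mathcal{H}^f([0,1]^{nm})&\text{if }\sum_{q=1}^\infty q^{n+m-1}g\Bigl(\frac{|B_q|^{1/m}}{2q}\Bigr)=\infty.\end{cases} \]
   Context: A dimension function is a continuous non-decreasing $f:\mathbb{R}_{>0}\to\mathbb{R}_{>0}$ with $f(r)\to0$ as $r\to0$; $\mathcal{H}^f$ is the Hausdorff $f$-measure ($\mathcal{H}^f(F)=\lim_{\rho\to0}\inf\sum_i f(r_i)$ over covers of $F$ by balls $B(x_i,r_i)$ with $r_i<\rho$). Balls are max-norm balls in $\mathbb{R}^m/\mathbb{Z}^m$, $|B|$ is Lebesgue measure (so $|B_q|^{1/m}/2$ is the radius of $B_q$). For $\mathbf{q}\in\mathbb{Z}^n$, $|\mathbf{q}|=\max_i|q_i|$; $\mathbf{x}\in[0,1]^{nm}$ is an $n\times m$ matrix and $\mathbf{q}\mathbf{x}$ the row-vector–matrix product. $\mathcal{A}_{n,m}(\Psi)$ is the set of $\mathbf{x}\in[0,1]^{nm}$ such that $\mathbf{q}\mathbf{x}+\mathbf{p}\in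 B_{|\mathbf{q}|}$ for infinitely many $(\mathbf{p},\mathbf{q})\in\mathbb{Z}^m\times(\mathbb{Z}^n\setminus\{\mathbf0\})$. *)

theory Defs
  imports "HOL-Analysis.Analysis"
begin

definition dimension_function :: "(real \<Rightarrow> real) \<Rightarrow> bool" where
  "dimension_function f \<longleftrightarrow>
     continuous_on {0<..} f \<and> mono_on {0<..} f \<and> (\<forall>r>0. f r > 0) \<and>
     (f \<longlongrightarrow> 0) (at_right 0)"

definition monotonic_on :: "real set \<Rightarrow> (real \<Rightarrow> real) \<Rightarrow> bool" where
  "monotonic_on S h \<longleftrightarrow> mono_on S h \<or> (\<forall>x\<in>S. \<forall>y\<in>S. x \<le> y \<longrightarrow> h y \<le> h x)"

text \<open>Hausdorff f-measure: limit (= supremum, as the content is non-increasing in rho)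
  over rho \<rightarrow> 0 of the infimum of sums of f(r_i) over countable covers by balls
  B(x_i, r_i) with 0 < r_i < rho.\<close>
definition hausdorff_content :: "(real \<Rightarrow> real) \<Rightarrow> real \<Rightarrow> 'a::metric_space set \<Rightarrow> ennreal" where
  "hausdorff_content f \<rho> F =
     (INF cr \<in> {(c, r). (\<forall>i::nat. 0 < r i \<and> r i < \<rho>) \<and> F \<subseteq> (\<Union>i. ball (c i) (r i))}.
        (\<Sum>i. ennreal (f (snd cr i))))"

definition hausdorff_measure_f :: "(real \<Rightarrow> real) \<Rightarrow> 'a::metric_space set \<Rightarrow> ennreal" where
  "hausdorff_measure_f f F = (SUP \<rho> \<in> {0<..}. hausdorff_content f \<rho> F)"

definition int_vec_norm :: "int ^ 'n \<Rightarrow> nat" where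
  "int_vec_norm q = nat (Max (range (\<lambda>i. \<bar>q $ i\<bar>)))"

definition unit_cube_mat :: "(real ^ 'm ^ 'n) set" where
  "unit_cube_mat = {x. \<forall>i j. 0 \<le> x $ i $ j \<and> x $ i $ j \<le> 1}"

text \<open>A_{n,m}(Psi) where B_q is the max-norm ball with centre c q and radius rad q.
  x is an n x m matrix (rows indexed by 'n); q x is the row-vector/matrix product.\<close>
definition A_set :: "(nat \<Rightarrow> real ^ 'm) \<Rightarrow> (nat \<Rightarrow> real) \<Rightarrow> (real ^ 'm ^ 'n) set" where
  "A_set c rad = {x \<in> unit_cube_mat.
     infinite {(p :: int ^ 'm, q :: int ^ 'n). q \<noteq> 0 \<and>
        (\<forall>j. \<bar>((\<chi> i. of_int (q $ i)) v* x) $ j + of_int (p $ j) - c (int_vec_norm q) $ j\<bar>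
              < rad (int_vec_norm q))}}"

end

(* The convergence case counts maximal separated subsets of the resonant neighbourhoods.

   Divergence, Lebesgue level: only frequencies q with q_a = |q| and 1 <= q_i <= |q| are used.
   Translating by w (x) u with q.w = 0, r.w = 1 shows that the sets of two non-parallel
   frequencies are independent on the torus.  Parallel pairs are bounded by counting near
   coincidences in one variable, and their contribution sums to a constant multiple of the first
   moment because the sum over l of (gcd(k,l)/k)^(n+m-1) is bounded; this is where nm > 2 enters.
   Full measure then needs no zero-one law: a single set fills its expected share of every open set
   once |q| is large, so a set of positive measure missed by all late events would carry a
   positive proportion of the first moment on a set of arbitrarily small measure.

   Divergence, r^(-nm) f(r) unbounded: given a cover of total f-mass T, the Lebesgue statement is
   applied to the radii (g(r)/M)^(1/m) with M >> T, and Vitali's lemma yields disjoint balls filling a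
   fixed proportion of any open set.  Redistributing the volume of each ball uniformly over the
   thin slab inside it gives every covering ball of radius s mass at most a constant times f(s)/M.
   Hence the cover misses a part of some slab of positive measure.  Iterating inside that slab
   produces nested sets whose common point lies in the limsup set but not in the cover. *)


theory Submission
  imports Defs
begin

section \<open>The torus\<close>

text \<open>The monotonicity of r^(-nm) f(r) enters through a dichotomy at 0. If f(s) <= B s^(nm)
  for small s, then H^f vanishes on Lebesgue null sets, and it suffices that \<open>A_set\<close>
  fills the unit cube up to a null set. Otherwise the ratio is unbounded near 0, so it cannot be
  non-decreasing; it tends to infinity as s tends to 0, and both Hausdorff measures turn out to be
  infinite. For the latter no Frostman measure is built: a finite H^f would give one cover of finite
  mass, and that single cover is defeated by a nested sequence made for it. Each stage compares
  masses with this cover only, so the redistributed volumes of different stages never have to fit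
  together. At the Lebesgue level the balls B_q may vary arbitrarily with q, in centre and in size,
  so the overlaps of parallel frequencies have to be bounded pair by pair. The loss is a matter of
  counting: at most d numbers l <= k have k / gcd k l = d, so the sum of (gcd k l / k)^e is at most
  the sum of d^(1-e), which stays bounded for e = n+m-1 >= 3.\<close>

definition half_open_cube :: "'a::euclidean_space set" where
  "half_open_cube = {x. \<forall>b\<in>Basis. 0 \<le> x \<bullet> b \<and> x \<bullet> b < 1}"

text \<open>Cube and lattice are phrased through \<open>Basis\<close>, so that one treatment of the
  torus serves both R^m and the space of matrices. The cube is half open so that each point has
  exactly one lattice translate in it.\<close>

definition int_lattice :: "'a::euclidean_space set" where
  "int_lattice = {z. \<forall>b\<in>Basis. z \<bullet> b \<in> \<int>}"

lemma half_open_cube_borel [measurable]: "half_open_cube \<in> sets borel"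
proof -
  have "half_open_cube = (\<Inter>b\<in>Basis. {x::'a. 0 \<le> x \<bullet> b} \<inter> {x. x \<bullet> b < 1})"
    by (auto simp: half_open_cube_def)
  also have "\<dots> \<in> sets borel"
    by (intro sets.finite_INT) auto
  finally show ?thesis .
qed

lemma emeasure_half_open_cube: "emeasure lborel (half_open_cube :: 'a::euclidean_space set) = 1"
proof (rule antisym)
  have "emeasure lborel (half_open_cube :: 'a set) \<le> emeasure lborel (cbox 0 (One::'a))"
    by (rule emeasure_mono) (auto simp: half_open_cube_def mem_box less_imp_le)
  then show "emeasure lborel (half_open_cube :: 'a set) \<le> 1"
    by (simp add: emeasure_lborel_cbox_eq)
  have "emeasure lborel (box 0 (One::'a)) \<le> emeasure lborel (half_open_cube :: 'a set)"
    by (rule emeasure_mono) (auto simp: half_open_cube_def mem_box less_imp_le)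
  then show "1 \<le> emeasure lborel (half_open_cube :: 'a set)"
    by (simp add: emeasure_lborel_box_eq)
qed

lemma countable_int_lattice: "countable (int_lattice :: 'a::euclidean_space set)"
proof -
  have "int_lattice \<subseteq> (\<lambda>g. \<Sum>b\<in>Basis. of_int (g b) *\<^sub>R b) ` (PiE (Basis::'a set) (\<lambda>_. UNIV :: int set))"
  proof
    fix z :: 'a assume "z \<in> int_lattice"
    then have *: "\<And>b. b \<in> Basis \<Longrightarrow> of_int \<lfloor>z \<bullet> b\<rfloor> = z \<bullet> b"
      by (auto simp: int_lattice_def)
    have "z = (\<Sum>b\<in>Basis. of_int ((restrict (\<lambda>b. \<lfloor>z \<bullet> b\<rfloor>) Basis) b) *\<^sub>R b)"
      by (simp add: * euclidean_representation)
    then show "z \<in> (\<lambda>g. \<Sum>b\<in>Basis. of_int (g b) *\<^sub>R b) ` (PiE (Basis::'a set) (\<lambda>_. UNIV :: int set))"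
      by (rule image_eqI[where x = "restrict (\<lambda>b. \<lfloor>z \<bullet> b\<rfloor>) Basis"]) simp
  qed
  moreover have "countable (PiE (Basis::'a set) (\<lambda>_. UNIV :: int set))"
    by (rule countable_PiE) auto
  ultimately show ?thesis
    by (meson countable_image countable_subset)
qed

lemma int_lattice_uminus_iff [simp]: "- z \<in> int_lattice \<longleftrightarrow> z \<in> int_lattice"
  by (auto simp: int_lattice_def)

lemma ex1_cube_translate: "\<exists>!z\<in>int_lattice. x + z \<in> half_open_cube" for x :: "'a::euclidean_space"
proof (rule ex_ex1I)
  show "\<exists>z. z \<in> int_lattice \<and> x + z \<in> half_open_cube"
  proof (intro exI[of _ "- (\<Sum>b\<in>Basis. of_int \<lfloor>x \<bullet> b\<rfloor> *\<^sub>R b)"] conjI)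
    show "- (\<Sum>b\<in>Basis. of_int \<lfloor>x \<bullet> b\<rfloor> *\<^sub>R b) \<in> int_lattice"
      by (auto simp: int_lattice_def)
    show "x + - (\<Sum>b\<in>Basis. of_int \<lfloor>x \<bullet> b\<rfloor> *\<^sub>R b) \<in> half_open_cube"
      unfolding half_open_cube_def
      by (auto simp: inner_diff_left) linarith
  qed
next
  fix z y :: 'a
  assume z: "z \<in> int_lattice \<and> x + z \<in> half_open_cube" and y: "y \<in> int_lattice \<and> x + y \<in> half_open_cube"
  show "z = y"
  proof (rule euclidean_eqI)
    fix b :: 'a assume b: "b \<in> Basis"
    obtain i j where "z \<bullet> b = of_int i" "y \<bullet> b = of_int j"
      using z y b unfolding int_lattice_def by (metis (mono_tags, lifting) Ints_cases mem_Collect_eq)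
    moreover have "0 \<le> x \<bullet> b + z \<bullet> b" "x \<bullet> b + z \<bullet> b < 1" "0 \<le> x \<bullet> b + y \<bullet> b" "x \<bullet> b + y \<bullet> b < 1"
      using z y b by (auto simp: half_open_cube_def inner_add_left)
    ultimately have "\<bar>real_of_int (i - j)\<bar> < 1" by auto
    then have "i = j" by linarith
    then show "z \<bullet> b = y \<bullet> b"
      using \<open>z \<bullet> b = of_int i\<close> \<open>y \<bullet> b = of_int j\<close> by simp
  qed
qed

text \<open>Lattice sums are written as integrals over \<open>count_space\<close>, so that they can
  be exchanged with Lebesgue integrals.\<close>

lemma cube_translates_partition:
  "(\<integral>\<^sup>+z. indicator half_open_cube (x + z) \<partial>count_space int_lattice) = (1::ennreal)" for x :: "'a::euclidean_space"
proof -
  obtain z0 where z0: "z0 \<in> int_lattice" "x + z0 \<in> half_open_cube"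
    "\<And>z. z \<in> int_lattice \<Longrightarrow> x + z \<in> half_open_cube \<Longrightarrow> z = z0"
    using ex1_cube_translate[of x] by blast
  have "(\<integral>\<^sup>+z. indicator half_open_cube (x + z) \<partial>count_space int_lattice)
      = (\<integral>\<^sup>+z. indicator {z0} z \<partial>count_space (int_lattice::'a set))"
  proof (rule nn_integral_cong)
    fix z assume "z \<in> space (count_space (int_lattice::'a set))"
    then have "x + z \<in> half_open_cube \<longleftrightarrow> z = z0"
      using z0(1,2) z0(3)[of z] by auto
    then show "indicator half_open_cube (x + z) = (indicator {z0} z :: ennreal)"
      by (simp add: indicator_def)
  qed
  also have "\<dots> = 1"
    using z0(1) by (subst nn_integral_indicator) (auto simp: emeasure_count_space)
  finally show ?thesis .
qed

section \<open>Integration over the torus: unfolding and translation invariance\<close>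

lemma nn_integral_lborel_shift:
  fixes w :: "'a::euclidean_space"
  assumes [measurable]: "f \<in> borel_measurable borel"
  shows "(\<integral>\<^sup>+x. f (x + w) \<partial>lborel) = (\<integral>\<^sup>+x. f x \<partial>lborel)"
proof -
  have "(\<integral>\<^sup>+x. f x \<partial>lborel) = (\<integral>\<^sup>+x. f x \<partial>distr lborel borel ((+) w))"
    by (simp add: lborel_distr_plus)
  also have "\<dots> = (\<integral>\<^sup>+x. f (w + x) \<partial>lborel)"
    by (subst nn_integral_distr) auto
  finally show ?thesis by (simp add: add.commute)
qed

text \<open>Exchange the lattice sum with the integral, move each translation onto the cube, and sum
  back: exactly one translate of the cube contains a given point.\<close>

lemma nn_integral_unfold:
  fixes \<Phi> :: "'a::euclidean_space \<Rightarrow> ennreal"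
  assumes [measurable]: "\<Phi> \<in> borel_measurable borel"
  shows "(\<integral>\<^sup>+x. indicator half_open_cube x * (\<integral>\<^sup>+z. \<Phi> (x + z) \<partial>count_space int_lattice) \<partial>lborel)
       = (\<integral>\<^sup>+x. \<Phi> x \<partial>lborel)"
proof -
  have "(\<integral>\<^sup>+x. indicator half_open_cube x * (\<integral>\<^sup>+z. \<Phi> (x + z) \<partial>count_space int_lattice) \<partial>lborel)
      = (\<integral>\<^sup>+x. (\<integral>\<^sup>+z. indicator half_open_cube x * \<Phi> (x + z) \<partial>count_space int_lattice) \<partial>lborel)"
    by (rule nn_integral_cong, rule nn_integral_cmult[symmetric]) auto
  also have "\<dots> = (\<integral>\<^sup>+z. \<integral>\<^sup>+x. indicator half_open_cube x * \<Phi> (x + z) \<partial>lborel \<partial>count_space int_lattice)"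
    by (rule nn_integral_count_space_nn_integral) (auto simp: countable_int_lattice)
  also have "\<dots> = (\<integral>\<^sup>+z. \<integral>\<^sup>+x. indicator half_open_cube (x + (- z)) * \<Phi> x \<partial>lborel \<partial>count_space int_lattice)"
  proof (rule nn_integral_cong)
    fix z :: 'a
    have "(\<integral>\<^sup>+x. indicator half_open_cube x * \<Phi> (x + z) \<partial>lborel)
       = (\<integral>\<^sup>+x. (\<lambda>x. indicator half_open_cube (x + (-z)) * \<Phi> x) (x + z) \<partial>lborel)"
      by (simp)
    also have "\<dots> = (\<integral>\<^sup>+x. indicator half_open_cube (x + (- z)) * \<Phi> x \<partial>lborel)"
      by (rule nn_integral_lborel_shift) measurable
    finally show "(\<integral>\<^sup>+x. indicator half_open_cube x * \<Phi> (x + z) \<partial>lborel)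
       = (\<integral>\<^sup>+x. indicator half_open_cube (x + (- z)) * \<Phi> x \<partial>lborel)" .
  qed
  also have "\<dots> = (\<integral>\<^sup>+x. \<integral>\<^sup>+z. indicator half_open_cube (x + (- z)) * \<Phi> x \<partial>count_space int_lattice \<partial>lborel)"
    by (rule nn_integral_count_space_nn_integral[symmetric]) (auto simp: countable_int_lattice)
  also have "\<dots> = (\<integral>\<^sup>+x. (\<integral>\<^sup>+z. indicator half_open_cube (x + (- z)) \<partial>count_space int_lattice) * \<Phi> x \<partial>lborel)"
    by (rule nn_integral_cong, rule nn_integral_multc) auto
  also have "\<dots> = (\<integral>\<^sup>+x. \<Phi> x \<partial>lborel)"
  proof (rule nn_integral_cong)
    fix x :: 'a
    have "(\<integral>\<^sup>+z. indicator half_open_cube (x + (- z)) \<partial>count_space int_lattice)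
        = (\<integral>\<^sup>+z. indicator half_open_cube (x + z) \<partial>count_space (int_lattice::'a set))"
      by (rule nn_integral_bij_count_space[where g=uminus])
         (auto intro!: bij_betwI[where g=uminus])
    then show "(\<integral>\<^sup>+z. indicator half_open_cube (x + (- z)) \<partial>count_space int_lattice) * \<Phi> x = \<Phi> x"
      by (simp add: cube_translates_partition)
  qed
  finally show ?thesis .
qed

text \<open>A translated cube is again a fundamental domain: unfolding folds its indicator back into
  the original cube, where the translates add up to 1 and \<open>\<Phi>\<close> factors out by
  periodicity.\<close>

lemma nn_integral_torus_shift:
  fixes \<Phi> :: "'a::euclidean_space \<Rightarrow> ennreal"
  assumes [measurable]: "\<Phi> \<in> borel_measurable borel"
    and per: "\<And>x z. z \<in> int_lattice \<Longrightarrow> \<Phi> (x + z) = \<Phi> x"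
  shows "(\<integral>\<^sup>+x. indicator half_open_cube x * \<Phi> (x + w) \<partial>lborel)
       = (\<integral>\<^sup>+x. indicator half_open_cube x * \<Phi> x \<partial>lborel)"
proof -
  have "(\<integral>\<^sup>+x. indicator half_open_cube x * \<Phi> (x + w) \<partial>lborel)
      = (\<integral>\<^sup>+x. (\<lambda>x. indicator half_open_cube (x - w) * \<Phi> x) (x + w) \<partial>lborel)"
    by simp
  also have "\<dots> = (\<integral>\<^sup>+x. indicator half_open_cube (x - w) * \<Phi> x \<partial>lborel)"
    by (rule nn_integral_lborel_shift) measurable
  also have "\<dots> = (\<integral>\<^sup>+x. indicator half_open_cube x *
      (\<integral>\<^sup>+z. indicator half_open_cube (x + z - w) * \<Phi> (x + z) \<partial>count_space int_lattice) \<partial>lborel)"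
    by (rule nn_integral_unfold[symmetric]) measurable
  also have "\<dots> = (\<integral>\<^sup>+x. indicator half_open_cube x * \<Phi> x \<partial>lborel)"
  proof (rule nn_integral_cong)
    fix x :: 'a
    have "(\<integral>\<^sup>+z. indicator half_open_cube (x + z - w) * \<Phi> (x + z) \<partial>count_space int_lattice)
        = (\<integral>\<^sup>+z. indicator half_open_cube ((x - w) + z) * \<Phi> x \<partial>count_space int_lattice)"
      by (intro nn_integral_cong) (simp add: per add_diff_eq diff_add_eq)
    also have "\<dots> = (\<integral>\<^sup>+z. indicator half_open_cube ((x - w) + z) \<partial>count_space int_lattice) * \<Phi> x"
      by (rule nn_integral_multc) auto
    also have "\<dots> = \<Phi> x" by (simp only: cube_translates_partition) simp
    finally show "indicator half_open_cube x * (\<integral>\<^sup>+z. indicator half_open_cube (x + z - w) * \<Phi> (x + z) \<partial>count_space int_lattice)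
      = indicator half_open_cube x * \<Phi> x" by simp
  qed
  finally show ?thesis .
qed

section \<open>Integer linear forms\<close>

text \<open>A rank-one matrix used as a direction of translation: moving \<open>x\<close> by
  \<open>tensor w u\<close> moves the form \<open>q v* x\<close> by \<open>q \<bullet> w\<close>
  times \<open>u\<close>.\<close>

definition tensor :: "real ^ 'n \<Rightarrow> real ^ 'm \<Rightarrow> real ^ 'm ^ 'n" where
  "tensor w u = (\<chi> i. (w $ i) *\<^sub>R u)"

definition real_vec :: "int ^ 'n \<Rightarrow> real ^ 'n" where
  "real_vec q = (\<chi> i. of_int (q $ i))"

lemma real_vec_nth [simp]: "real_vec q $ i = of_int (q $ i)"
  by (simp add: real_vec_def)

lemma vec_mat_nth: "(q v* x) $ j = (\<Sum>i\<in>UNIV. q $ i * x $ i $ j)" for q :: "real ^ 'n"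
  by (simp add: vector_matrix_mult_def mult.commute)

lemma vec_mat_add_tensor: "q v* (x + tensor w u) = q v* x + (q \<bullet> w) *\<^sub>R u"
  by (simp add: vec_eq_iff vec_mat_nth tensor_def inner_vec_def distrib_left sum.distrib
      sum_distrib_left mult_ac)

lemma vec_mat_add: "q v* (x + y) = q v* x + q v* y" for q :: "real ^ 'n"
  by (simp add: vec_eq_iff vec_mat_nth distrib_left sum.distrib)

lemma continuous_on_vec_mat [continuous_intros]:
  "continuous_on S (\<lambda>x. q v* x)" for q :: "real ^ 'n"
  unfolding vector_matrix_mult_def by (intro continuous_intros)

lemma continuous_on_tensor [continuous_intros]: "continuous_on S (tensor w)"
  unfolding tensor_def by (intro continuous_intros)

lemma vec_mat_measurable [measurable]: "(\<lambda>x. q v* x) \<in> borel_measurable borel" for q :: "real ^ 'n"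
  by (intro borel_measurable_continuous_onI continuous_intros)

lemma tensor_measurable [measurable]: "tensor w \<in> borel_measurable borel"
  by (intro borel_measurable_continuous_onI continuous_intros)

lemma int_lattice_vec: "(z :: real ^ 'm) \<in> int_lattice \<longleftrightarrow> (\<forall>j. z $ j \<in> \<int>)"
  by (auto simp: int_lattice_def Basis_vec_def inner_axis)

lemma int_lattice_mat: "(z :: real ^ 'm ^ 'n) \<in> int_lattice \<longleftrightarrow> (\<forall>i j. z $ i $ j \<in> \<int>)"
  by (auto simp: int_lattice_def Basis_vec_def inner_axis)

lemma half_open_cube_vec: "(z :: real ^ 'm) \<in> half_open_cube \<longleftrightarrow> (\<forall>j. 0 \<le> z $ j \<and> z $ j < 1)"
  by (auto simp: half_open_cube_def Basis_vec_def inner_axis)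

lemma half_open_cube_mat: "(z :: real ^ 'm ^ 'n) \<in> half_open_cube \<longleftrightarrow> (\<forall>i j. 0 \<le> z $ i $ j \<and> z $ i $ j < 1)"
  by (auto simp: half_open_cube_def Basis_vec_def inner_axis)

lemma vec_mat_int_lattice:
  "z \<in> int_lattice \<Longrightarrow> real_vec q v* z \<in> int_lattice"
  by (auto simp: int_lattice_vec int_lattice_mat vec_mat_nth)

lemma nn_integral_swap:
  fixes \<Phi> :: "'a::euclidean_space \<Rightarrow> 'b::euclidean_space \<Rightarrow> ennreal"
  assumes "(\<lambda>(x, u). \<Phi> x u) \<in> borel_measurable borel"
  shows "(\<integral>\<^sup>+x. \<integral>\<^sup>+u. \<Phi> x u \<partial>lborel \<partial>lborel) = (\<integral>\<^sup>+u. \<integral>\<^sup>+x. \<Phi> x u \<partial>lborel \<partial>lborel)"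
proof -
  show ?thesis
    by (rule lborel_pair.Fubini'[symmetric]) (use assms in \<open>simp add: borel_prod[symmetric]\<close>)
qed

text \<open>The torus integral is invariant under each translation by \<open>tensor w u\<close>,
  hence under averaging over \<open>u\<close>. This creates an inner variable in which linear forms
  can be integrated explicitly.\<close>

lemma nn_integral_torus_average:
  fixes \<Phi> :: "real ^ 'm ^ 'n \<Rightarrow> ennreal"
  assumes [measurable]: "\<Phi> \<in> borel_measurable borel"
    and per: "\<And>x z. z \<in> int_lattice \<Longrightarrow> \<Phi> (x + z) = \<Phi> x"
  shows "(\<integral>\<^sup>+x. indicator half_open_cube x * \<Phi> x \<partial>lborel)
       = (\<integral>\<^sup>+x. indicator half_open_cube x * (\<integral>\<^sup>+u. indicator half_open_cube u * \<Phi> (x + tensor w u) \<partial>lborel) \<partial>lborel)"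
proof -
  let ?I = "\<integral>\<^sup>+x. indicator half_open_cube x * \<Phi> x \<partial>lborel"
  have "?I = (\<integral>\<^sup>+u. indicator (half_open_cube :: (real^'m) set) u * ?I \<partial>lborel)"
    by (subst nn_integral_multc) (simp_all add: emeasure_half_open_cube)
  also have "\<dots> = (\<integral>\<^sup>+u. \<integral>\<^sup>+x. indicator (half_open_cube :: (real^'m) set) u *
      (indicator half_open_cube x * \<Phi> (x + tensor w u)) \<partial>lborel \<partial>lborel)"
    by (rule nn_integral_cong, subst nn_integral_cmult) (simp_all add: nn_integral_torus_shift per)
  also have "\<dots> = (\<integral>\<^sup>+x. \<integral>\<^sup>+u. indicator (half_open_cube :: (real^'m) set) u *
      (indicator half_open_cube x * \<Phi> (x + tensor w u)) \<partial>lborel \<partial>lborel)"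
    by (rule nn_integral_swap) (simp add: borel_prod[symmetric])
  also have "\<dots> = (\<integral>\<^sup>+x. indicator half_open_cube x * (\<integral>\<^sup>+u. indicator half_open_cube u * \<Phi> (x + tensor w u) \<partial>lborel) \<partial>lborel)"
    by (rule nn_integral_cong, subst nn_integral_cmult[symmetric]) (simp_all add: mult_ac)
  finally show ?thesis .
qed

text \<open>Averaging along \<open>tensor w u\<close> fixes the first form and lets the second run
  through a whole period, so the inner integral is a constant. The vector \<open>w\<close> may be
  real, since the torus integral is invariant under all real translations.\<close>

lemma nn_integral_linear_forms_independent:
  fixes F G :: "real ^ 'm \<Rightarrow> ennreal" and q r :: "int ^ 'n"
  assumes [measurable]: "F \<in> borel_measurable borel" "G \<in> borel_measurable borel"
    and perF: "\<And>u z. z \<in> int_lattice \<Longrightarrow> F (u + z) = F u"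
    and perG: "\<And>u z. z \<in> int_lattice \<Longrightarrow> G (u + z) = G u"
    and w: "real_vec q \<bullet> w = 0" "real_vec r \<bullet> w = 1"
  shows "(\<integral>\<^sup>+x. indicator half_open_cube x * (F (real_vec q v* x) * G (real_vec r v* x)) \<partial>lborel)
     = (\<integral>\<^sup>+x. indicator half_open_cube x * F (real_vec q v* x) \<partial>lborel) *
       (\<integral>\<^sup>+u. indicator half_open_cube u * G u \<partial>lborel)"
proof -
  have "(\<integral>\<^sup>+x. indicator half_open_cube x * (F (real_vec q v* x) * G (real_vec r v* x)) \<partial>lborel)
    = (\<integral>\<^sup>+x. indicator half_open_cube x * (\<integral>\<^sup>+u. indicator half_open_cube u *
        (F (real_vec q v* (x + tensor w u)) * G (real_vec r v* (x + tensor w u))) \<partial>lborel) \<partial>lborel)"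
    by (rule nn_integral_torus_average) (auto simp: vec_mat_add perF perG vec_mat_int_lattice)
  also have "\<dots> = (\<integral>\<^sup>+x. indicator half_open_cube x * (\<integral>\<^sup>+u. F (real_vec q v* x) * (indicator half_open_cube u *
        G (u + real_vec r v* x)) \<partial>lborel) \<partial>lborel)"
    by (simp add: vec_mat_add_tensor w mult_ac add_ac)
  also have "\<dots> = (\<integral>\<^sup>+x. indicator half_open_cube x * F (real_vec q v* x) *
       (\<integral>\<^sup>+u. indicator half_open_cube u * G u \<partial>lborel) \<partial>lborel)"
    by (rule nn_integral_cong, subst nn_integral_cmult)
       (simp_all add: nn_integral_torus_shift perG mult_ac)
  also have "\<dots> = (\<integral>\<^sup>+x. indicator half_open_cube x * F (real_vec q v* x) \<partial>lborel) *
       (\<integral>\<^sup>+u. indicator half_open_cube u * G u \<partial>lborel)"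
    by (rule nn_integral_multc) measurable
  finally show ?thesis .
qed

lemma nn_integral_linear_form:
  fixes G :: "real ^ 'm \<Rightarrow> ennreal" and r :: "int ^ 'n"
  assumes [measurable]: "G \<in> borel_measurable borel"
    and perG: "\<And>u z. z \<in> int_lattice \<Longrightarrow> G (u + z) = G u" and "r \<noteq> 0"
  shows "(\<integral>\<^sup>+x. indicator half_open_cube x * G (real_vec r v* x) \<partial>lborel)
     = (\<integral>\<^sup>+u. indicator half_open_cube u * G u \<partial>lborel)"
proof -
  have "real_vec r \<noteq> 0"
    using \<open>r \<noteq> 0\<close> by (auto simp: vec_eq_iff)
  \<comment> \<open>The independence lemma with the zero form in first place and
    \<open>F = 1\<close>; \<open>w\<close> is \<open>r\<close> scaled to have inner product 1 with
    itself unscaled.\<close>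
  then have "real_vec (0 :: int ^ 'n) \<bullet> (real_vec r /\<^sub>R (real_vec r \<bullet> real_vec r)) = 0"
    "real_vec r \<bullet> (real_vec r /\<^sub>R (real_vec r \<bullet> real_vec r)) = 1"
    by (simp add: inner_vec_def, simp)
  from nn_integral_linear_forms_independent[of "\<lambda>_. 1" G, OF _ _ _ perG this]
  show ?thesis
    by (simp add: emeasure_half_open_cube)
qed

section \<open>Counting integers and integer vectors\<close>

lemma card_int_between:
  fixes a b :: real
  assumes "a \<le> b"
  shows "finite {i::int. a < of_int i \<and> of_int i < b}" "real (card {i::int. a < of_int i \<and> of_int i < b}) \<le> b - a + 1"
proof -
  have sub: "{i::int. a < of_int i \<and> of_int i < b} \<subseteq> {\<lceil>a\<rceil>..\<lfloor>b\<rfloor>}"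
    by (auto simp: ceiling_le_iff le_floor_iff)
  then show "finite {i::int. a < of_int i \<and> of_int i < b}"
    by (rule finite_subset) simp
  have "card {i::int. a < of_int i \<and> of_int i < b} \<le> card {\<lceil>a\<rceil>..\<lfloor>b\<rfloor>}"
    using sub by (rule card_mono[rotated]) simp
  also have "real \<dots> \<le> b - a + 1"
    using assms by simp linarith
  finally show "real (card {i::int. a < of_int i \<and> of_int i < b}) \<le> b - a + 1" by simp
qed

text \<open>Eliminate \<open>t\<close>: the integer \<open>l * p - k * p'\<close> lies within
  \<open>D = l * \<psi> + k * \<psi>'\<close> of a fixed number and is divisible by
  \<open>g = gcd k l\<close>, which leaves at most \<open>2 * D / g + 1\<close> values. Given this
  value, \<open>p\<close> is determined modulo \<open>k / g\<close> and runs through an interval of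
  length about \<open>k\<close>, which leaves at most \<open>4 * g\<close> choices.\<close>

lemma card_near_coincidences:
  fixes s s' \<psi> \<psi>' :: real and k l :: nat
  assumes "k > 0" "l > 0" "0 < \<psi>" "\<psi> \<le> 1/4" "0 < \<psi>'"
  defines "P \<equiv> {p::int. \<exists>t p'. 0 \<le> t \<and> t < 1 \<and> \<bar>s + of_nat k * t + of_int p\<bar> < \<psi> \<and> \<bar>s' + of_nat l * t + of_int (p'::int)\<bar> < \<psi>'}"
  shows "finite P" "real (card P) \<le> 8 * (of_nat l * \<psi> + of_nat k * \<psi>') + 4 * of_nat (gcd k l)"
proof -
  define g where "g = gcd k l"
  define k' where "k' = k div g"
  have g: "g > 0" "k = g * k'" "k' > 0" "g dvd l" "g dvd k"
    using assms(1,2) by (auto simp: g_def k'_def div_greater_zero_iff intro: gcd_le1_nat)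
  have cop: "coprime (int k') (int (l div g))"
    using assms(1) by (simp add: k'_def g_def div_gcd_coprime)
  have "\<forall>p\<in>P. \<exists>p'::int. \<exists>t. 0 \<le> t \<and> t < 1 \<and> \<bar>s + of_nat k * t + of_int p\<bar> < \<psi> \<and> \<bar>s' + of_nat l * t + of_int p'\<bar> < \<psi>'"
    by (auto simp: P_def)
  \<comment> \<open>One admissible \<open>p'\<close> is selected for each \<open>p\<close>; only the
    \<open>p\<close> are counted.\<close>
  then obtain c where c: "\<And>p. p \<in> P \<Longrightarrow> \<exists>t. 0 \<le> t \<and> t < 1 \<and> \<bar>s + of_nat k * t + of_int p\<bar> < \<psi> \<and> \<bar>s' + of_nat l * t + of_int (c p)\<bar> < \<psi>'"
    by metis
  define D where "D = real l * \<psi> + real k * \<psi>'"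
  have "D > 0" using assms by (simp add: D_def add_pos_pos)
  define A where "A = {a::int. (- D - (l * s - k * s')) / g < a \<and> a < (D - (l * s - k * s')) / g}"
  \<comment> \<open>Range of \<open>p div k'\<close>: the bounds for \<open>p / k'\<close> that
    follow from 0 <= t < 1, with \<open>- 1\<close> at the lower end for rounding down.\<close>
  define B where "B = {b::int. (- \<psi> - s - k) / k' - 1 < b \<and> b < (\<psi> - s) / k' + 1 / 4}"
  have bA: "(- D - (l * s - k * s')) / g \<le> (D - (l * s - k * s')) / g"
    using \<open>D > 0\<close> g by (intro divide_right_mono) auto
  have bB: "(- \<psi> - s - k) / k' - 1 \<le> (\<psi> - s) / k' + 1 / 4"
  proof -
    have "(- \<psi> - s - k) / k' \<le> (\<psi> - s) / k'"
      using assms(3) by (intro divide_right_mono) auto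
    then show ?thesis by linarith
  qed
  note A = card_int_between[OF bA, folded A_def] and B = card_int_between[OF bB, folded B_def]
  define v where "v p = int l * p - int k * c p" for p
  have gv: "v p = int g * (v p div int g)" for p
  proof -
    have "int g dvd v p"
      using g(4,5) unfolding v_def by (intro dvd_diff dvd_mult2) auto
    then show ?thesis by simp
  qed
  have inj: "inj_on (\<lambda>p. (v p div int g, p div int k')) P"
  proof (rule inj_onI)
    fix p r assume "(v p div int g, p div int k') = (v r div int g, r div int k')"
    then have "v p = v r" and d: "p div int k' = r div int k'"
      using gv[of p] gv[of r] by auto
    \<comment> \<open>Dividing by \<open>g\<close> gives
      \<open>(l div g) * (p - r) = k' * (c p - c r)\<close>. By coprimality \<open>p\<close> and
      \<open>r\<close> agree modulo \<open>k'\<close>, and the equal quotients do the rest.\<close>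
    then have "int l * (p - r) = int k * (c p - c r)"
      by (simp add: v_def algebra_simps)
    then have "int (g * (l div g)) * (p - r) = int (g * k') * (c p - c r)"
      using g(2,4) by simp
    then have "int g * (int (l div g) * (p - r)) = int g * (int k' * (c p - c r))"
      by (simp only: of_nat_mult mult.assoc)
    then have "int (l div g) * (p - r) = int k' * (c p - c r)"
      using g by simp
    then have "int k' dvd int (l div g) * (p - r)" by simp
    then have "int k' dvd p - r"
      using cop by (simp add: coprime_dvd_mult_right_iff)
    then have "p mod int k' = r mod int k'"
      by (simp add: mod_eq_dvd_iff)
    then show "p = r" using d by (metis div_mod_decomp_int)
  qed
  have img: "(\<lambda>p. (v p div int g, p div int k')) ` P \<subseteq> A \<times> B"
  proof (rule image_subsetI)
    fix p assume "p \<in> P"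
    from c[OF this] obtain t where t: "0 \<le> t" "t < 1" "\<bar>s + of_nat k * t + of_int p\<bar> < \<psi>" "\<bar>s' + of_nat l * t + of_int (c p)\<bar> < \<psi>'"
      by blast
    have "real_of_int (v p) + (l * s - k * s') = l * (s + of_nat k * t + of_int p) - k * (s' + of_nat l * t + of_int (c p))"
      by (simp add: v_def algebra_simps)
    moreover have "\<bar>l * (s + of_nat k * t + of_int p)\<bar> < l * \<psi>" "\<bar>k * (s' + of_nat l * t + of_int (c p))\<bar> < k * \<psi>'"
      using t assms(1,2) by (simp_all add: abs_mult)
    ultimately have "\<bar>real_of_int (v p) + (l * s - k * s')\<bar> < D"
      unfolding D_def by linarith
    then have "\<bar>g * real_of_int (v p div int g) + (l * s - k * s')\<bar> < D"
      using arg_cong[OF gv[of p], of real_of_int] by simp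
    then have a: "v p div int g \<in> A"
      unfolding A_def using g(1) by (auto simp: pos_less_divide_eq pos_divide_less_eq mult.commute)
    have kt: "0 \<le> k * t" "k * t \<le> k" using t by (auto simp: mult_left_le)
    have fl: "p div int k' = \<lfloor>real_of_int p / real k'\<rfloor>"
      using floor_divide_of_int_eq[where ?'a = real, of p "int k'"] by simp
    have "real_of_int (p div int k') \<le> p / k'" "p / k' - 1 < real_of_int (p div int k')"
      unfolding fl by linarith+
    moreover have "p / k' < (\<psi> - s) / k'" "(- \<psi> - s - k) / k' < p / k'"
    proof -
      have "p < \<psi> - s" "- \<psi> - s - k < p" using t(3) kt by linarith+
      then show "p / k' < (\<psi> - s) / k'" "(- \<psi> - s - k) / k' < p / k'"
        using g(3) by (auto intro!: divide_strict_right_mono)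
    qed
    ultimately have "p div int k' \<in> B"
      unfolding B_def by auto
    with a show "(v p div int g, p div int k') \<in> A \<times> B" by simp
  qed
  show "finite P"
    using inj_on_finite[OF inj img] A(1) B(1) by simp
  have "card P \<le> card (A \<times> B)"
    using card_inj_on_le[OF inj img] A(1) B(1) by simp
  then have "real (card P) \<le> real (card A) * real (card B)"
    by (simp add: card_cartesian_product flip: of_nat_mult)
  \<comment> \<open>The bound \<open>\<psi> \<le> 1/4\<close> leads to \<open>g + 11 / 4\<close>,
    which is at most \<open>4 * g\<close> because \<open>g \<ge> 1\<close>.\<close>
  also have "real (card B) \<le> 4 * g"
  proof -
    have "(\<psi> - s) / k' + 1 / 4 - ((- \<psi> - s - k) / k' - 1) + 1 = 2 * \<psi> / k' + g + 9 / 4"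
      using g by (simp add: field_simps)
    also have "2 * \<psi> / k' \<le> 1 / 2"
    proof -
      have "2 * \<psi> / k' \<le> 2 * \<psi> / 1"
        using assms(3) g(3) by (intro divide_left_mono) auto
      then show ?thesis using assms(4) by linarith
    qed
    finally have "real (card B) \<le> g + 11 / 4" using B(2) by linarith
    then show ?thesis using g(1) by linarith
  qed
  then have "real (card A) * real (card B) \<le> (2 * D / g + 1) * (4 * g)"
    using A(2) by (intro mult_mono) (auto simp: diff_divide_distrib add_divide_distrib)
  also have "\<dots> = 8 * D + 4 * g"
    using g(1) by (simp add: field_simps)
  finally show "real (card P) \<le> 8 * (of_nat l * \<psi> + of_nat k * \<psi>') + 4 * of_nat (gcd k l)"
    by (simp add: D_def g_def)
qed

lemma card_int_vec:
  fixes S :: "'n::finite \<Rightarrow> int set"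
  assumes "\<And>i. finite (S i)"
  shows "finite {q :: int ^ 'n. \<forall>i. q $ i \<in> S i}" "card {q :: int ^ 'n. \<forall>i. q $ i \<in> S i} = (\<Prod>i\<in>UNIV. card (S i))"
proof -
  have b: "bij_betw vec_nth {q :: int ^ 'n. \<forall>i. q $ i \<in> S i} (PiE UNIV S)"
    by (rule bij_betwI[where g = vec_lambda]) (auto simp: vec_eq_iff)
  show "card {q :: int ^ 'n. \<forall>i. q $ i \<in> S i} = (\<Prod>i\<in>UNIV. card (S i))"
    using bij_betw_same_card[OF b] by (simp add: card_PiE)
  show "finite {q :: int ^ 'n. \<forall>i. q $ i \<in> S i}"
    using bij_betw_finite[OF b] assms by (simp add: finite_PiE)
qed

section \<open>Resonant sets\<close>

definition open_cube :: "real ^ 'm \<Rightarrow> real \<Rightarrow> (real ^ 'm) set" where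
  "open_cube c \<psi> = {u. \<forall>j. \<bar>u $ j - c $ j\<bar> < \<psi>}"

lemma open_open_cube: "open (open_cube c \<psi>)"
proof -
  have "open_cube c \<psi> = (\<Inter>j\<in>UNIV. {u. \<bar>u $ j - c $ j\<bar> < \<psi>})"
    by (auto simp: open_cube_def)
  also have "open \<dots>"
    by (intro open_INT ballI open_Collect_less continuous_intros) auto
  finally show ?thesis .
qed

lemma open_cube_borel [measurable]: "open_cube c \<psi> \<in> sets borel"
  by (simp add: open_open_cube)

lemma emeasure_open_cube:
  assumes "\<psi> \<ge> 0"
  shows "emeasure lborel (open_cube (c :: real ^ 'm) \<psi>) = ennreal ((2 * \<psi>) ^ CARD('m))"
proof -
  have One: "(One :: real ^ 'm) $ j = 1" for j
  proof -
    have "(One :: real ^ 'm) $ j = One \<bullet> axis j (1::real)" by (rule cart_eq_inner_axis)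
    also have "\<dots> = 1" by (rule inner_sum_Basis) (simp add: axis_in_Basis_iff)
    finally show ?thesis .
  qed
  have eq: "open_cube c \<psi> = box (c - \<psi> *\<^sub>R One) (c + \<psi> *\<^sub>R One)"
    unfolding open_cube_def mem_box_cart set_eq_iff
    by (simp only: vector_add_component vector_minus_component vector_scaleR_component One) (auto simp: abs_less_iff algebra_simps)
  define l r where "l = c - \<psi> *\<^sub>R One" and "r = c + \<psi> *\<^sub>R One"
  have w: "(r - l) \<bullet> b = 2 * \<psi>" if "b \<in> Basis" for b
    using inner_sum_Basis[OF that] unfolding l_def r_def
    by (simp only: inner_diff_left inner_add_left inner_scaleR_left)
  then have le: "l \<bullet> b \<le> r \<bullet> b" if "b \<in> Basis" for b
    using w[OF that] assms by (simp add: inner_diff_left)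
  have "emeasure lborel (box l r) = ennreal (\<Prod>b\<in>Basis. (r - l) \<bullet> b)"
    using le by (rule emeasure_lborel_box)
  also have "(\<Prod>b\<in>Basis. (r - l) \<bullet> b) = (\<Prod>b\<in>(Basis::(real^'m) set). 2 * \<psi>)"
    using w by (rule prod.cong[OF refl])
  also have "\<dots> = (2 * \<psi>) ^ CARD('m)"
    by (simp only: prod_constant DIM_cart DIM_real mult_1_right)
  finally show ?thesis by (simp only: eq l_def r_def)
qed

text \<open>The lift to R^m of a ball on the torus; \<open>z\<close> plays the role of the integer
  vector p of the limsup set.\<close>

definition target :: "real ^ 'm \<Rightarrow> real \<Rightarrow> (real ^ 'm) set" where
  "target c \<psi> = {u. \<exists>z\<in>int_lattice. u + z \<in> open_cube c \<psi>}"

lemma open_target: "open (target c \<psi>)"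
proof -
  have "target c \<psi> = (\<Union>z\<in>int_lattice. (\<lambda>u. u + z) -` open_cube c \<psi>)"
    by (auto simp: target_def)
  also have "open \<dots>"
    by (intro open_UN ballI open_vimage open_open_cube continuous_intros)
  finally show ?thesis .
qed

lemma target_borel [measurable]: "target c \<psi> \<in> sets borel"
  by (simp add: open_target)

lemma int_lattice_add: "a \<in> int_lattice \<Longrightarrow> b \<in> int_lattice \<Longrightarrow> a + b \<in> int_lattice"
  by (simp add: int_lattice_def inner_add_left)

lemma target_periodic:
  assumes "z \<in> int_lattice" shows "u + z \<in> target c \<psi> \<longleftrightarrow> u \<in> target c \<psi>"
proof
  assume "u + z \<in> target c \<psi>"
  then show "u \<in> target c \<psi>"
    using assms by (auto simp: target_def add.assoc intro: int_lattice_add)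
next
  assume "u \<in> target c \<psi>"
  then obtain y where y: "y \<in> int_lattice" "u + y \<in> open_cube c \<psi>"
    by (auto simp: target_def)
  have "y - z \<in> int_lattice" "u + z + (y - z) \<in> open_cube c \<psi>"
    using y assms by (simp_all add: int_lattice_def inner_diff_left)
  then show "u + z \<in> target c \<psi>" unfolding target_def by blast
qed

lemma nn_integral_lattice_singleton:
  "z \<in> int_lattice \<Longrightarrow> (\<integral>\<^sup>+y. indicator {z} y \<partial>count_space int_lattice) = 1"
  by (subst nn_integral_indicator) (auto simp: emeasure_count_space)

lemma indicator_target_le:
  "indicator (target c \<psi>) u \<le> (\<integral>\<^sup>+z. indicator (open_cube c \<psi>) (u + z) \<partial>count_space int_lattice)"
proof (cases "u \<in> target c \<psi>")
  case True
  then obtain z where z: "z \<in> int_lattice" "u + z \<in> open_cube c \<psi>" by (auto simp: target_def)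
  have "(\<integral>\<^sup>+y. indicator {z} y \<partial>count_space int_lattice)
      \<le> (\<integral>\<^sup>+z. indicator (open_cube c \<psi>) (u + z) \<partial>count_space int_lattice)"
    using z by (intro nn_integral_mono) (auto simp: indicator_def)
  then show ?thesis using True nn_integral_lattice_singleton[OF z(1)] by simp
qed simp

lemma open_cube_lattice_unique:
  assumes "\<psi> \<le> 1/2" "y \<in> int_lattice" "z \<in> int_lattice" "u + y \<in> open_cube c \<psi>" "u + z \<in> open_cube c \<psi>"
  shows "y = z"
proof -
  have "y $ j = z $ j" for j
  proof -
    obtain a b where ab: "y $ j = of_int a" "z $ j = of_int b"
      using assms(2,3) by (meson Ints_cases int_lattice_vec)
    have "\<bar>u $ j + y $ j - c $ j\<bar> < \<psi>" "\<bar>u $ j + z $ j - c $ j\<bar> < \<psi>"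
      using assms(4,5) by (auto simp: open_cube_def)
    then have "\<bar>y $ j - z $ j\<bar> < 1" using assms(1) by linarith
    then have "\<bar>of_int (a - b) :: real\<bar> < 1" by (simp add: ab)
    then have "a = b" by linarith
    then show ?thesis by (simp add: ab)
  qed
  then show ?thesis by (simp add: vec_eq_iff)
qed

text \<open>Half side at most 1/2 makes the integer translates of the cube disjoint, so the lattice
  sum never exceeds 1. For larger radii the translates may overlap and
  \<open>indicator_target_le\<close> remains, on which the convergence case relies.\<close>

lemma indicator_target_eq:
  assumes "\<psi> \<le> 1/2"
  shows "indicator (target c \<psi>) u = (\<integral>\<^sup>+z. indicator (open_cube c \<psi>) (u + z) \<partial>count_space int_lattice)"
proof (rule antisym[OF indicator_target_le])
  show "(\<integral>\<^sup>+z. indicator (open_cube c \<psi>) (u + z) \<partial>count_space int_lattice) \<le> indicator (target c \<psi>) u"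
  proof (cases "u \<in> target c \<psi>")
    case True
    then obtain z where z: "z \<in> int_lattice" "u + z \<in> open_cube c \<psi>" by (auto simp: target_def)
    have "(\<integral>\<^sup>+y. indicator (open_cube c \<psi>) (u + y) \<partial>count_space int_lattice)
        \<le> (\<integral>\<^sup>+y. indicator {z} y \<partial>count_space int_lattice)"
    proof (rule nn_integral_mono)
      fix y :: "real ^ 'a" assume "y \<in> space (count_space int_lattice)"
      then show "indicator (open_cube c \<psi>) (u + y) \<le> (indicator {z} y :: ennreal)"
        using open_cube_lattice_unique[OF assms _ z(1) _ z(2), of y] by (auto simp: indicator_def)
    qed
    then show ?thesis using True nn_integral_lattice_singleton[OF z(1)] by simp
  next
    case False
    have "(\<integral>\<^sup>+z. indicator (open_cube c \<psi>) (u + z) \<partial>count_space int_lattice)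
        = (\<integral>\<^sup>+z. 0 \<partial>count_space (int_lattice :: (real ^ 'a) set))"
      using False by (intro nn_integral_cong) (auto simp: target_def indicator_def)
    then show ?thesis by simp
  qed
qed

lemma nn_integral_unfold_open_cube:
  assumes "\<psi> \<ge> 0"
  shows "(\<integral>\<^sup>+u. indicator half_open_cube u * (\<integral>\<^sup>+z. indicator (open_cube (c :: real ^ 'm) \<psi>) (u + z) \<partial>count_space int_lattice) \<partial>lborel)
    = ennreal ((2 * \<psi>) ^ CARD('m))"
  using assms by (subst nn_integral_unfold) (simp_all add: emeasure_open_cube)

lemma emeasure_target_le:
  assumes "\<psi> \<ge> 0"
  shows "(\<integral>\<^sup>+u. indicator half_open_cube u * indicator (target (c :: real ^ 'm) \<psi>) u \<partial>lborel) \<le> ennreal ((2 * \<psi>) ^ CARD('m))"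
  unfolding nn_integral_unfold_open_cube[OF assms, of c, symmetric]
  by (intro nn_integral_mono mult_left_mono indicator_target_le) simp

lemma emeasure_target:
  assumes "\<psi> \<ge> 0" "\<psi> \<le> 1/2"
  shows "(\<integral>\<^sup>+u. indicator half_open_cube u * indicator (target (c :: real ^ 'm) \<psi>) u \<partial>lborel) = ennreal ((2 * \<psi>) ^ CARD('m))"
  unfolding indicator_target_eq[OF assms(2)] by (rule nn_integral_unfold_open_cube[OF assms(1)])

text \<open>The contribution of one frequency \<open>q\<close> to the limsup set, with the union
  over all p built into \<open>target\<close>.\<close>

definition resonant :: "int ^ 'n \<Rightarrow> real ^ 'm \<Rightarrow> real \<Rightarrow> (real ^ 'm ^ 'n) set" where
  "resonant q c \<psi> = {x. real_vec q v* x \<in> target c \<psi>}"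

lemma open_resonant: "open (resonant q c \<psi>)"
proof -
  have "resonant q c \<psi> = (\<lambda>x. real_vec q v* x) -` target c \<psi>"
    by (auto simp: resonant_def)
  then show ?thesis
    by (simp add: open_vimage open_target continuous_on_vec_mat)
qed

lemma resonant_borel [measurable]: "resonant q c \<psi> \<in> sets borel"
  by (simp add: open_resonant)

section \<open>Measure of the overlap of two resonant sets\<close>

lemma indicator_target_periodic:
  "z \<in> int_lattice \<Longrightarrow> indicator (target c \<psi>) (u + z) = (indicator (target c \<psi>) u :: ennreal)"
  by (simp add: indicator_def target_periodic)

lemma emeasure_resonant_independent:
  fixes c c' :: "real ^ 'm" and q r :: "int ^ 'n"
  assumes "0 \<le> \<psi>" "\<psi> \<le> 1/2" "0 \<le> \<psi>'" "\<psi>' \<le> 1/2" "q \<noteq> 0"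
    and indep: "\<And>t. real_vec r \<noteq> t *\<^sub>R real_vec q"
  shows "emeasure lborel (half_open_cube \<inter> resonant q c \<psi> \<inter> resonant r c' \<psi>') = ennreal ((2 * \<psi>) ^ CARD('m) * (2 * \<psi>') ^ CARD('m))"
proof -
  define Q R where "Q = real_vec q" and "R = real_vec r"
  \<comment> \<open>Gram-Schmidt: the component of \<open>R\<close> orthogonal to \<open>Q\<close>.
    It is nonzero because \<open>R\<close> is not a multiple of \<open>Q\<close>, and
    \<open>R \<bullet> w0 = w0 \<bullet> w0\<close> shows how to normalise it.\<close>
  define w0 where "w0 = R - ((R \<bullet> Q) / (Q \<bullet> Q)) *\<^sub>R Q"
  have "Q \<noteq> 0" using assms(5) by (auto simp: vec_eq_iff Q_def)
  then have 0: "Q \<bullet> w0 = 0" by (simp add: w0_def inner_diff_right inner_commute)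
  have "w0 \<noteq> 0" using indep by (auto simp: w0_def Q_def R_def)
  have "R \<bullet> w0 = w0 \<bullet> w0 + ((R \<bullet> Q) / (Q \<bullet> Q)) * (Q \<bullet> w0)"
    by (simp add: w0_def inner_diff_left inner_diff_right algebra_simps)
  then have "R \<bullet> w0 = w0 \<bullet> w0" by (simp add: 0)
  then have w: "real_vec q \<bullet> (w0 /\<^sub>R (w0 \<bullet> w0)) = 0" "real_vec r \<bullet> (w0 /\<^sub>R (w0 \<bullet> w0)) = 1"
    using 0 \<open>w0 \<noteq> 0\<close> by (auto simp: Q_def R_def)
  have "emeasure lborel (half_open_cube \<inter> resonant q c \<psi> \<inter> resonant r c' \<psi>')
     = (\<integral>\<^sup>+x. indicator (half_open_cube \<inter> resonant q c \<psi> \<inter> resonant r c' \<psi>') x \<partial>lborel)"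
    by simp
  also have "\<dots> = (\<integral>\<^sup>+x. indicator half_open_cube x * (indicator (target c \<psi>) (real_vec q v* x) * indicator (target c' \<psi>') (real_vec r v* x)) \<partial>lborel)"
    by (rule nn_integral_cong) (auto simp: indicator_def resonant_def)
  also have "\<dots> = (\<integral>\<^sup>+x. indicator half_open_cube x * indicator (target c \<psi>) (real_vec q v* x) \<partial>lborel) *
       (\<integral>\<^sup>+u. indicator half_open_cube u * indicator (target c' \<psi>') u \<partial>lborel)"
    by (rule nn_integral_linear_forms_independent[OF _ _ _ _ w]) (auto simp: indicator_target_periodic)
  also have "(\<integral>\<^sup>+x. indicator half_open_cube x * indicator (target c \<psi>) (real_vec q v* x) \<partial>lborel)
      = (\<integral>\<^sup>+u. indicator half_open_cube u * indicator (target c \<psi>) u \<partial>lborel)"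
    by (rule nn_integral_linear_form) (auto simp: assms indicator_target_periodic)
  finally have "emeasure lborel (half_open_cube \<inter> resonant q c \<psi> \<inter> resonant r c' \<psi>')
      = ennreal ((2 * \<psi>) ^ CARD('m)) * ennreal ((2 * \<psi>') ^ CARD('m))"
    by (simp only: emeasure_target assms)
  then show ?thesis using assms by (subst ennreal_mult) auto
qed

text \<open>The coordinates of \<open>u\<close> decouple. In each of them the coincidence count
  bounds the number of integers \<open>p $ j\<close>, and once \<open>p\<close> is fixed the first
  condition alone confines \<open>u\<close> to a cube of half side
  \<open>\<psi> / k\<close>.\<close>

lemma emeasure_dilated_targets:
  fixes s s' c c' :: "real ^ 'm" and k l :: nat and \<psi> \<psi>' :: real
  assumes "k > 0" "l > 0" "0 < \<psi>" "\<psi> \<le> 1/4" "0 < \<psi>'"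
  shows "(\<integral>\<^sup>+u. indicator half_open_cube u * (indicator (target c \<psi>) (s + real k *\<^sub>R u) *
            indicator (target c' \<psi>') (s' + real l *\<^sub>R u)) \<partial>lborel)
     \<le> ennreal (((8 * (l * \<psi> + k * \<psi>') + 4 * gcd k l) * (2 * (\<psi> / k))) ^ CARD('m))"
proof -
  define P where "P j = {p::int. \<exists>t p'. 0 \<le> t \<and> t < 1 \<and> \<bar>(s $ j - c $ j) + of_nat k * t + of_int p\<bar> < \<psi> \<and> \<bar>(s' $ j - c' $ j) + of_nat l * t + of_int (p'::int)\<bar> < \<psi>'}" for j
  have P: "finite (P j)" "real (card (P j)) \<le> 8 * (l * \<psi> + k * \<psi>') + 4 * gcd k l" for j
    using card_near_coincidences[OF assms, of "s $ j - c $ j" "s' $ j - c' $ j"] unfolding P_def by auto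
  define PP where "PP = {p :: int ^ 'm. \<forall>j. p $ j \<in> P j}"
  note PP = card_int_vec[of P, OF P(1), folded PP_def]
  define Z where "Z p = (1 / k) *\<^sub>R (c - s - real_vec p)" for p :: "int ^ 'm"
  have sub: "half_open_cube \<inter> {u. s + real k *\<^sub>R u \<in> target c \<psi>} \<inter> {u. s' + real l *\<^sub>R u \<in> target c' \<psi>'}
      \<subseteq> (\<Union>p\<in>PP. open_cube (Z p) (\<psi> / k))"
  proof
    fix u assume u: "u \<in> half_open_cube \<inter> {u. s + real k *\<^sub>R u \<in> target c \<psi>} \<inter> {u. s' + real l *\<^sub>R u \<in> target c' \<psi>'}"
    then obtain z z' where z: "z \<in> int_lattice" "s + real k *\<^sub>R u + z \<in> open_cube c \<psi>"
      "z' \<in> int_lattice" "s' + real l *\<^sub>R u + z' \<in> open_cube c' \<psi>'"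
      by (auto simp: target_def)
    define p where "p = (\<chi> j. \<lfloor>z $ j\<rfloor>)"
    have p: "z $ j = of_int (p $ j)" "z' $ j = of_int \<lfloor>z' $ j\<rfloor>" for j
      using z(1,3) by (simp_all add: p_def int_lattice_vec)
    have "p $ j \<in> P j" for j
      unfolding P_def
    proof (intro CollectI exI conjI)
      show "0 \<le> u $ j" "u $ j < 1" using u by (auto simp: half_open_cube_vec)
      show "\<bar>(s $ j - c $ j) + of_nat k * u $ j + of_int (p $ j)\<bar> < \<psi>"
      proof -
        have "\<bar>s $ j + k * u $ j + z $ j - c $ j\<bar> < \<psi>"
          using z(2) by (simp add: open_cube_def)
        then show ?thesis using p(1)[of j] by (simp add: algebra_simps)
      qed
      have "\<bar>s' $ j + l * u $ j + z' $ j - c' $ j\<bar> < \<psi>'"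
        using z(4) by (simp add: open_cube_def)
      then show "\<bar>(s' $ j - c' $ j) + of_nat l * u $ j + of_int \<lfloor>z' $ j\<rfloor>\<bar> < \<psi>'"
        using p(2)[of j] by (simp add: algebra_simps)
    qed
    then have "p \<in> PP" by (simp add: PP_def)
    moreover have "u \<in> open_cube (Z p) (\<psi> / k)"
      unfolding open_cube_def
    proof (intro CollectI allI)
      fix j
      have "u $ j - Z p $ j = (s $ j + k * u $ j + z $ j - c $ j) / k"
        using assms(1) p(1)[of j] by (simp add: Z_def field_simps)
      moreover have "\<bar>s $ j + k * u $ j + z $ j - c $ j\<bar> < \<psi>"
        using z(2) by (simp add: open_cube_def)
      ultimately show "\<bar>u $ j - Z p $ j\<bar> < \<psi> / k"
        using assms(1) by (simp add: divide_strict_right_mono)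
    qed
    ultimately show "u \<in> (\<Union>p\<in>PP. open_cube (Z p) (\<psi> / k))" by blast
  qed
  have "(\<integral>\<^sup>+u. indicator half_open_cube u * (indicator (target c \<psi>) (s + real k *\<^sub>R u) *
            indicator (target c' \<psi>') (s' + real l *\<^sub>R u)) \<partial>lborel)
     \<le> (\<integral>\<^sup>+u. indicator (\<Union>p\<in>PP. open_cube (Z p) (\<psi> / k)) u \<partial>lborel)"
    using sub by (intro nn_integral_mono) (auto simp: indicator_def subset_iff)
  also have "\<dots> = emeasure lborel (\<Union>p\<in>PP. open_cube (Z p) (\<psi> / k))"
    by (rule nn_integral_indicator) (auto intro!: open_UN open_open_cube)
  also have "\<dots> \<le> (\<Sum>p\<in>PP. emeasure lborel (open_cube (Z p) (\<psi> / k)))"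
    using PP(1) by (intro emeasure_subadditive_finite) (auto simp: open_open_cube)
  also have "\<dots> = ennreal (real (card PP) * (2 * (\<psi> / k)) ^ CARD('m))"
    using assms by (simp add: emeasure_open_cube ennreal_mult flip: ennreal_of_nat_eq_real_of_nat)
  also have "\<dots> \<le> ennreal (((8 * (l * \<psi> + k * \<psi>') + 4 * gcd k l) * (2 * (\<psi> / k))) ^ CARD('m))"
  proof (rule ennreal_leI)
    have "real (card PP) \<le> (\<Prod>j\<in>(UNIV::'m set). 8 * (l * \<psi> + k * \<psi>') + 4 * gcd k l)"
      unfolding PP(2) of_nat_prod by (rule prod_mono) (use P in auto)
    then show "real (card PP) * (2 * (\<psi> / k)) ^ CARD('m) \<le> ((8 * (l * \<psi> + k * \<psi>') + 4 * gcd k l) * (2 * (\<psi> / k))) ^ CARD('m)"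
      unfolding power_mult_distrib using assms by (intro mult_right_mono) auto
  qed
  finally show ?thesis .
qed

lemma power_add_le: "(a + b) ^ d \<le> 2 ^ d * (a ^ d + b ^ d)" if "0 \<le> a" "0 \<le> b" for a b :: real
proof -
  have "(a + b) ^ d \<le> (2 * max a b) ^ d" using that by (intro power_mono) auto
  also have "\<dots> = 2 ^ d * max a b ^ d" by (simp add: power_mult_distrib)
  also have "max a b ^ d \<le> a ^ d + b ^ d" using that by (auto simp: max_def)
  finally show ?thesis by simp
qed

text \<open>Averaging along \<open>axis a 1\<close> moves the two forms by \<open>k\<close> and
  \<open>l\<close> times \<open>u\<close>, so only the entries at \<open>a\<close> matter and the
  bound covers parallel pairs. The first summand has the order of magnitude of independent sets; the
  gcd summand is the excess.\<close>

lemma emeasure_resonant_dependent: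
  fixes c c' :: "real ^ 'm" and q r :: "int ^ 'n" and k l :: nat
  assumes "0 < \<psi>" "\<psi> \<le> 1/4" "0 < \<psi>'" "\<psi>' \<le> 1/4" "q $ a = int k" "r $ a = int l" "k > 0" "l > 0"
  shows "emeasure lborel (half_open_cube \<inter> resonant q c \<psi> \<inter> resonant r c' \<psi>')
    \<le> ennreal (2 ^ CARD('m) * ((32 * \<psi> * \<psi>') ^ CARD('m) + (8 * gcd k l * (\<psi> / k)) ^ CARD('m)))"
proof -
  \<comment> \<open>Stated for both orders, so that the relatively narrower set can come first:
    \<open>k2 * \<psi>1 \<le> k1 * \<psi>2\<close> then absorbs one of the two terms, and
    \<open>\<psi>1 / k1\<close> is at most \<open>\<psi> / k\<close> in either order.\<close>
  have ord: ?thesis if *: "0 < \<psi>1" "\<psi>1 \<le> 1/4" "0 < \<psi>2" "\<psi>2 \<le> 1/4" "q1 $ a = int k1" "q2 $ a = int k2" "k1 > 0" "k2 > 0" "\<psi>1 / k1 \<le> \<psi>2 / k2"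
     and **: "(q1 = q \<and> k1 = k \<and> \<psi>1 = \<psi> \<and> c1 = c \<and> q2 = r \<and> k2 = l \<and> \<psi>2 = \<psi>' \<and> c2 = c') \<or> (q1 = r \<and> k1 = l \<and> \<psi>1 = \<psi>' \<and> c1 = c' \<and> q2 = q \<and> k2 = k \<and> \<psi>2 = \<psi> \<and> c2 = c)"
    for q1 q2 :: "int ^ 'n" and k1 k2 :: nat and \<psi>1 \<psi>2 and c1 c2 :: "real ^ 'm"
  proof -
    have ax: "real_vec q1 \<bullet> axis a 1 = k1" "real_vec q2 \<bullet> axis a 1 = k2" using * by (simp_all add: inner_axis)
    have "emeasure lborel (half_open_cube \<inter> resonant q c \<psi> \<inter> resonant r c' \<psi>')
       = (\<integral>\<^sup>+x. indicator (half_open_cube \<inter> resonant q1 c1 \<psi>1 \<inter> resonant q2 c2 \<psi>2) x \<partial>lborel)"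
      using ** by (auto simp: Int_ac)
    also have "\<dots> = (\<integral>\<^sup>+x. indicator half_open_cube x * (indicator (target c1 \<psi>1) (real_vec q1 v* x) * indicator (target c2 \<psi>2) (real_vec q2 v* x)) \<partial>lborel)"
      by (rule nn_integral_cong) (auto simp: indicator_def resonant_def)
    also have "\<dots> = (\<integral>\<^sup>+x. indicator half_open_cube x * (\<integral>\<^sup>+u. indicator half_open_cube u * (indicator (target c1 \<psi>1) (real_vec q1 v* (x + tensor (axis a 1) u)) * indicator (target c2 \<psi>2) (real_vec q2 v* (x + tensor (axis a 1) u))) \<partial>lborel) \<partial>lborel)"
      by (rule nn_integral_torus_average) (auto simp: vec_mat_add indicator_target_periodic vec_mat_int_lattice)
    also have "\<dots> \<le> (\<integral>\<^sup>+x. indicator (half_open_cube :: (real^'m^'n) set) x * ennreal (((8 * (k2 * \<psi>1 + k1 * \<psi>2) + 4 * gcd k1 k2) * (2 * (\<psi>1 / k1))) ^ CARD('m)) \<partial>lborel)"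
      unfolding vec_mat_add_tensor ax
      by (intro nn_integral_mono mult_left_mono emeasure_dilated_targets[OF *(7,8,1,2,3)]) auto
    also have "\<dots> = ennreal (((8 * (k2 * \<psi>1 + k1 * \<psi>2) + 4 * gcd k1 k2) * (2 * (\<psi>1 / k1))) ^ CARD('m))"
      by (subst nn_integral_multc) (simp_all add: emeasure_half_open_cube)
    also have "\<dots> \<le> ennreal ((32 * \<psi> * \<psi>' + 8 * gcd k l * (\<psi> / k)) ^ CARD('m))"
    proof (rule ennreal_leI, rule power_mono)
      have 1: "k2 * \<psi>1 \<le> k1 * \<psi>2" using * by (simp add: field_simps mult.commute)
      have "(8 * (k2 * \<psi>1 + k1 * \<psi>2) + 4 * gcd k1 k2) * (2 * (\<psi>1 / k1)) \<le> (16 * (k1 * \<psi>2) + 4 * gcd k1 k2) * (2 * (\<psi>1 / k1))"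
        using 1 * by (intro mult_right_mono) (auto simp: mult.commute)
      also have "\<dots> = 32 * \<psi>1 * \<psi>2 + 8 * gcd k1 k2 * (\<psi>1 / k1)"
        using * by (simp add: field_simps)
      also have "\<dots> \<le> 32 * \<psi>1 * \<psi>2 + 8 * gcd k1 k2 * (\<psi> / k)"
        using ** * by (intro add_left_mono mult_left_mono) auto
      finally show "(8 * (k2 * \<psi>1 + k1 * \<psi>2) + 4 * gcd k1 k2) * (2 * (\<psi>1 / k1)) \<le> 32 * \<psi> * \<psi>' + 8 * gcd k l * (\<psi> / k)"
        using ** by (auto simp: gcd.commute mult_ac)
      show "0 \<le> (8 * (k2 * \<psi>1 + k1 * \<psi>2) + 4 * gcd k1 k2) * (2 * (\<psi>1 / k1))"
        using * by auto
    qed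
    also have "\<dots> \<le> ennreal (2 ^ CARD('m) * ((32 * \<psi> * \<psi>') ^ CARD('m) + (8 * gcd k l * (\<psi> / k)) ^ CARD('m)))"
      using assms by (intro ennreal_leI power_add_le) auto
    finally show ?thesis .
  qed
  show ?thesis
  proof (cases "\<psi> / k \<le> \<psi>' / l")
    case True
    from ord[OF assms(1-8) True] show ?thesis by blast
  next
    case False
    then have "\<psi>' / l \<le> \<psi> / k" by simp
    from ord[OF assms(3,4,1,2,6,5,8,7) this, of c' c] show ?thesis by simp
  qed
qed

section \<open>Frequencies and parallel pairs\<close>

lemma fmeasurable_subset_unit_box:
  fixes A :: "'a::euclidean_space set"
  assumes "A \<subseteq> box 0 One" "A \<in> sets borel"
  shows "A \<in> fmeasurable lborel"
proof (rule fmeasurableI)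
  show "A \<in> sets lborel" using assms by simp
  have "emeasure lborel A \<le> emeasure lborel (box 0 (One :: 'a))"
    using assms by (intro emeasure_mono) auto
  then show "emeasure lborel A < \<infinity>" using emeasure_lborel_box_finite by (rule le_less_trans)
qed

lemma ball_subset_iff_dist: "ball x r \<subseteq> S \<longleftrightarrow> (\<forall>y\<in>-S. r \<le> dist x y)"
proof -
  have "ball x r \<subseteq> S \<longleftrightarrow> (\<forall>y. y \<notin> S \<longrightarrow> \<not> dist x y < r)" by auto
  then show ?thesis by (simp add: not_less Ball_def)
qed

text \<open>The points at distance at least 1/(j+1) from the complement form closed sets increasing
  to \<open>S\<close>, so their measures converge to that of \<open>S\<close>. The margin
  \<open>\<rho>\<close> is room for short translations.\<close>

lemma open_erosion:
  fixes S :: "'a::euclidean_space set"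
  assumes "open S" "emeasure lborel S < \<infinity>" "\<eta> > 0"
  obtains K \<rho> where "K \<in> sets borel" "\<rho> > 0" "K \<subseteq> S" "\<And>x. x \<in> K \<Longrightarrow> ball x \<rho> \<subseteq> S"
    "measure lborel S - \<eta> < measure lborel K"
proof -
  define K where "K j = {x. ball x (1 / real (Suc j)) \<subseteq> S}" for j
  have Kc: "closed (K j)" for j
  proof -
    have "K j = (\<Inter>y\<in>-S. {x. 1 / real (Suc j) \<le> dist x y})"
      by (auto simp only: K_def ball_subset_iff_dist)
    moreover have "closed (\<Inter>y\<in>-S. {x. 1 / real (Suc j) \<le> dist x y})"
      by (intro closed_INT ballI closed_Collect_le continuous_intros)
    ultimately show ?thesis by simp
  qed
  have inc: "incseq K"
  proof (rule monoI)
    fix i j :: nat assume "i \<le> j"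
    then have "1 / real (Suc j) \<le> 1 / real (Suc i)" by (simp add: frac_le)
    then show "K i \<subseteq> K j"
      unfolding K_def using subset_ball by blast
  qed
  have "(\<Union>j. K j) = S"
  proof
    show "(\<Union>j. K j) \<subseteq> S" by (auto simp: K_def)
    show "S \<subseteq> (\<Union>j. K j)"
    proof
      fix x assume "x \<in> S"
      then obtain e where "e > 0" "ball x e \<subseteq> S" using assms(1) open_contains_ball by blast
      moreover obtain j where "1 / real (Suc j) < e"
        using \<open>e > 0\<close> nat_approx_posE by blast
      ultimately have "x \<in> K j" unfolding K_def using subset_ball[of "1 / real (Suc j)" e x] by auto
      then show "x \<in> (\<Union>j. K j)" by blast
    qed
  qed
  moreover have "(\<lambda>j. measure lborel (K j)) \<longlonglongrightarrow> measure lborel (\<Union>j. K j)"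
    by (rule Lim_measure_incseq) (use Kc inc \<open>(\<Union>j. K j) = S\<close> assms(2) in \<open>auto simp: borel_closed\<close>)
  ultimately have "\<forall>\<^sub>F j in sequentially. measure lborel S - \<eta> < measure lborel (K j)"
    using assms(3) by (intro order_tendstoD(1)) auto
  then obtain j where "measure lborel S - \<eta> < measure lborel (K j)"
    by (auto simp: eventually_sequentially)
  moreover have "K j \<subseteq> S" by (auto simp: K_def)
  ultimately show ?thesis
    using that[of "K j" "1 / real (Suc j)"] Kc by (auto simp: K_def borel_closed)
qed

text \<open>A part of the vectors of max norm \<open>k\<close> that still has k^(n-1) members, the
  full order of magnitude. All attain the norm at the same coordinate \<open>a\<close>, so one
  direction of translation serves every pair, and parallel pairs satisfy
  \<open>k * r = l * q\<close> without signs.\<close>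

definition freq :: "'n \<Rightarrow> nat \<Rightarrow> (int ^ 'n) set" where
  "freq a k = {q. q $ a = int k \<and> (\<forall>i. 1 \<le> q $ i \<and> q $ i \<le> int k)}"

lemma freq_eq: "k \<ge> 1 \<Longrightarrow> freq (a :: 'b::finite) k = {q. \<forall>i. q $ i \<in> (if i = a then {int k} else {1..int k})}"
proof (intro set_eqI iffI)
  fix q :: "int ^ 'b" assume k: "k \<ge> 1" and q: "q \<in> {q. \<forall>i. q $ i \<in> (if i = a then {int k} else {1..int k})}"
  have "q $ a = int k" using q by (auto dest: spec[of _ a])
  moreover have "1 \<le> q $ i \<and> q $ i \<le> int k" for i
    using q k by (cases "i = a") (auto dest: spec[of _ i])
  ultimately show "q \<in> freq a k" by (simp add: freq_def)
qed (auto simp: freq_def)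

lemma prod_if_eq_const:
  "(\<Prod>i\<in>(UNIV :: 'n::finite set). if i = a then 1 else x) = (x :: 'b::comm_monoid_mult) ^ (CARD('n) - 1)"
proof -
  have "(\<Prod>i\<in>UNIV. if i = a then 1 else x) = (\<Prod>i\<in>UNIV - {a}. if i = a then 1 else x)"
    by (subst prod.remove[of UNIV a]) auto
  also have "\<dots> = (\<Prod>i\<in>UNIV - {a}. x)" by (rule prod.cong) auto
  also have "\<dots> = x ^ (CARD('n) - 1)" by simp
  finally show ?thesis .
qed

lemma finite_freq: "k \<ge> 1 \<Longrightarrow> finite (freq a k)"
  by (subst freq_eq, assumption, rule card_int_vec) auto

lemma card_freq: "k \<ge> 1 \<Longrightarrow> card (freq (a :: 'n) k) = k ^ (CARD('n::finite) - 1)"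
proof -
  assume "k \<ge> 1"
  then have "card (freq a k) = (\<Prod>i\<in>UNIV. card (if i = a then {int k} else {1..int k}))"
    unfolding freq_eq[OF \<open>k \<ge> 1\<close>] by (intro card_int_vec) auto
  also have "\<dots> = (\<Prod>i\<in>(UNIV :: 'n set). if i = a then 1 else k)"
    by (intro prod.cong) auto
  finally show ?thesis by (simp only: prod_if_eq_const)
qed

lemma sum_inverse_squares_le: "(\<Sum>d=1..k. 1 / real d ^ 2) \<le> 2"
proof -
  have "(\<Sum>d=1..k. 1 / real d ^ 2) \<le> 2 - 1 / k" if "k \<ge> 1" for k
    using that
  proof (induction k rule: dec_induct)
    case (step k)
    have "1 / real (Suc k) ^ 2 \<le> 1 / k - 1 / Suc k"
    proof -
      have "1 / real (Suc k) ^ 2 \<le> 1 / (real k * real (Suc k))"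
        using step by (intro divide_left_mono) (auto simp: power2_eq_square intro!: mult_right_mono)
      also have "\<dots> = 1 / k - 1 / Suc k" using step by (simp add: field_simps)
      finally show ?thesis .
    qed
    then show ?case using step by simp
  qed simp
  from this[of k] show ?thesis
  proof (cases "k \<ge> 1")
    case True
    have "0 \<le> 1 / real k" by simp
    with \<open>k \<ge> 1 \<Longrightarrow> _\<close> True show ?thesis by linarith
  qed (simp add: not_le)
qed

text \<open>Reduce l/k to lowest terms: \<open>\<phi>\<close> is injective on 1..k, and each
  denominator d has at most d numerators. This bounds the sum by that of
  \<open>d * (1 / d) ^ e\<close>, hence by that of 1/d^2; with e = 2 the bound would be a harmonic
  sum.\<close>

lemma sum_gcd_ratio_le:
  assumes "e \<ge> 3" "k \<ge> 1"
  shows "(\<Sum>l=1..k. (real (gcd k l) / k) ^ e) \<le> 2"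
proof -
  define \<phi> where "\<phi> l = (k div gcd k l, l div gcd k l)" for l
  have d: "real (gcd k l) / k = 1 / real (k div gcd k l)" if "l \<ge> 1" for l
    using assms(2) by (simp add: real_of_nat_div field_simps)
  have inj: "inj_on \<phi> {1..k}"
  proof (rule inj_onI)
    fix x y assume xy: "x \<in> {1..k}" "y \<in> {1..k}" "\<phi> x = \<phi> y"
    then have 1: "k div gcd k x = k div gcd k y" "x div gcd k x = y div gcd k y" by (auto simp: \<phi>_def)
    have "gcd k x * (k div gcd k x) = gcd k y * (k div gcd k y)" by simp
    then have "gcd k x = gcd k y" using 1 assms(2)
      by (metis dvd_div_eq_0_iff gcd_dvd1 mult_cancel2 not_one_le_zero)
    then show "x = y" using 1(2) by (metis dvd_div_mult_self gcd_dvd2)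
  qed
  have img: "\<phi> ` {1..k} \<subseteq> Sigma {1..k} (\<lambda>d. {1..d})"
  proof (rule image_subsetI)
    fix l assume l: "l \<in> {1..k}"
    then have "gcd k l \<le> l" "gcd k l > 0" "gcd k l \<le> k" using assms(2) by (auto intro: gcd_le2_nat gcd_le1_nat)
    then have "l div gcd k l \<ge> 1" "k div gcd k l \<ge> 1"
      by (auto simp: Suc_le_eq div_greater_zero_iff)
    moreover have "l div gcd k l \<le> k div gcd k l" using l by (simp add: div_le_mono)
    ultimately show "\<phi> l \<in> Sigma {1..k} (\<lambda>d. {1..d})" by (auto simp: \<phi>_def)
  qed
  have "(\<Sum>l=1..k. (real (gcd k l) / k) ^ e) = (\<Sum>l\<in>{1..k}. (\<lambda>(d, l'). (1 / real d) ^ e) (\<phi> l))"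
    by (rule sum.cong) (auto simp: d \<phi>_def)
  also have "\<dots> = (\<Sum>x\<in>\<phi> ` {1..k}. (\<lambda>(d, l'). (1 / real d) ^ e) x)"
    using sum.reindex[OF inj, of "\<lambda>(d, l'). (1 / real d) ^ e"] by (simp add: o_def)
  also have "\<dots> \<le> (\<Sum>x\<in>Sigma {1..k} (\<lambda>d. {1..d}). (\<lambda>(d, l'). (1 / real d) ^ e) x)"
    using img by (intro sum_mono2) auto
  also have "\<dots> = (\<Sum>d=1..k. real d * (1 / real d) ^ e)"
    by (subst sum.Sigma[symmetric]) auto
  also have "\<dots> \<le> (\<Sum>d=1..k. 1 / real d ^ 2)"
  proof (rule sum_mono)
    fix d assume "d \<in> {1..k}"
    then have "d \<ge> 1" by simp
    then have "real d * (1 / real d) ^ e \<le> real d * (1 / real d) ^ 3"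
      using assms(1) by (intro mult_left_mono power_decreasing) auto
    also have "\<dots> = 1 / real d ^ 2" using \<open>d \<ge> 1\<close> by (simp add: power3_eq_cube power2_eq_square)
    finally show "real d * (1 / real d) ^ e \<le> 1 / real d ^ 2" .
  qed
  also note sum_inverse_squares_le
  finally show ?thesis .
qed

definition parallel :: "int ^ 'n \<Rightarrow> int ^ 'n \<Rightarrow> bool" where
  "parallel q r \<longleftrightarrow> (\<exists>t. real_vec r = t *\<^sub>R real_vec q)"

lemma parallel_freq:
  assumes "q \<in> freq a k" "r \<in> freq a l" "parallel q r" "k \<ge> 1"
  shows "int k * r $ i = int l * q $ i"
proof -
  obtain t where t: "real_vec r = t *\<^sub>R real_vec q" using assms(3) by (auto simp: parallel_def)
  then have *: "of_int (r $ j) = t * of_int (q $ j)" for j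
    by (metis real_vec_nth vector_scaleR_component real_scaleR_def)
  from *[of a] have "real l = t * real k" using assms(1,2) by (simp add: freq_def)
  then have "of_int (int k * r $ i) = (of_int (int l * q $ i) :: real)"
    using *[of i] by simp
  then show ?thesis by (simp only: of_int_eq_iff)
qed

lemma card_multiples: 
  assumes "d \<ge> 1" shows "card {b \<in> {1..int (g * d)}. int d dvd b} = g"
proof -
  have "{b \<in> {1..int (g * d)}. int d dvd b} = (\<lambda>x. int d * x) ` {1..int g}"
  proof (intro set_eqI iffI)
    fix b assume "b \<in> {b \<in> {1..int (g * d)}. int d dvd b}"
    then have b: "int d dvd b" "1 \<le> b" "b \<le> int d * int g" by (auto simp: mult.commute)
    from b(1) obtain x where "b = int d * x" by (rule dvdE)
    with b have "b = int d * x" "1 \<le> int d * x" "int d * x \<le> int d * int g" by auto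
    moreover have "0 < x" "x \<le> int g"
    proof -
      have d0: "0 < int d" using assms by simp
      have "0 < int d * x" using \<open>1 \<le> int d * x\<close> by linarith
      then show "0 < x" using d0 by (simp add: zero_less_mult_iff)
      show "x \<le> int g" using \<open>int d * x \<le> int d * int g\<close> d0 by (rule mult_left_le_imp_le)
    qed
    ultimately show "b \<in> (\<lambda>x. int d * x) ` {1..int g}" by auto
  next
    fix b assume "b \<in> (\<lambda>x. int d * x) ` {1..int g}"
    then obtain x where x: "b = int d * x" "x \<in> {1..int g}" by (rule imageE)
    have "0 < int d * x" using x(2) assms by (intro mult_pos_pos) auto
    moreover have "int d * x \<le> int d * int g" using x(2) by (intro mult_left_mono) auto
    ultimately have "1 \<le> b" "b \<le> int (g * d)" unfolding x(1) by (simp_all add: mult.commute)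
    then show "b \<in> {b \<in> {1..int (g * d)}. int d dvd b}" by (simp add: x(1))
  qed
  moreover have "inj_on (\<lambda>x. int d * x) {1..int g}" using assms by (auto simp: inj_on_def)
  ultimately show ?thesis by (simp add: card_image)
qed

text \<open>\<open>q\<close> determines \<open>r\<close> through \<open>k * r = l * q\<close>, and
  integrality of \<open>r\<close> forces \<open>k / gcd k l\<close> to divide every entry of
  \<open>q\<close>. That leaves \<open>gcd k l\<close> choices in each coordinate other than
  \<open>a\<close>.\<close>

lemma card_parallel_pairs:
  fixes a :: "'n::finite"
  assumes "k \<ge> 1" "l \<ge> 1"
  shows "card {(q, r) \<in> freq a k \<times> freq a l. parallel q r} \<le> gcd k l ^ (CARD('n) - 1)"
proof -
  define g d where "g = gcd k l" and "d = k div g"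
  have g: "g > 0" "k = g * d" "d \<ge> 1" "g dvd l"
    using assms by (auto simp: g_def d_def Suc_le_eq div_greater_zero_iff intro: gcd_le1_nat)
  have cop: "coprime (int d) (int (l div g))"
    using assms(1) by (simp add: d_def g_def div_gcd_coprime)
  define T where "T i = (if i = a then {int k} else {b \<in> {1..int (g * d)}. int d dvd b})" for i
  have T: "finite (T i)" for i
    by (rule finite_subset[of _ "{1..int (g * d)} \<union> {int k}"]) (auto simp: T_def)
  have inj: "inj_on fst {(q, r) \<in> freq a k \<times> freq a l. parallel q r}"
  proof (rule inj_onI, clarsimp)
    fix q r r' assume *: "q \<in> freq a k" "r \<in> freq a l" "r' \<in> freq a l" "parallel q r" "parallel q r'"
    show "r = r'"
    unfolding vec_eq_iff
    proof (rule allI)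
      fix i
      have "int k * r $ i = int k * r' $ i"
        using parallel_freq[OF *(1,2,4) assms(1), of i] parallel_freq[OF *(1,3,5) assms(1), of i] by simp
      then show "r $ i = r' $ i" using assms(1) by simp
    qed
  qed
  have img: "fst ` {(q, r) \<in> freq a k \<times> freq a l. parallel q r} \<subseteq> {q. \<forall>i. q $ i \<in> T i}"
  proof clarsimp
    fix q r i assume *: "q \<in> freq a k" "r \<in> freq a l" "parallel q r"
    have "int (g * d) * r $ i = int (g * (l div g)) * q $ i"
      using parallel_freq[OF * assms(1), of i] g by simp
    then have "int g * (int d * r $ i) = int g * (int (l div g) * q $ i)"
      by (simp only: of_nat_mult mult.assoc)
    then have "int d * r $ i = int (l div g) * q $ i" using g(1) by simp
    then have "int d dvd int (l div g) * q $ i" by (metis dvd_triv_left)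
    then have "int d dvd q $ i" using cop by (simp add: coprime_dvd_mult_right_iff)
    then show "q $ i \<in> T i" using *(1) g(2) by (auto simp: T_def freq_def)
  qed
  have "card {(q, r) \<in> freq a k \<times> freq a l. parallel q r} \<le> card {q. \<forall>i. q $ i \<in> T i}"
    by (rule card_inj_on_le[OF inj img]) (rule card_int_vec(1), rule T)
  also have "\<dots> = (\<Prod>i\<in>UNIV. card (T i))" by (rule card_int_vec(2), rule T)
  also have "\<dots> = (\<Prod>i\<in>(UNIV::'n set). if i = a then 1 else g)"
    using card_multiples[OF g(3), of g] by (intro prod.cong) (auto simp: T_def)
  also have "\<dots> = g ^ (CARD('n) - 1)" by (rule prod_if_eq_const)
  finally show ?thesis by (simp add: g_def)
qed

section \<open>Second moment of the number of resonant sets containing a point\<close>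

lemma sum_measure_Int_le:
  assumes "finite J" "\<And>x. x \<in> J \<Longrightarrow> W x \<in> fmeasurable M" "E \<in> fmeasurable M" "\<alpha> > 0"
  shows "(\<Sum>x\<in>J. measure M (W x \<inter> E)) \<le> (\<alpha> * (\<Sum>x\<in>J. \<Sum>y\<in>J. measure M (W x \<inter> W y)) + measure M E / \<alpha>) / 2"
proof -
  have int: "integrable M (indicator (A \<inter> B) :: _ \<Rightarrow> real)" if "A \<in> fmeasurable M" "B \<in> fmeasurable M" for A B
    using fmeasurable.Int[OF that] by (auto simp: fmeasurable_def)
  have E: "integrable M (indicator E :: _ \<Rightarrow> real)" using assms(3) by (auto simp: fmeasurable_def)
  have m: "measure M A = integral\<^sup>L M (indicator A)" if "A \<in> sets M" for A
    using that sets.sets_into_space[OF that] by (simp add: Int_absorb2)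
  note sets = fmeasurableD[OF assms(2)] fmeasurableD[OF assms(3)]
  have "(\<Sum>x\<in>J. measure M (W x \<inter> E)) = (\<integral>z. (\<Sum>x\<in>J. indicator (W x \<inter> E) z) \<partial>M)"
    by (subst Bochner_Integration.integral_sum) (use int assms m sets in auto)
  also have "\<dots> \<le> (\<integral>z. (\<alpha> * (\<Sum>x\<in>J. \<Sum>y\<in>J. indicator (W x \<inter> W y) z) + indicator E z / \<alpha>) / 2 \<partial>M)"
  proof (rule integral_mono)
    show "integrable M (\<lambda>z. \<Sum>x\<in>J. indicator (W x \<inter> E) z :: real)" using int assms by auto
    show "integrable M (\<lambda>z. (\<alpha> * (\<Sum>x\<in>J. \<Sum>y\<in>J. indicator (W x \<inter> W y) z) + indicator E z / \<alpha>) / 2)"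
      using int assms E by (intro integrable_divide_zero Bochner_Integration.integrable_add integrable_mult_right Bochner_Integration.integrable_sum) auto
    fix z
    define t where "t = (\<Sum>x\<in>J. indicator (W x) z :: real)"
    have 1: "(\<Sum>x\<in>J. indicator (W x \<inter> E) z) = t * indicator E z"
      by (simp add: t_def indicator_inter_arith sum_distrib_right)
    have 2: "(\<Sum>x\<in>J. \<Sum>y\<in>J. indicator (W x \<inter> W y) z) = t * t"
      by (simp add: t_def indicator_inter_arith sum_product)
    \<comment> \<open>With \<open>t\<close> the number of sets containing \<open>z\<close>, the
      square yields \<open>2 * t \<le> \<alpha> * (t * t) + 1 / \<alpha>\<close>: Cauchy-Schwarz
      with a free weight, linear both in the second moment and in the measure of
      \<open>E\<close>.\<close>
    have "0 \<le> (\<alpha> * t - 1)\<^sup>2 / \<alpha>" using assms(4) by simp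
    also have "\<dots> = \<alpha> * (t * t) - 2 * t + 1 / \<alpha>"
      using assms(4) by (simp add: power2_eq_square field_simps)
    finally show "(\<Sum>x\<in>J. indicator (W x \<inter> E) z) \<le> (\<alpha> * (\<Sum>x\<in>J. \<Sum>y\<in>J. indicator (W x \<inter> W y) z) + indicator E z / \<alpha>) / 2"
      unfolding 1 2 using assms(4) by (auto simp: indicator_def)
  qed
  also have "\<dots> = (\<alpha> * (\<Sum>x\<in>J. \<Sum>y\<in>J. \<integral>z. indicator (W x \<inter> W y) z \<partial>M) + (\<integral>z. indicator E z \<partial>M) / \<alpha>) / 2"
    using int assms E by (simp add: Bochner_Integration.integral_sum Bochner_Integration.integrable_sum)
  also have "\<dots> = (\<alpha> * (\<Sum>x\<in>J. \<Sum>y\<in>J. measure M (W x \<inter> W y)) + measure M E / \<alpha>) / 2"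
    using m sets by (simp cong: sum.cong)
  finally show ?thesis .
qed

lemma half_open_cube_fmeasurable: "half_open_cube \<in> fmeasurable lborel"
  by (auto simp: fmeasurable_def emeasure_half_open_cube)

lemma freq_nonzero: "q \<in> freq a k \<Longrightarrow> k \<ge> 1 \<Longrightarrow> q \<noteq> 0"
  by (auto simp: freq_def vec_eq_iff intro!: exI[of _ a])

text \<open>The larger norm \<open>k\<close> goes into the denominator of the excess, so that the
  excess can be summed over \<open>l \<le> k\<close>. The constants 32 and 8 turn into powers of 16
  and 8 once radii are rewritten as side lengths.\<close>

lemma measure_resonant_pair_le:
  fixes c :: "nat \<Rightarrow> real ^ 'm" and \<psi> :: "nat \<Rightarrow> real" and a :: "'n::finite"
  assumes \<psi>: "\<And>k. 0 < \<psi> k" "\<And>k. \<psi> k \<le> 1/4"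
    and qr: "q \<in> freq a k" "r \<in> freq a l" "1 \<le> l" "l \<le> k"
  shows "measure lborel ((half_open_cube \<inter> resonant q (c k) (\<psi> k)) \<inter> (half_open_cube \<inter> resonant r (c l) (\<psi> l)))
    \<le> 16 ^ CARD('m) * ((2 * \<psi> k) ^ CARD('m) * (2 * \<psi> l) ^ CARD('m) +
         (if parallel q r then (2 * \<psi> k) ^ CARD('m) * (real (gcd k l) / k) ^ CARD('m) else 0))"
    (is "measure lborel ?S \<le> 16 ^ ?m * (?v + ?R)")
proof -
  have S: "?S = half_open_cube \<inter> resonant q (c k) (\<psi> k) \<inter> resonant r (c l) (\<psi> l)" by auto
  have v0: "0 \<le> ?v" "0 \<le> ?R" using \<psi>(1)[of k] \<psi>(1)[of l] by auto
  have "emeasure lborel ?S \<le> ennreal (16 ^ ?m * (?v + ?R))"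
  proof (cases "parallel q r")
    case False
    then have "emeasure lborel ?S = ennreal ?v"
      unfolding S using \<psi>(1)[of k] \<psi>(1)[of l] \<psi>(2)[of k] \<psi>(2)[of l] freq_nonzero[OF qr(1)] qr
      by (intro emeasure_resonant_independent) (auto simp: parallel_def)
    also have "?v \<le> 16 ^ ?m * (?v + ?R)"
      using v0 mult_mono[of 1 "16 ^ ?m" ?v "?v + ?R"] by simp
    finally show ?thesis using ennreal_leI by (metis order_trans order_refl)
  next
    case True
    have "emeasure lborel ?S \<le> ennreal (2 ^ ?m * ((32 * \<psi> k * \<psi> l) ^ ?m + (8 * gcd k l * (\<psi> k / k)) ^ ?m))"
      unfolding S using qr
      by (intro emeasure_resonant_dependent[where a = a] \<psi>) (auto simp: freq_def)
    also have "2 ^ ?m * ((32 * \<psi> k * \<psi> l) ^ ?m + (8 * gcd k l * (\<psi> k / k)) ^ ?m)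
        = 16 ^ ?m * ?v + 8 ^ ?m * ((2 * \<psi> k) ^ ?m * (real (gcd k l) / k) ^ ?m)"
    proof -
      have 1: "2 * (32 * \<psi> k * \<psi> l) = 16 * ((2 * \<psi> k) * (2 * \<psi> l))" by simp
      have 2: "2 * (8 * gcd k l * (\<psi> k / k)) = 8 * ((2 * \<psi> k) * (real (gcd k l) / k))" by simp
      have "2 ^ ?m * (32 * \<psi> k * \<psi> l) ^ ?m = 16 ^ ?m * ?v"
        by (simp only: power_mult_distrib[symmetric] 1)
      moreover have "2 ^ ?m * (8 * gcd k l * (\<psi> k / k)) ^ ?m = 8 ^ ?m * ((2 * \<psi> k) ^ ?m * (real (gcd k l) / k) ^ ?m)"
        by (simp only: power_mult_distrib[symmetric] 2)
      ultimately show ?thesis by (simp only: distrib_left)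
    qed
    also have "\<dots> \<le> 16 ^ ?m * ?v + 16 ^ ?m * ((2 * \<psi> k) ^ ?m * (real (gcd k l) / k) ^ ?m)"
      using \<psi>(1)[of k] by (intro add_left_mono mult_right_mono power_mono) auto
    also have "\<dots> = 16 ^ ?m * (?v + ?R)" using True by (simp add: distrib_left)
    finally show ?thesis by (simp add: ennreal_leI)
  qed
  then show ?thesis
    unfolding measure_def using v0 by (intro enn2real_leI) auto
qed

lemma sum_measure_resonant_pairs_le:
  fixes c :: "nat \<Rightarrow> real ^ 'm" and \<psi> :: "nat \<Rightarrow> real" and a :: "'n::finite" and N N' :: nat
  assumes \<psi>: "\<And>k. 0 < \<psi> k" "\<And>k. \<psi> k \<le> 1/4"
    and N: "N \<ge> 1" and dim: "CARD('n) + CARD('m) \<ge> 4"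
  defines "J \<equiv> Sigma {N..N'} (freq a)"
  defines "W \<equiv> \<lambda>(k, q). half_open_cube \<inter> resonant q (c k) (\<psi> k)"
  defines "S \<equiv> \<Sum>k=N..N'. real k ^ (CARD('n) - 1) * (2 * \<psi> k) ^ CARD('m)"
  shows "(\<Sum>x\<in>J. \<Sum>y\<in>J. measure lborel (W x \<inter> W y)) \<le> 16 ^ CARD('m) * (S * S + 4 * S)"
proof -
  define v where "v k = (2 * \<psi> k) ^ CARD('m)" for k
  have v0: "v k > 0" for k using \<psi>(1)[of k] by (simp add: v_def)
  \<comment> \<open>The excess of a parallel pair, charged to the order with the larger norm first;
    in general a pair is bounded with \<open>R x y + R y x\<close>.\<close>
  define R where "R = (\<lambda>(k, q :: int ^ 'n) (l, r). if l \<le> k \<and> parallel q r then v k * (real (gcd k l) / k) ^ CARD('m) else 0)"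
  have R0: "R x y \<ge> 0" for x y using v0 by (auto simp: R_def less_imp_le split: prod.splits)
  have fin: "finite J"
    unfolding J_def using N by (intro finite_SigmaI finite_freq) auto
  have pair: "measure lborel (W x \<inter> W y) \<le> 16 ^ CARD('m) * (v (fst x) * v (fst y) + (R x y + R y x))"
    if "x \<in> J" "y \<in> J" for x y
  proof -
    obtain k q l r where xy: "x = (k, q)" "y = (l, r)" by (cases x, cases y)
    with that have *: "q \<in> freq a k" "r \<in> freq a l" "1 \<le> k" "1 \<le> l"
      using N by (auto simp: J_def)
    show ?thesis
    proof (cases "l \<le> k")
      case True
      have "measure lborel (W x \<inter> W y) \<le> 16 ^ CARD('m) * (v k * v l + R x y)"
        using measure_resonant_pair_le[where \<psi> = \<psi>, OF \<psi> *(1,2,4) True, of c] True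
        unfolding xy W_def v_def R_def by simp
      also have "\<dots> \<le> 16 ^ CARD('m) * (v (fst x) * v (fst y) + (R x y + R y x))"
        using R0[of y x] by (intro mult_left_mono) (auto simp: xy)
      finally show ?thesis .
    next
      case False
      then have "k \<le> l" by simp
      have "measure lborel (W y \<inter> W x) \<le> 16 ^ CARD('m) * (v l * v k + R y x)"
        using measure_resonant_pair_le[where \<psi> = \<psi>, OF \<psi> *(2,1,3) \<open>k \<le> l\<close>, of c] \<open>k \<le> l\<close>
        unfolding xy W_def v_def R_def by simp
      also have "\<dots> \<le> 16 ^ CARD('m) * (v (fst x) * v (fst y) + (R x y + R y x))"
        using R0[of x y] by (intro mult_left_mono) (auto simp: xy)
      finally show ?thesis by (simp add: Int_commute)
    qed
  qed
  have card: "real (card (freq a k)) = real k ^ (CARD('n) - 1)" if "k \<in> {N..N'}" for k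
    using that N card_freq[of k a] by simp
  have S: "(\<Sum>x\<in>J. v (fst x)) = S"
  proof -
    have "(\<Sum>x\<in>J. v (fst x)) = (\<Sum>k=N..N'. \<Sum>q\<in>freq a k. v k)"
      unfolding J_def using N by (subst sum.Sigma) (auto simp: case_prod_unfold intro!: finite_freq)
    also have "\<dots> = S" unfolding S_def by (rule sum.cong) (simp_all add: card v_def)
    finally show ?thesis .
  qed
  have Rsum: "(\<Sum>x\<in>J. \<Sum>y\<in>J. R x y) \<le> 2 * S"
  proof -
    have "(\<Sum>x\<in>J. \<Sum>y\<in>J. R x y) = (\<Sum>k=N..N'. \<Sum>q\<in>freq a k. \<Sum>l=N..N'. \<Sum>r\<in>freq a l. R (k, q) (l, r))"
      unfolding J_def using N by (subst (1 2) sum.Sigma) (auto simp: case_prod_unfold intro!: finite_freq sum.cong)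
    also have "\<dots> = (\<Sum>k=N..N'. \<Sum>l=N..N'. \<Sum>q\<in>freq a k. \<Sum>r\<in>freq a l. R (k, q) (l, r))"
      by (rule sum.cong[OF refl], rule sum.swap)
    also have "\<dots> \<le> (\<Sum>k=N..N'. v k * real k ^ (CARD('n) - 1) * 2)"
    proof (rule sum_mono)
      fix k assume k: "k \<in> {N..N'}"
      have inner: "(\<Sum>q\<in>freq a k. \<Sum>r\<in>freq a l. R (k, q) (l, r)) \<le>
         (if l \<le> k then v k * real k ^ (CARD('n) - 1) * (real (gcd k l) / k) ^ (CARD('n) - 1 + CARD('m)) else 0)"
        if l: "l \<in> {N..N'}" for l
      proof (cases "l \<le> k")
        case True
        have "(\<Sum>q\<in>freq a k. \<Sum>r\<in>freq a l. R (k, q) (l, r))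
          = (\<Sum>x\<in>freq a k \<times> freq a l. if x \<in> {(q, r) \<in> freq a k \<times> freq a l. parallel q r} then v k * (real (gcd k l) / k) ^ CARD('m) else 0)"
          unfolding sum.cartesian_product using True by (intro sum.cong) (auto simp: R_def split: if_splits)
        also have "\<dots> = real (card {(q, r) \<in> freq a k \<times> freq a l. parallel q r}) * (v k * (real (gcd k l) / k) ^ CARD('m))"
        proof -
          have "finite (freq a k \<times> freq a l)" using k l N by (intro finite_cartesian_product finite_freq) auto
          moreover have "(freq a k \<times> freq a l) \<inter> {(q, r) \<in> freq a k \<times> freq a l. parallel q r} = {(q, r) \<in> freq a k \<times> freq a l. parallel q r}"
            by auto
          ultimately show ?thesis by (subst sum.inter_restrict[symmetric]) simp_all
        qed
        also have "\<dots> \<le> real (gcd k l ^ (CARD('n) - 1)) * (v k * (real (gcd k l) / k) ^ CARD('m))"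
        proof (rule mult_right_mono)
          show "real (card {(q, r) \<in> freq a k \<times> freq a l. parallel q r}) \<le> real (gcd k l ^ (CARD('n) - 1))"
            using k l N by (intro of_nat_mono card_parallel_pairs) auto
        qed (use v0[of k] in auto)
        \<comment> \<open>At most gcd^(n-1) parallel pairs, each with a factor (gcd/k)^m, combine to
          k^(n-1) times (gcd/k)^(n-1+m), whose exponent is at least 3.\<close>
        also have "\<dots> = v k * real k ^ (CARD('n) - 1) * (real (gcd k l) / k) ^ (CARD('n) - 1 + CARD('m))"
        proof -
          have *: "g ^ e * (w * (g / x) ^ m) = w * x ^ e * (g / x) ^ (e + m)" if "x > 0" for g x w :: real and e m :: nat
            using that by (simp add: power_add power_divide)
          have k0: "real k > 0" using k N by simp
          show ?thesis unfolding of_nat_power by (rule *[OF k0])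
        qed
        finally show ?thesis using True by simp
      qed (simp add: R_def)
      have "(\<Sum>l=N..N'. \<Sum>q\<in>freq a k. \<Sum>r\<in>freq a l. R (k, q) (l, r))
         \<le> (\<Sum>l=N..N'. if l \<le> k then v k * real k ^ (CARD('n) - 1) * (real (gcd k l) / k) ^ (CARD('n) - 1 + CARD('m)) else 0)"
        by (rule sum_mono) (rule inner)
      also have "\<dots> = (\<Sum>l\<in>{l\<in>{N..N'}. l \<le> k}. v k * real k ^ (CARD('n) - 1) * (real (gcd k l) / k) ^ (CARD('n) - 1 + CARD('m)))"
        by (rule sum.inter_filter[symmetric]) simp
      also have "\<dots> \<le> (\<Sum>l\<in>{1..k}. v k * real k ^ (CARD('n) - 1) * (real (gcd k l) / k) ^ (CARD('n) - 1 + CARD('m)))"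
        using N v0[of k] by (intro sum_mono2) auto
      also have "\<dots> = v k * real k ^ (CARD('n) - 1) * (\<Sum>l\<in>{1..k}. (real (gcd k l) / k) ^ (CARD('n) - 1 + CARD('m)))"
        by (simp add: sum_distrib_left)
      also have "\<dots> \<le> v k * real k ^ (CARD('n) - 1) * 2"
        using v0[of k] k N dim by (intro mult_left_mono sum_gcd_ratio_le) auto
      finally show "(\<Sum>l=N..N'. \<Sum>q\<in>freq a k. \<Sum>r\<in>freq a l. R (k, q) (l, r)) \<le> v k * real k ^ (CARD('n) - 1) * 2" .
    qed
    also have "\<dots> = 2 * S" by (simp add: S_def v_def sum_distrib_left mult_ac)
    finally show ?thesis .
  qed
  have "(\<Sum>x\<in>J. \<Sum>y\<in>J. measure lborel (W x \<inter> W y))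
      \<le> (\<Sum>x\<in>J. \<Sum>y\<in>J. 16 ^ CARD('m) * (v (fst x) * v (fst y) + (R x y + R y x)))"
    by (intro sum_mono pair)
  also have "\<dots> = 16 ^ CARD('m) * ((\<Sum>x\<in>J. v (fst x)) * (\<Sum>y\<in>J. v (fst y)) + ((\<Sum>x\<in>J. \<Sum>y\<in>J. R x y) + (\<Sum>x\<in>J. \<Sum>y\<in>J. R y x)))"
    by (simp add: sum.distrib sum_distrib_left[symmetric] sum_product)
  also have "(\<Sum>x\<in>J. \<Sum>y\<in>J. R y x) = (\<Sum>x\<in>J. \<Sum>y\<in>J. R x y)"
    by (rule sum.swap)
  also have "16 ^ CARD('m) * ((\<Sum>x\<in>J. v (fst x)) * (\<Sum>y\<in>J. v (fst y)) + ((\<Sum>x\<in>J. \<Sum>y\<in>J. R x y) + (\<Sum>x\<in>J. \<Sum>y\<in>J. R x y)))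
      \<le> 16 ^ CARD('m) * (S * S + 4 * S)"
    unfolding S using Rsum by (intro mult_left_mono) auto
  finally show ?thesis .
qed

section \<open>A single resonant set inside a given open set\<close>

lemma norm_axis: "norm (axis a x) = norm (x :: 'a::real_normed_vector)"
proof -
  have "(\<Sum>i\<in>UNIV. (norm (axis a x $ i))\<^sup>2) = (\<Sum>i\<in>UNIV. if i = a then (norm x)\<^sup>2 else 0)"
    by (rule sum.cong) (auto simp: axis_def)
  then show ?thesis by (simp add: norm_vec_def[of "axis a x"] L2_set_def)
qed

lemma norm_tensor_axis: "norm (tensor (axis a t) u) = \<bar>t\<bar> * norm u"
proof -
  have "tensor (axis a t) u = axis a (t *\<^sub>R u)"
    by (auto simp: tensor_def vec_eq_iff axis_def)
  then show ?thesis by (simp add: norm_axis)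
qed

lemma norm_half_open_cube_le: "u \<in> half_open_cube \<Longrightarrow> norm u \<le> CARD('m)" for u :: "real ^ 'm"
proof -
  assume "u \<in> half_open_cube"
  then have "(\<Sum>i\<in>UNIV. \<bar>u $ i\<bar>) \<le> (\<Sum>i\<in>(UNIV :: 'm set). 1)"
    by (intro sum_mono) (auto simp: half_open_cube_vec abs_le_iff less_imp_le intro: order_trans[of _ 0])
  then show ?thesis using norm_le_l1_cart[of u] by simp
qed

text \<open>Translations by \<open>tensor w u\<close> with \<open>u\<close> in the unit cube carry
  the form through one full period but move points by at most \<open>CARD('m) / k\<close>, less than
  \<open>\<rho>\<close>. Averaging over them gives \<open>K\<close> exactly its expected share
  without leaving \<open>G\<close>.\<close>

lemma emeasure_resonant_Int_ge:
  fixes c :: "real ^ 'm" and q :: "int ^ 'n"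
  assumes \<psi>: "0 \<le> \<psi>" "\<psi> \<le> 1/2" and q: "q $ a = int k" "k \<ge> 1"
    and K: "K \<in> sets borel" and G: "open G" "\<And>x. x \<in> K \<Longrightarrow> ball x \<rho> \<subseteq> G" and k: "real CARD('m) / k < \<rho>"
  shows "emeasure lborel (G \<inter> resonant q c \<psi>) \<ge> emeasure lborel K * ennreal ((2 * \<psi>) ^ CARD('m))"
proof -
  note [measurable] = K borel_open[OF G(1)]
  define w where "w = axis a (1 / real k)"
  have qw: "real_vec q \<bullet> w = 1" using q by (simp add: w_def inner_axis)
  let ?F = "indicator (target c \<psi>) :: real ^ 'm \<Rightarrow> ennreal"
  let ?I = "emeasure lborel (G \<inter> resonant q c \<psi>)"
  have "emeasure lborel K * ennreal ((2 * \<psi>) ^ CARD('m)) =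
     (\<integral>\<^sup>+x. indicator K x * (\<integral>\<^sup>+u. indicator half_open_cube u * ?F u \<partial>lborel) \<partial>lborel)"
    by (subst nn_integral_multc) (simp_all only: emeasure_target[OF \<psi>] nn_integral_indicator K sets_lborel borel_measurable_indicator)
  also have "\<dots> = (\<integral>\<^sup>+x. indicator K x * (\<integral>\<^sup>+u. indicator half_open_cube u * ?F (u + real_vec q v* x) \<partial>lborel) \<partial>lborel)"
    by (intro nn_integral_cong arg_cong2[where f = "(*)"] refl nn_integral_torus_shift[symmetric])
       (simp_all add: indicator_target_periodic)
  also have "\<dots> = (\<integral>\<^sup>+x. \<integral>\<^sup>+u. indicator K x * (indicator half_open_cube u * ?F (u + real_vec q v* x)) \<partial>lborel \<partial>lborel)"
    by (rule nn_integral_cong, rule nn_integral_cmult[symmetric]) measurable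
  also have "\<dots> = (\<integral>\<^sup>+u. \<integral>\<^sup>+x. indicator K x * (indicator half_open_cube u * ?F (u + real_vec q v* x)) \<partial>lborel \<partial>lborel)"
    by (rule nn_integral_swap) (simp add: borel_prod[symmetric])
  also have "\<dots> \<le> (\<integral>\<^sup>+u. indicator (half_open_cube :: (real^'m) set) u * ?I \<partial>lborel)"
  proof (rule nn_integral_mono)
    fix u :: "real ^ 'm"
    show "(\<integral>\<^sup>+x. indicator K x * (indicator half_open_cube u * ?F (u + real_vec q v* x)) \<partial>lborel) \<le> indicator half_open_cube u * ?I"
    proof (cases "u \<in> half_open_cube")
      case True
      have "norm (tensor w u) = 1 / k * norm u" by (simp add: w_def norm_tensor_axis)
      also have "\<dots> \<le> 1 / k * CARD('m)" by (intro mult_left_mono norm_half_open_cube_le True) auto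
      finally have tw: "norm (tensor w u) < \<rho>" using k by simp
      have "(\<integral>\<^sup>+x. indicator K x * (indicator half_open_cube u * ?F (u + real_vec q v* x)) \<partial>lborel)
         \<le> (\<integral>\<^sup>+x. indicator (G \<inter> resonant q c \<psi>) (x + tensor w u) \<partial>lborel)"
      proof (rule nn_integral_mono)
        fix x
        have "x + tensor w u \<in> ball x \<rho>" using tw by (simp add: dist_norm)
        then have "x \<in> K \<Longrightarrow> x + tensor w u \<in> G" using G(2) by blast
        moreover have "real_vec q v* (x + tensor w u) = u + real_vec q v* x"
          by (simp add: vec_mat_add_tensor qw)
        ultimately show "indicator K x * (indicator half_open_cube u * ?F (u + real_vec q v* x)) \<le> indicator (G \<inter> resonant q c \<psi>) (x + tensor w u)"
          by (auto simp: indicator_def resonant_def)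
      qed
      also have "\<dots> = ?I"
        by (subst nn_integral_lborel_shift[of "indicator (G \<inter> resonant q c \<psi>)"]) auto
      finally show ?thesis using True by simp
    qed simp
  qed
  also have "\<dots> = ?I"
    by (subst nn_integral_multc) (simp_all add: emeasure_half_open_cube)
  finally show ?thesis .
qed

section \<open>The Lebesgue measure statement\<close>

text \<open>If the truncated series converged, its terms would eventually drop below
  \<open>t ^ d\<close>. A term that is really truncated is at least \<open>t ^ d\<close>, so almost
  all terms would be the original ones.\<close>

lemma not_summable_min_power:
  fixes \<psi> :: "nat \<Rightarrow> real"
  assumes "\<And>k. \<psi> k > 0" "\<not> summable (\<lambda>k. real (Suc k) ^ e * \<psi> (Suc k) ^ d)" "t > 0"
  shows "\<not> summable (\<lambda>k. real (Suc k) ^ e * min (\<psi> (Suc k)) t ^ d)"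
proof
  assume sum: "summable (\<lambda>k. real (Suc k) ^ e * min (\<psi> (Suc k)) t ^ d)"
  have "(\<lambda>k. real (Suc k) ^ e * min (\<psi> (Suc k)) t ^ d) \<longlonglongrightarrow> 0"
    using sum by (rule summable_LIMSEQ_zero)
  then have "\<forall>\<^sub>F k in sequentially. real (Suc k) ^ e * min (\<psi> (Suc k)) t ^ d < t ^ d"
    by (rule order_tendstoD) (use assms(3) in auto)
  then have "\<forall>\<^sub>F k in sequentially. real (Suc k) ^ e * min (\<psi> (Suc k)) t ^ d = real (Suc k) ^ e * \<psi> (Suc k) ^ d"
  proof (eventually_elim)
    case (elim k)
    have "\<psi> (Suc k) \<le> t"
    proof (rule ccontr)
      assume "\<not> \<psi> (Suc k) \<le> t"
      then have "1 * t ^ d \<le> real (Suc k) ^ e * min (\<psi> (Suc k)) t ^ d"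
        using assms(3) by (intro mult_mono one_le_power) auto
      then show False using elim by simp
    qed
    then show ?case by (simp add: min_def)
  qed
  from summable_cong[OF this] show False using sum assms(2) by blast
qed

lemma partial_sums_unbounded:
  fixes f :: "nat \<Rightarrow> real"
  assumes "\<And>k. f k \<ge> 0" "\<not> summable (\<lambda>k. f (Suc k))"
  obtains N' where "(\<Sum>k=N..N'. f k) \<ge> 1"
proof (rule ccontr)
  assume "\<not> thesis"
  with that have "(\<Sum>k=N..N'. f k) < 1" for N' using not_le by blast
  then have *: "(\<Sum>k=N..N'. f k) \<le> 1" for N' by (simp add: less_imp_le)
  have "summable (\<lambda>k. f (k + N))"
  proof (rule summableI_nonneg_bounded[where x = 1])
    fix n
    have "(\<Sum>i<n. f (i + N)) = (\<Sum>k\<in>(\<lambda>i. i + N) ` {..<n}. f k)" by (subst sum.reindex) auto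
    also have "\<dots> \<le> (\<Sum>k=N..N+n. f k)" using assms(1) by (intro sum_mono2) auto
    also have "\<dots> \<le> 1" by (rule *)
    finally show "(\<Sum>i<n. f (i + N)) \<le> 1" .
  qed (use assms in auto)
  then have "summable f" by (simp only: summable_iff_shift)
  then have "summable (\<lambda>k. f (Suc k))" by (simp only: summable_Suc_iff)
  with assms(2) show False by contradiction
qed

lemma resonant_tail_full_aux:
  fixes c :: "nat \<Rightarrow> real ^ 'm" and \<psi> :: "nat \<Rightarrow> real" and a :: "'n::finite" and N :: nat
  assumes \<psi>: "\<And>k. 0 < \<psi> k" "\<And>k. \<psi> k \<le> 1/4"
    and div: "\<not> summable (\<lambda>k. real (Suc k) ^ (CARD('n) - 1) * \<psi> (Suc k) ^ CARD('m))"
    and dim: "CARD('n) + CARD('m) \<ge> 4"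
  shows "box 0 One - (\<Union>k\<in>{N..}. \<Union>q\<in>freq a k. resonant q (c k) (\<psi> k)) \<in> null_sets lborel"
proof -
  define D where "D = box 0 (One :: real ^ 'm ^ 'n) - (\<Union>k\<in>{N..}. \<Union>q\<in>freq a k. resonant q (c k) (\<psi> k))"
  have D: "D \<in> sets borel"
    unfolding D_def by (intro sets.Diff borel_open open_UN ballI open_resonant) auto
  have cube: "box 0 (One :: real ^ 'm ^ 'n) \<subseteq> half_open_cube"
    by (auto simp: half_open_cube_def mem_box less_imp_le)
  have "measure lborel D = 0"
  proof (rule ccontr)
    define \<delta> where "\<delta> = measure lborel D"
    \<comment> \<open>Since \<open>S \<ge> 1\<close>, the pair bound \<open>S * S + 4 * S\<close> is
      at most \<open>5 * (S * S)\<close>.\<close>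
    define C :: real where "C = 16 ^ CARD('m) * 5"
    assume "measure lborel D \<noteq> 0"
    then have \<delta>: "\<delta> > 0" by (simp add: \<delta>_def less_le)
    have C: "C > 0" by (simp add: C_def)
    \<comment> \<open>Chosen so that \<open>\<epsilon> * C = \<delta>\<close> and
      \<open>\<eta> / \<epsilon> \<le> \<delta> / 4\<close>. The argument ends with
      \<open>\<delta> - \<eta> \<le> 5 / 8 * \<delta>\<close>, impossible for
      \<open>\<eta> \<le> \<delta> / 16\<close>.\<close>
    define \<epsilon> \<eta> where "\<epsilon> = \<delta> / C" and "\<eta> = min (\<delta> / 16) (\<epsilon> * \<delta> / 4)"
    have \<epsilon>\<eta>: "\<epsilon> > 0" "\<eta> > 0" using \<delta> C by (auto simp: \<epsilon>_def \<eta>_def)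
    obtain G' where G': "open G'" "D \<subseteq> G'" "emeasure lborel (G' - D) < ennreal \<eta>"
      using outer_regular_lborel[OF D \<epsilon>\<eta>(2)] by blast
    define G where "G = G' \<inter> box 0 One"
    have G: "open G" "D \<subseteq> G" "G \<subseteq> box 0 One" "G \<in> sets borel"
      using G' by (auto simp: G_def D_def)
    have GD: "measure lborel (G - D) \<le> \<eta>"
    proof -
      have "emeasure lborel (G - D) \<le> emeasure lborel (G' - D)"
        using G' D by (intro emeasure_mono) (auto simp: G_def)
      then have "emeasure lborel (G - D) \<le> ennreal \<eta>" using G'(3) by simp
      then show ?thesis unfolding measure_def using \<epsilon>\<eta> by (intro enn2real_leI) auto
    qed
    have fm: "G \<in> fmeasurable lborel" "D \<in> fmeasurable lborel" "G - D \<in> fmeasurable lborel"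
      using G D by (auto intro!: fmeasurable_subset_unit_box)
    have G\<delta>: "\<delta> \<le> measure lborel G"
      unfolding \<delta>_def using G fm D by (intro measure_mono_fmeasurable) auto
    obtain K \<rho> where K: "K \<in> sets borel" "\<rho> > 0" "K \<subseteq> G" "\<And>x. x \<in> K \<Longrightarrow> ball x \<rho> \<subseteq> G"
      "measure lborel G - \<eta> < measure lborel K"
      using open_erosion[OF G(1) _ \<epsilon>\<eta>(2)] fm(1) by (auto simp: fmeasurable_def)
    obtain N1 :: nat where N1: "real CARD('m) / \<rho> < N1" using reals_Archimedean2 by blast
    \<comment> \<open>From \<open>N\<close> on the sets avoid \<open>D\<close>; from
      \<open>N1\<close> on the translations behind the local lower bound are shorter than
      \<open>\<rho>\<close>.\<close>
    define N0 where "N0 = max (max N N1) 1"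
    define F where "F k = real k ^ (CARD('n) - 1) * (2 * \<psi> k) ^ CARD('m)" for k
    have "\<not> summable (\<lambda>k. F (Suc k))"
    proof
      assume "summable (\<lambda>k. F (Suc k))"
      then have "summable (\<lambda>k. (1 / 2 ^ CARD('m)) * F (Suc k))" by (rule summable_mult)
      then show False using div by (simp add: F_def power_mult_distrib field_simps)
    qed
    moreover have F0: "F k \<ge> 0" for k using \<psi>(1)[of k] by (simp add: F_def)
    ultimately obtain N' where N': "(\<Sum>k=N0..N'. F k) \<ge> 1"
      using partial_sums_unbounded by blast
    define S where "S = (\<Sum>k=N0..N'. F k)"
    have S: "S \<ge> 1" using N' by (simp add: S_def)
    define J where "J = Sigma {N0..N'} (freq a)"
    define W where "W = (\<lambda>(k, q :: int ^ 'n). half_open_cube \<inter> resonant q (c k) (\<psi> k))"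
    have fin: "finite J"
      unfolding J_def by (intro finite_SigmaI finite_freq) (auto simp: N0_def)
    have Wf: "W x \<in> fmeasurable lborel" for x
      by (cases x) (auto simp: W_def half_open_cube_fmeasurable intro!: fmeasurable_Int_fmeasurable)
    have pairs: "(\<Sum>x\<in>J. \<Sum>y\<in>J. measure lborel (W x \<inter> W y)) \<le> C * S * S"
    proof -
      have "(\<Sum>x\<in>J. \<Sum>y\<in>J. measure lborel (W x \<inter> W y)) \<le> 16 ^ CARD('m) * (S * S + 4 * S)"
        unfolding J_def W_def S_def F_def by (rule sum_measure_resonant_pairs_le[OF \<psi> _ dim]) (simp add: N0_def)
      also have "\<dots> \<le> 16 ^ CARD('m) * (5 * (S * S))"
        using S by (intro mult_left_mono) auto
      finally show ?thesis by (simp add: C_def mult_ac)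
    qed
    have low: "(measure lborel G - \<eta>) * S \<le> (\<Sum>x\<in>J. measure lborel (W x \<inter> G))"
    proof -
      have each: "(measure lborel G - \<eta>) * (2 * \<psi> k) ^ CARD('m) \<le> measure lborel (W (k, q) \<inter> G)"
        if kq: "k \<in> {N0..N'}" "q \<in> freq a k" for k q
      proof -
        have k: "k \<ge> 1" "k \<ge> N1" using kq by (auto simp: N0_def)
        have "real CARD('m) / \<rho> < k" using N1 k(2) by linarith
        then have k\<rho>: "real CARD('m) / k < \<rho>" using K(2) k(1) by (simp add: field_simps)
        have "emeasure lborel K * ennreal ((2 * \<psi> k) ^ CARD('m)) \<le> emeasure lborel (G \<inter> resonant q (c k) (\<psi> k))"
          using \<psi>(1)[of k] \<psi>(2)[of k] kq k
          by (intro emeasure_resonant_Int_ge[OF _ _ _ k(1) K(1) G(1) K(4) k\<rho>]) (auto simp: freq_def)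
        also have "G \<inter> resonant q (c k) (\<psi> k) = W (k, q) \<inter> G"
          using G(3) cube by (auto simp: W_def)
        finally have "ennreal (measure lborel K * (2 * \<psi> k) ^ CARD('m)) \<le> ennreal (measure lborel (W (k, q) \<inter> G))"
          using fmeasurable_subset_unit_box[of K] K(1,3) G(3) fmeasurable.Int[OF Wf[of "(k, q)"] fm(1)] \<psi>(1)[of k]
          by (simp add: ennreal_mult emeasure_eq_measure2)
        then have "measure lborel K * (2 * \<psi> k) ^ CARD('m) \<le> measure lborel (W (k, q) \<inter> G)"
          by (simp add: ennreal_le_iff)
        moreover have "(measure lborel G - \<eta>) * (2 * \<psi> k) ^ CARD('m) \<le> measure lborel K * (2 * \<psi> k) ^ CARD('m)"
          using K(5) \<psi>(1)[of k] by (intro mult_right_mono) auto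
        ultimately show ?thesis by linarith
      qed
      have "(measure lborel G - \<eta>) * S = (\<Sum>k=N0..N'. \<Sum>q\<in>freq a k. (measure lborel G - \<eta>) * (2 * \<psi> k) ^ CARD('m))"
        unfolding S_def F_def sum_distrib_left
        by (rule sum.cong) (auto simp: card_freq N0_def)
      also have "\<dots> \<le> (\<Sum>k=N0..N'. \<Sum>q\<in>freq a k. measure lborel (W (k, q) \<inter> G))"
        by (intro sum_mono each) auto
      also have "\<dots> = (\<Sum>x\<in>J. measure lborel (W x \<inter> G))"
        unfolding J_def by (subst sum.Sigma) (auto simp: case_prod_unfold N0_def intro!: finite_freq)
      finally show ?thesis .
    qed
    have "(\<Sum>x\<in>J. measure lborel (W x \<inter> G)) = (\<Sum>x\<in>J. measure lborel (W x \<inter> (G - D)))"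
    proof (rule sum.cong[OF refl], rule arg_cong[where f = "measure lborel"])
      fix x assume "x \<in> J"
      then obtain k q where x: "x = (k, q)" "N \<le> k" "q \<in> freq a k" by (auto simp: J_def N0_def)
      then have "W x \<inter> D = {}" by (auto simp: W_def D_def)
      then show "W x \<inter> G = W x \<inter> (G - D)" by auto
    qed
    \<comment> \<open>The weight \<open>\<epsilon> / S\<close> makes both terms proportional to
      \<open>S\<close>, which then cancels.\<close>
    also have "\<dots> \<le> ((\<epsilon> / S) * (\<Sum>x\<in>J. \<Sum>y\<in>J. measure lborel (W x \<inter> W y)) + measure lborel (G - D) / (\<epsilon> / S)) / 2"
      using S \<epsilon>\<eta> fin Wf fm(3) by (intro sum_measure_Int_le) auto
    also have "\<dots> \<le> ((\<epsilon> / S) * (C * S * S) + \<eta> / (\<epsilon> / S)) / 2"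
      using S \<epsilon>\<eta> pairs GD by (intro divide_right_mono add_mono mult_left_mono) auto
    also have "\<dots> = (\<epsilon> * C + \<eta> / \<epsilon>) / 2 * S"
      using S by (simp add: field_simps)
    finally have "(measure lborel G - \<eta>) * S \<le> (\<epsilon> * C + \<eta> / \<epsilon>) / 2 * S" using low by linarith
    then have "measure lborel G - \<eta> \<le> (\<epsilon> * C + \<eta> / \<epsilon>) / 2"
      using S by (simp add: mult_le_cancel_right)
    also have "\<dots> \<le> (\<delta> + \<delta> / 4) / 2"
    proof (intro divide_right_mono add_mono)
      show "\<epsilon> * C \<le> \<delta>" using C by (simp add: \<epsilon>_def)
      show "\<eta> / \<epsilon> \<le> \<delta> / 4" using \<epsilon>\<eta> by (simp add: \<eta>_def divide_le_eq mult.commute min_def)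
    qed simp
    finally have "measure lborel G - \<eta> \<le> (\<delta> + \<delta> / 4) / 2" .
    moreover have "\<eta> \<le> \<delta> / 16" by (simp add: \<eta>_def)
    ultimately show False using G\<delta> \<delta> by (simp add: field_simps)
  qed
  moreover have "D \<in> fmeasurable lborel"
    by (rule fmeasurable_subset_unit_box) (auto simp: D_def D[unfolded D_def])
  ultimately have "emeasure lborel D = 0"
    by (simp only: emeasure_eq_measure2 ennreal_0)
  then have "D \<in> null_sets lborel" using D by (simp add: null_sets_def)
  then show ?thesis unfolding D_def .
qed

lemma resonant_mono: "\<psi> \<le> \<psi>' \<Longrightarrow> resonant q c \<psi> \<subseteq> resonant q c \<psi>'"
  by (auto simp: resonant_def target_def open_cube_def intro: less_le_trans)

text \<open>The pair estimates ask for radii at most 1/4; truncation there preserves divergence and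
  only shrinks the resonant sets.\<close>

theorem resonant_tail_full:
  fixes c :: "nat \<Rightarrow> real ^ 'm" and \<psi> :: "nat \<Rightarrow> real" and a :: "'n::finite" and N :: nat
  assumes "\<And>k. 0 < \<psi> k"
    and "\<not> summable (\<lambda>k. real (Suc k) ^ (CARD('n) - 1) * \<psi> (Suc k) ^ CARD('m))"
    and "CARD('n) + CARD('m) \<ge> 4"
  shows "box 0 One - (\<Union>k\<in>{N..}. \<Union>q\<in>freq a k. resonant q (c k) (\<psi> k)) \<in> null_sets lborel"
proof (rule null_sets_subset)
  show "box 0 One - (\<Union>k\<in>{N..}. \<Union>q\<in>freq a k. resonant q (c k) (min (\<psi> k) (1/4))) \<in> null_sets lborel"
    using assms by (intro resonant_tail_full_aux not_summable_min_power) auto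
  show "box 0 One - (\<Union>k\<in>{N..}. \<Union>q\<in>freq a k. resonant q (c k) (\<psi> k)) \<in> sets lborel"
    unfolding sets_lborel by (intro sets.Diff borel_open open_UN ballI open_resonant) auto
  show "box 0 One - (\<Union>k\<in>{N..}. \<Union>q\<in>freq a k. resonant q (c k) (\<psi> k))
    \<subseteq> box 0 One - (\<Union>k\<in>{N..}. \<Union>q\<in>freq a k. resonant q (c k) (min (\<psi> k) (1/4)))"
    by (intro Diff_mono UN_mono order_refl resonant_mono) auto
qed

section \<open>Mass transference inside slabs\<close>

text \<open>One sheet of a resonant set, for a single integer translate: if \<open>q\<close> is
  nonzero, a neighbourhood of an affine subspace of codimension \<open>CARD('m)\<close>.\<close>

definition slab :: "int ^ 'n \<Rightarrow> real ^ 'm \<Rightarrow> real \<Rightarrow> (real ^ 'm ^ 'n) set" where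
  "slab q e \<psi> = {x. real_vec q v* x \<in> open_cube e \<psi>}"

lemma open_slab: "open (slab q e \<psi>)"
proof -
  have "slab q e \<psi> = (\<lambda>x. real_vec q v* x) -` open_cube e \<psi>"
    by (auto simp: slab_def)
  then show ?thesis
    by (simp add: open_vimage open_open_cube continuous_on_vec_mat)
qed

lemma slab_borel [measurable]: "slab q e \<psi> \<in> sets borel"
  by (simp add: open_slab)

lemma resonant_eq_slabs: "resonant q c \<psi> = (\<Union>z\<in>int_lattice. slab q (c - z) \<psi>)"
  by (auto simp: resonant_def target_def slab_def open_cube_def algebra_simps)

section \<open>Volume of a slab inside a ball\<close>

lemma nn_integral_indicator_form:
  fixes e :: "real ^ 'm" and q :: "int ^ 'n"
  assumes [measurable]: "Y \<in> sets borel" and 0: "0 \<le> \<psi>"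
  shows "(\<integral>\<^sup>+u. \<integral>\<^sup>+x. indicator Y x * indicator (open_cube e \<psi>) (u + real_vec q v* x) \<partial>lborel \<partial>lborel)
    = emeasure lborel Y * ennreal ((2 * \<psi>) ^ CARD('m))"
proof -
  have "(\<integral>\<^sup>+u. \<integral>\<^sup>+x. indicator Y x * indicator (open_cube e \<psi>) (u + real_vec q v* x) \<partial>lborel \<partial>lborel)
    = (\<integral>\<^sup>+x. \<integral>\<^sup>+u. indicator Y x * indicator (open_cube e \<psi>) (u + real_vec q v* x) \<partial>lborel \<partial>lborel)"
    by (rule nn_integral_swap[symmetric]) (simp add: borel_prod[symmetric])
  also have "\<dots> = (\<integral>\<^sup>+x. indicator Y x * ennreal ((2 * \<psi>) ^ CARD('m)) \<partial>lborel)"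
  proof (rule nn_integral_cong)
    fix x :: "real ^ 'm ^ 'n"
    have "(\<integral>\<^sup>+u. indicator Y x * indicator (open_cube e \<psi>) (u + real_vec q v* x) \<partial>lborel)
        = indicator Y x * (\<integral>\<^sup>+u. indicator (open_cube e \<psi>) (u + real_vec q v* x) \<partial>lborel)"
      by (rule nn_integral_cmult) measurable
    also have "(\<integral>\<^sup>+u. indicator (open_cube e \<psi>) (u + real_vec q v* x) \<partial>lborel) = (\<integral>\<^sup>+u. indicator (open_cube e \<psi>) u \<partial>lborel)"
      by (rule nn_integral_lborel_shift) measurable
    also have "\<dots> = ennreal ((2 * \<psi>) ^ CARD('m))"
      by (simp add: emeasure_open_cube 0)
    finally show "(\<integral>\<^sup>+u. indicator Y x * indicator (open_cube e \<psi>) (u + real_vec q v* x) \<partial>lborel) = indicator Y x * ennreal ((2 * \<psi>) ^ CARD('m))" .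
  qed
  also have "\<dots> = emeasure lborel Y * ennreal ((2 * \<psi>) ^ CARD('m))"
    by (subst nn_integral_multc) simp_all
  finally show ?thesis .
qed

lemma nn_integral_window_slab:
  fixes e :: "real ^ 'm" and q :: "int ^ 'n"
  assumes [measurable]: "X \<in> sets borel" and 0: "0 \<le> T"
  shows "emeasure lborel (X \<inter> slab q e \<psi>) * ennreal ((2 * T) ^ CARD('m)) =
    (\<integral>\<^sup>+u. \<integral>\<^sup>+x. indicator (open_cube (0 :: real ^ 'm) T) u * indicator (X \<inter> slab q e \<psi>) (x + tensor w u) \<partial>lborel \<partial>lborel)"
proof -
  have "(\<integral>\<^sup>+x. indicator (open_cube (0 :: real ^ 'm) T) u * indicator (X \<inter> slab q e \<psi>) (x + tensor w u) \<partial>lborel)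
    = indicator (open_cube 0 T) u * emeasure lborel (X \<inter> slab q e \<psi>)" for u
  proof -
    have "(\<integral>\<^sup>+x. indicator (X \<inter> slab q e \<psi>) (x + tensor w u) \<partial>lborel) = emeasure lborel (X \<inter> slab q e \<psi>)"
      by (subst nn_integral_lborel_shift[of "indicator (X \<inter> slab q e \<psi>)"]) auto
    then show ?thesis by (subst nn_integral_cmult) auto
  qed
  then show ?thesis
    by (simp add: nn_integral_multc emeasure_open_cube 0 mult.commute)
qed

text \<open>Double counting of the pairs \<open>(x, u)\<close> with \<open>x + tensor w u\<close> in
  \<open>X \<inter> slab q e \<psi>\<close> and \<open>u\<close> in a window of half side
  \<open>T\<close>. For fixed \<open>u\<close> translation preserves volume; for fixed
  \<open>x\<close> in \<open>Y\<close> the admissible \<open>u\<close> lie in a cube of half side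
  \<open>\<psi>\<close>, as the form moves by \<open>u\<close> itself.\<close>

lemma slab_average_upper:
  fixes e :: "real ^ 'm" and q :: "int ^ 'n"
  assumes XY: "X \<in> sets borel" "Y \<in> sets borel" and qw: "real_vec q \<bullet> w = 1" and 0: "0 \<le> \<psi>" "0 \<le> T"
    and sub: "\<And>x u. u \<in> open_cube 0 T \<Longrightarrow> x + tensor w u \<in> X \<Longrightarrow> x \<in> Y"
  shows "emeasure lborel (X \<inter> slab q e \<psi>) * ennreal ((2 * T) ^ CARD('m)) \<le> emeasure lborel Y * ennreal ((2 * \<psi>) ^ CARD('m))"
  unfolding nn_integral_window_slab[OF XY(1) 0(2), of q e \<psi> w] nn_integral_indicator_form[OF XY(2) 0(1), of e q, symmetric]
  using sub by (intro nn_integral_mono) (auto simp: indicator_def slab_def vec_mat_add_tensor qw add.commute)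

text \<open>The same count in the other direction: now the window is wide enough to contain every
  \<open>u\<close> that sends a point of \<open>Y\<close> into the slab.\<close>

lemma slab_average_lower:
  fixes e :: "real ^ 'm" and q :: "int ^ 'n"
  assumes XY: "X \<in> sets borel" "Y \<in> sets borel" and qw: "real_vec q \<bullet> w = 1" and 0: "0 \<le> \<psi>" "0 \<le> T"
    and sub: "\<And>x u. x \<in> Y \<Longrightarrow> real_vec q v* x + u \<in> open_cube e \<psi> \<Longrightarrow> u \<in> open_cube 0 T \<and> x + tensor w u \<in> X"
  shows "emeasure lborel Y * ennreal ((2 * \<psi>) ^ CARD('m)) \<le> emeasure lborel (X \<inter> slab q e \<psi>) * ennreal ((2 * T) ^ CARD('m))"
  unfolding nn_integral_window_slab[OF XY(1) 0(2), of q e \<psi> w] nn_integral_indicator_form[OF XY(2) 0(1), of e q, symmetric]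
proof (intro nn_integral_mono)
  fix u :: "real ^ 'm" and x
  show "indicator Y x * indicator (open_cube e \<psi>) (u + real_vec q v* x)
    \<le> (indicator (open_cube (0 :: real ^ 'm) T) u * indicator (X \<inter> slab q e \<psi>) (x + tensor w u) :: ennreal)"
    using sub[of x u] by (auto simp: indicator_def slab_def vec_mat_add_tensor qw add.commute)
qed

lemma ball_fmeasurable: "ball x r \<in> fmeasurable lborel" for x :: "'a::euclidean_space"
  by (rule fmeasurableI[OF _ emeasure_lborel_ball_finite]) simp

lemma ball_fmeasurable_Int: "S \<in> sets borel \<Longrightarrow> ball x r \<inter> S \<in> fmeasurable lborel"
  for x :: "'a::euclidean_space"
  by (rule fmeasurable_Int_fmeasurable) (auto simp: ball_fmeasurable)

lemma norm_open_cube_le: "u \<in> open_cube 0 T \<Longrightarrow> norm u \<le> real CARD('m) * T" for u :: "real ^ 'm"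
proof -
  assume "u \<in> open_cube 0 T"
  then have "(\<Sum>i\<in>UNIV. \<bar>u $ i\<bar>) \<le> (\<Sum>i\<in>(UNIV :: 'm set). T)"
    by (intro sum_mono) (auto simp: open_cube_def less_imp_le)
  then show ?thesis using norm_le_l1_cart[of u] by simp
qed

text \<open>A window of half side \<open>k * s\<close> displaces points by at most
  \<open>CARD('m) * s\<close>, and the two cubes compare as \<open>(r / s) ^ CARD('m)\<close>. If
  the slab is wider than the ball, the volume of the ball itself suffices.\<close>

lemma content_ball_slab_le:
  fixes e :: "real ^ 'm" and q :: "int ^ 'n" and y :: "real ^ 'm ^ 'n" and k :: nat and r s :: real
  assumes "q $ a = int k" "k \<ge> 1" "s > 0" "r > 0"
  shows "measure lborel (ball y s \<inter> slab q e (real k * r)) \<le>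
    ((1 + real CARD('m)) * s) ^ DIM(real ^ 'm ^ 'n) * measure lborel (ball (0 :: real ^ 'm ^ 'n) 1) * (min r s / s) ^ CARD('m)"
    (is "?L \<le> ?C * ?w * _")
proof (cases "r \<le> s")
  case False
  have "?L \<le> measure lborel (ball y s)"
    by (intro measure_mono_fmeasurable fmeasurableI emeasure_lborel_ball_finite) auto
  also have "\<dots> = s ^ DIM(real ^ 'm ^ 'n) * ?w"
    using assms by (intro content_ball_conv_unit_ball) auto
  also have "\<dots> \<le> ?C * ?w"
    using assms by (intro mult_right_mono power_mono) auto
  finally show ?thesis using False assms by (simp add: min_def)
next
  case True
  define T where "T = real k * s"
  define w where "w = axis a (1 / real k)"
  have T: "T > 0" using assms by (simp add: T_def)
  have qw: "real_vec q \<bullet> w = 1" using assms by (simp add: w_def inner_axis)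
  have "emeasure lborel (ball y s \<inter> slab q e (real k * r)) * ennreal ((2 * T) ^ CARD('m))
      \<le> emeasure lborel (ball y ((1 + real CARD('m)) * s)) * ennreal ((2 * (real k * r)) ^ CARD('m))"
  proof (rule slab_average_upper[OF _ _ qw])
    fix x u assume u: "u \<in> open_cube 0 T" and x: "x + tensor w u \<in> ball y s"
    have "norm (tensor w u) = norm u / k" by (simp add: w_def norm_tensor_axis)
    also have "\<dots> \<le> CARD('m) * T / k" by (intro divide_right_mono norm_open_cube_le u) auto
    also have "\<dots> = CARD('m) * s" using assms by (simp add: T_def)
    finally have "norm (tensor w u) \<le> CARD('m) * s" .
    moreover have "dist y x \<le> dist y (x + tensor w u) + norm (tensor w u)"
      using norm_triangle_ineq[of "y - (x + tensor w u)" "tensor w u"] by (simp add: dist_norm)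
    ultimately show "x \<in> ball y ((1 + real CARD('m)) * s)"
      using x by (simp add: distrib_right)
  qed (use T assms in auto)
  then have "ennreal (?L * (2 * T) ^ CARD('m)) \<le> ennreal (measure lborel (ball y ((1 + real CARD('m)) * s)) * (2 * (real k * r)) ^ CARD('m))"
    using T assms
    by (simp add: ennreal_mult emeasure_eq_measure2 ball_fmeasurable_Int ball_fmeasurable)
  then have "?L * (2 * T) ^ CARD('m) \<le> measure lborel (ball y ((1 + real CARD('m)) * s)) * (2 * (real k * r)) ^ CARD('m)"
    using assms by (subst (asm) ennreal_le_iff) auto
  also have "measure lborel (ball y ((1 + real CARD('m)) * s)) = ?C * ?w"
    using assms by (intro content_ball_conv_unit_ball) auto
  also have "(2 * (real k * r)) ^ CARD('m) = (r / s) ^ CARD('m) * (2 * T) ^ CARD('m)"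
    using assms unfolding power_mult_distrib[symmetric] by (simp add: T_def field_simps)
  finally have "?L * (2 * T) ^ CARD('m) \<le> (?C * ?w * (r / s) ^ CARD('m)) * (2 * T) ^ CARD('m)"
    by (simp only: mult.assoc)
  then have "?L \<le> ?C * ?w * (r / s) ^ CARD('m)"
    using T by (simp only: mult_le_cancel_right_pos zero_less_power zero_less_mult_iff zero_less_numeral simp_thms)
  then show ?thesis using True by (simp add: min_def)
qed

lemma vec_mat_nth_diff_le:
  fixes q :: "real ^ 'n" and x y :: "real ^ 'm ^ 'n" and k :: real
  assumes "\<And>i. \<bar>q $ i\<bar> \<le> k"
  shows "\<bar>(q v* x) $ j - (q v* y) $ j\<bar> \<le> CARD('n) * k * dist x y"
proof -
  have "(q v* x) $ j - (q v* y) $ j = (\<Sum>i\<in>UNIV. q $ i * (x $ i $ j - y $ i $ j))"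
    by (simp add: vec_mat_nth sum_subtractf right_diff_distrib)
  also have "\<bar>\<dots>\<bar> \<le> (\<Sum>i\<in>UNIV. \<bar>q $ i * (x $ i $ j - y $ i $ j)\<bar>)" by (rule sum_abs)
  also have "\<dots> \<le> (\<Sum>i\<in>(UNIV :: 'n set). k * dist x y)"
  proof (rule sum_mono)
    fix i
    have "\<bar>x $ i $ j - y $ i $ j\<bar> \<le> dist (x $ i) (y $ i)"
      using component_le_norm_cart[of "x $ i - y $ i" j] by (simp add: dist_norm)
    also have "\<dots> \<le> dist x y" by (rule dist_vec_nth_le)
    finally have "\<bar>q $ i\<bar> * \<bar>x $ i $ j - y $ i $ j\<bar> \<le> k * dist x y"
      using assms[of i] by (intro mult_mono) auto
    then show "\<bar>q $ i * (x $ i $ j - y $ i $ j)\<bar> \<le> k * dist x y" by (simp add: abs_mult)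
  qed
  finally show ?thesis by simp
qed

lemma content_ball_slab_ge:
  fixes e :: "real ^ 'm" and q :: "int ^ 'n" and x0 :: "real ^ 'm ^ 'n" and k :: nat and r R :: real
  assumes q: "q \<in> freq a k" "k \<ge> 1" and R: "0 < r" "r \<le> R" and x0: "x0 \<in> slab q e (real k * R)"
  shows "R ^ DIM(real ^ 'm ^ 'n) * measure lborel (ball (0 :: real ^ 'm ^ 'n) 1) * (r / ((real CARD('n) + 2) * R)) ^ CARD('m)
    \<le> measure lborel (ball x0 ((1 + real CARD('m) * (real CARD('n) + 2)) * R) \<inter> slab q e (real k * r))"
    (is "?C * ?w * _ \<le> ?L")
proof -
  \<comment> \<open>For \<open>x\<close> within \<open>R\<close> of \<open>x0\<close>, a shift into
    the slab has entries below \<open>k * r + k * R + CARD('n) * k * R\<close>, which is at most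
    \<open>T\<close>. The resulting displacement, at most
    \<open>CARD('m) * (CARD('n) + 2) * R\<close>, accounts for the radius of the larger
    ball.\<close>
  define T where "T = real k * ((real CARD('n) + 2) * R)"
  define w where "w = axis a (1 / real k)"
  have T: "T > 0" using assms by (simp add: T_def)
  have qw: "real_vec q \<bullet> w = 1" using q by (simp add: w_def inner_axis freq_def)
  have "emeasure lborel (ball x0 R) * ennreal ((2 * (real k * r)) ^ CARD('m))
    \<le> emeasure lborel (ball x0 ((1 + real CARD('m) * (real CARD('n) + 2)) * R) \<inter> slab q e (real k * r)) * ennreal ((2 * T) ^ CARD('m))"
  proof (rule slab_average_lower[OF _ _ qw], goal_cases)
    case (5 x u)
    have u: "u \<in> open_cube 0 T"
      unfolding open_cube_def
    proof (intro CollectI allI)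
      fix j
      have 1: "\<bar>(real_vec q v* x) $ j + u $ j - e $ j\<bar> < real k * r"
        using 5 by (simp add: open_cube_def)
      have 2: "\<bar>(real_vec q v* x0) $ j - e $ j\<bar> < real k * R"
        using x0 by (simp add: slab_def open_cube_def)
      have "\<bar>(real_vec q v* x) $ j - (real_vec q v* x0) $ j\<bar> \<le> CARD('n) * real k * dist x x0"
      proof (rule vec_mat_nth_diff_le)
        fix i
        have "1 \<le> q $ i" "q $ i \<le> int k" using q by (auto simp: freq_def)
        then have "\<bar>q $ i\<bar> \<le> int k" by simp
        then have "of_int \<bar>q $ i\<bar> \<le> (of_int (int k) :: real)" by (simp only: of_int_le_iff)
        then show "\<bar>real_vec q $ i\<bar> \<le> real k" by simp
      qed
      also have "\<dots> \<le> CARD('n) * real k * R"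
        using 5 by (intro mult_left_mono) (auto simp: dist_commute)
      finally have "\<bar>u $ j\<bar> < real k * r + real k * R + CARD('n) * real k * R" using 1 2 by linarith
      also have "\<dots> \<le> real k * R + real k * R + CARD('n) * real k * R"
        using R by (intro add_mono mult_left_mono) auto
      also have "\<dots> = T" by (simp add: T_def algebra_simps)
      finally show "\<bar>u $ j - 0 $ j\<bar> < T" by simp
    qed
    have "norm (tensor w u) = norm u / k" by (simp add: w_def norm_tensor_axis)
    also have "\<dots> \<le> CARD('m) * T / k" by (intro divide_right_mono norm_open_cube_le u) auto
    also have "\<dots> = real CARD('m) * (real CARD('n) + 2) * R" using q by (simp add: T_def)
    finally have "norm (tensor w u) \<le> real CARD('m) * (real CARD('n) + 2) * R" .
    moreover have "dist x0 (x + tensor w u) \<le> dist x0 x + norm (tensor w u)"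
      using norm_triangle_ineq4[of "x0 - x" "tensor w u"] by (simp add: dist_norm diff_diff_eq)
    ultimately have "x + tensor w u \<in> ball x0 ((1 + real CARD('m) * (real CARD('n) + 2)) * R)"
      using 5 by (simp add: distrib_right)
    then show ?case using u by simp
  qed (use T R in auto)
  then have "ennreal (measure lborel (ball x0 R) * (2 * (real k * r)) ^ CARD('m)) \<le> ennreal (?L * (2 * T) ^ CARD('m))"
    using T assms
    by (simp add: ennreal_mult emeasure_eq_measure2 ball_fmeasurable_Int ball_fmeasurable)
  then have "measure lborel (ball x0 R) * (2 * (real k * r)) ^ CARD('m) \<le> ?L * (2 * T) ^ CARD('m)"
    using T by (subst (asm) ennreal_le_iff) auto
  also have "measure lborel (ball x0 R) = ?C * ?w"
    using R by (intro content_ball_conv_unit_ball) auto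
  also have "(2 * (real k * r)) ^ CARD('m) = (r / ((real CARD('n) + 2) * R)) ^ CARD('m) * (2 * T) ^ CARD('m)"
  proof -
    have e: "2 * (real k * r) = r / ((real CARD('n) + 2) * R) * (2 * T)"
      using R by (simp add: T_def)
    show ?thesis by (simp only: e) (simp only: power_mult_distrib)
  qed
  finally have "(?C * ?w * (r / ((real CARD('n) + 2) * R)) ^ CARD('m)) * (2 * T) ^ CARD('m) \<le> ?L * (2 * T) ^ CARD('m)"
    by (simp only: mult.assoc)
  then show ?thesis
    using T by (simp only: mult_le_cancel_right_pos zero_less_power zero_less_mult_iff zero_less_numeral simp_thms)
qed

section \<open>Mass bounds for volume redistributed over slabs\<close>

lemma sum_content_disjoint_le:
  fixes B :: "'i \<Rightarrow> 'a::euclidean_space set"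
  assumes "finite I" "disjoint_family_on B I" "\<And>i. i \<in> I \<Longrightarrow> B i \<in> sets borel"
    "\<And>i. i \<in> I \<Longrightarrow> B i \<subseteq> ball y R"
  shows "(\<Sum>i\<in>I. measure lborel (B i)) \<le> measure lborel (ball y R)"
proof -
  have B: "B i \<in> fmeasurable lborel" if "i \<in> I" for i
  proof -
    have "B i = ball y R \<inter> B i" using assms(4)[OF that] by auto
    then show ?thesis using ball_fmeasurable_Int[OF assms(3)[OF that], of y R] by simp
  qed
  have "(\<Sum>i\<in>I. measure lborel (B i)) = measure lborel (\<Union>i\<in>I. B i)"
  proof (rule measure_finite_Union[OF assms(1) _ assms(2), symmetric])
    show "B ` I \<subseteq> sets lborel" using assms(3) by auto
    show "emeasure lborel (B i) \<noteq> \<infinity>" if "i \<in> I" for i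
      using fmeasurableD2[OF B[OF that]] by simp
  qed
  also have "\<dots> \<le> measure lborel (ball y R)"
  proof (rule measure_mono_fmeasurable[OF _ _ ball_fmeasurable])
    show "(\<Union>i\<in>I. B i) \<subseteq> ball y R" using assms(4) by (rule UN_least)
    show "(\<Union>i\<in>I. B i) \<in> sets lborel" using assms(1,3) by (intro sets.finite_UN) auto
  qed
  finally show ?thesis .
qed

text \<open>Bounds the mass of \<open>ball y s\<close> when each piece \<open>E i\<close> carries
  the volume of its own ball. Pieces with \<open>s \<le> R i\<close> that meet the ball are few by
  packing, and each obeys \<open>big\<close>; those with \<open>R i < s\<close> contribute at most
  the volume of disjoint balls near \<open>y\<close>, of order \<open>s ^ DIM('a)\<close>.\<close>

lemma weighted_pieces_sum_le:
  fixes x :: "'i \<Rightarrow> 'a::euclidean_space" and E :: "'i \<Rightarrow> 'a set" and R :: "'i \<Rightarrow> real"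
  assumes I: "finite I" and R: "\<And>i. i \<in> I \<Longrightarrow> R i > 0" and \<kappa>: "\<kappa> \<ge> 1" and s: "s > 0" and A: "A \<ge> 0" and \<phi>: "s ^ DIM('a) \<le> \<phi>"
    and disj: "disjoint_family_on (\<lambda>i. cball (x i) (2 * \<kappa> * R i)) I"
    and E: "\<And>i. i \<in> I \<Longrightarrow> E i \<in> sets borel" "\<And>i. i \<in> I \<Longrightarrow> E i \<subseteq> ball (x i) (\<kappa> * R i)" "\<And>i. i \<in> I \<Longrightarrow> measure lborel (E i) > 0"
    and big: "\<And>i. i \<in> I \<Longrightarrow> s \<le> R i \<Longrightarrow>
       measure lborel (cball (x i) (2 * \<kappa> * R i)) * measure lborel (E i \<inter> ball y s) \<le> A * \<phi> * measure lborel (E i)"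
  shows "(\<Sum>i\<in>I. measure lborel (cball (x i) (2 * \<kappa> * R i)) / measure lborel (E i) * measure lborel (E i \<inter> ball y s))
    \<le> (2 ^ DIM('a) * A + (1 + 3 * \<kappa>) ^ DIM('a) * measure lborel (ball (0::'a) 1)) * \<phi>"
proof -
  define B where "B i = cball (x i) (2 * \<kappa> * R i)" for i
  define t where "t i = measure lborel (B i) / measure lborel (E i) * measure lborel (E i \<inter> ball y s)" for i
  let ?w = "measure lborel (ball (0::'a) 1)"
  have w: "?w > 0" by (simp add: content_ball_pos)
  have \<phi>0: "\<phi> > 0" using \<phi> s by (meson less_le_trans zero_less_power)
  define I0 I1 where "I0 = {i \<in> I. E i \<inter> ball y s \<noteq> {} \<and> s \<le> R i}" and "I1 = {i \<in> I. E i \<inter> ball y s \<noteq> {} \<and> R i < s}"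
  have fin: "finite I0" "finite I1" using I by (auto simp: I0_def I1_def)
  have t0: "t i = 0" if "i \<in> I - (I0 \<union> I1)" for i
    using that by (auto simp: t_def I0_def I1_def not_le)
  have "(\<Sum>i\<in>I. t i) = (\<Sum>i\<in>I0 \<union> I1. t i)"
    using I t0 by (intro sum.mono_neutral_right) (auto simp: I0_def I1_def)
  also have "\<dots> = (\<Sum>i\<in>I0. t i) + (\<Sum>i\<in>I1. t i)"
    using fin by (intro sum.union_disjoint) (auto simp: I0_def I1_def)
  also have "(\<Sum>i\<in>I0. t i) \<le> 2 ^ DIM('a) * A * \<phi>"
  proof -
    have "\<forall>i\<in>I0. \<exists>z. z \<in> E i \<inter> ball y s" by (auto simp: I0_def)
    then obtain z where z: "\<And>i. i \<in> I0 \<Longrightarrow> z i \<in> E i \<inter> ball y s" by metis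
    \<comment> \<open>The factor 2 in \<open>2 * \<kappa> * R i\<close> is spent here:
      \<open>E i\<close> stays within half the radius, so a ball of radius
      \<open>s \<le> R i\<close> about any of its points fits inside \<open>B i\<close>.
      Disjointness then leaves at most \<open>2 ^ DIM('a)\<close> such pieces in
      \<open>ball y (2 * s)\<close>.\<close>
    have zB: "ball (z i) s \<subseteq> B i" if "i \<in> I0" for i
    proof
      fix v assume v: "v \<in> ball (z i) s"
      have "dist (x i) v \<le> dist (x i) (z i) + dist (z i) v" by (rule dist_triangle)
      moreover have "dist (x i) (z i) < \<kappa> * R i" using z[OF that] E(2)[of i] that by (auto simp: I0_def)
      moreover have "1 * s \<le> \<kappa> * R i" using that \<kappa> s by (intro mult_mono) (auto simp: I0_def)
      ultimately show "v \<in> B i" using v by (auto simp: B_def)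
    qed
    have "real (card I0) * (s ^ DIM('a) * ?w) = (\<Sum>i\<in>I0. measure lborel (ball (z i) s))"
      by (simp only: content_ball_conv_unit_ball[OF less_imp_le[OF s]] sum_constant)
    also have "\<dots> \<le> measure lborel (ball y (2 * s))"
    proof (rule sum_content_disjoint_le[OF fin(1)])
      show "disjoint_family_on (\<lambda>i. ball (z i) s) I0"
        unfolding disjoint_family_on_def
      proof (intro ballI impI)
        fix i j assume ij: "i \<in> I0" "j \<in> I0" "i \<noteq> j"
        then have "B i \<inter> B j = {}"
          using disjoint_family_onD[OF disj, of i j] by (simp add: B_def I0_def)
        then show "ball (z i) s \<inter> ball (z j) s = {}" using zB[OF ij(1)] zB[OF ij(2)] by blast
      qed
      fix i assume i: "i \<in> I0"
      show "ball (z i) s \<subseteq> ball y (2 * s)"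
      proof
        fix v assume "v \<in> ball (z i) s"
        moreover have "dist y (z i) < s" using z[OF i] by simp
        ultimately show "v \<in> ball y (2 * s)" using dist_triangle[of y v "z i"] by simp
      qed
    qed auto
    also have "\<dots> = (2 * s) ^ DIM('a) * ?w"
      using s by (intro content_ball_conv_unit_ball) auto
    also have "\<dots> = 2 ^ DIM('a) * (s ^ DIM('a) * ?w)" by (simp add: power_mult_distrib)
    finally have card: "real (card I0) \<le> 2 ^ DIM('a)"
      using s w by (simp add: mult_le_cancel_right)
    have "(\<Sum>i\<in>I0. t i) \<le> (\<Sum>i\<in>I0. A * \<phi>)"
    proof (rule sum_mono)
      fix i assume "i \<in> I0"
      then show "t i \<le> A * \<phi>"
        using big[of i] E(3)[of i] by (simp add: t_def I0_def B_def pos_divide_le_eq)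
    qed
    also have "\<dots> = real (card I0) * (A * \<phi>)" by simp
    also have "\<dots> \<le> 2 ^ DIM('a) * (A * \<phi>)" using card A \<phi>0 by (intro mult_right_mono) auto
    finally show ?thesis by (simp add: mult.assoc)
  qed
  also have "(\<Sum>i\<in>I1. t i) \<le> (1 + 3 * \<kappa>) ^ DIM('a) * ?w * \<phi>"
  proof -
    have "(\<Sum>i\<in>I1. t i) \<le> (\<Sum>i\<in>I1. measure lborel (B i))"
    proof (rule sum_mono)
      fix i assume i: "i \<in> I1"
      then have iI: "i \<in> I" by (simp add: I1_def)
      have "E i = ball (x i) (\<kappa> * R i) \<inter> E i" using E(2)[OF iI] by auto
      then have "E i \<in> fmeasurable lborel"
        using ball_fmeasurable_Int[OF E(1)[OF iI], of "x i" "\<kappa> * R i"] by simp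
      then have "measure lborel (E i \<inter> ball y s) \<le> measure lborel (E i)"
        using E(1)[OF iI] by (intro measure_mono_fmeasurable) auto
      then have "t i \<le> measure lborel (B i) / measure lborel (E i) * measure lborel (E i)"
        unfolding t_def by (intro mult_left_mono) auto
      then show "t i \<le> measure lborel (B i)" using E(3)[OF iI] by simp
    qed
    also have "\<dots> \<le> measure lborel (ball y ((1 + 3 * \<kappa>) * s))"
    proof (rule sum_content_disjoint_le[OF fin(2)])
      show "disjoint_family_on B I1"
        using disjoint_family_on_mono[of I1 I B] disj by (auto simp: I1_def B_def[abs_def])
      fix i assume i: "i \<in> I1"
      then obtain z where z: "z \<in> E i" "dist y z < s" by (auto simp: I1_def)
      have "dist (x i) z < \<kappa> * R i" using z E(2)[of i] i by (auto simp: I1_def)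
      moreover have "\<kappa> * R i \<le> \<kappa> * s" using i \<kappa> by (intro mult_left_mono) (auto simp: I1_def)
      ultimately have d: "dist y (x i) < s + \<kappa> * s" "2 * \<kappa> * R i \<le> 2 * \<kappa> * s"
        using dist_triangle[of y "x i" z] z by (auto simp: dist_commute)
      show "B i \<subseteq> ball y ((1 + 3 * \<kappa>) * s)"
      proof
        fix v assume "v \<in> B i"
        then have "dist y v < s + \<kappa> * s + 2 * \<kappa> * s" using d dist_triangle[of y v "x i"] by (auto simp: B_def)
        then show "v \<in> ball y ((1 + 3 * \<kappa>) * s)" by (simp add: algebra_simps)
      qed
    qed (auto simp: B_def)
    also have "\<dots> = ((1 + 3 * \<kappa>) * s) ^ DIM('a) * ?w"
      using s \<kappa> by (intro content_ball_conv_unit_ball) auto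
    also have "\<dots> = (1 + 3 * \<kappa>) ^ DIM('a) * ?w * s ^ DIM('a)" by (simp add: power_mult_distrib)
    also have "\<dots> \<le> (1 + 3 * \<kappa>) ^ DIM('a) * ?w * \<phi>"
      using \<phi> \<kappa> w by (intro mult_left_mono) auto
    finally show ?thesis .
  qed
  finally show ?thesis by (simp add: t_def B_def distrib_right)
qed

text \<open>Compare the upper bound for the slab in \<open>ball y s\<close> with the lower bound for
  the whole piece. The width cancels through \<open>min r s / s = r / max r s\<close>; the surviving
  \<open>R ^ CARD('m)\<close> will be \<open>g r / M\<close>.\<close>

lemma piece_mass_le:
  fixes e :: "real ^ 'm" and q :: "int ^ 'n" and x0 y :: "real ^ 'm ^ 'n" and k :: nat and r R s \<kappa> :: real
  assumes q: "q \<in> freq a k" "k \<ge> 1" and r: "0 < r" "r \<le> R" and x0: "x0 \<in> slab q e (real k * R)"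
    and s: "0 < s" "s \<le> R" and \<kappa>: "\<kappa> = 1 + real CARD('m) * (real CARD('n) + 2)"
  shows "measure lborel (cball x0 (2 * \<kappa> * R)) * measure lborel ((ball x0 (\<kappa> * R) \<inter> slab q e (real k * r)) \<inter> ball y s)
    \<le> (2 * \<kappa> * (1 + real CARD('m))) ^ DIM(real ^ 'm ^ 'n) * (real CARD('n) + 2) ^ CARD('m) * measure lborel (ball (0 :: real ^ 'm ^ 'n) 1)
       * (R ^ CARD('m) * s ^ DIM(real ^ 'm ^ 'n) / max r s ^ CARD('m)) * measure lborel (ball x0 (\<kappa> * R) \<inter> slab q e (real k * r))"
proof -
  let ?d = "DIM(real ^ 'm ^ 'n)" and ?w = "measure lborel (ball (0 :: real ^ 'm ^ 'n) 1)" and ?m = "CARD('m)"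
  let ?E = "ball x0 (\<kappa> * R) \<inter> slab q e (real k * r)"
  have w: "?w > 0" by (simp add: content_ball_pos)
  have \<kappa>0: "\<kappa> > 0" unfolding \<kappa> by (simp add: add_pos_nonneg)
  have R0: "R > 0" using r by simp
  have B: "measure lborel (cball x0 (2 * \<kappa> * R)) = (2 * \<kappa>) ^ ?d * R ^ ?d * ?w"
  proof -
    have "measure lborel (cball x0 (2 * \<kappa> * R)) = (2 * \<kappa> * R) ^ ?d * ?w"
      unfolding content_cball_conv_ball using \<kappa>0 R0 by (intro content_ball_conv_unit_ball) auto
    then show ?thesis by (simp only: power_mult_distrib)
  qed
  have low: "R ^ ?d * ?w * (r / ((real CARD('n) + 2) * R)) ^ ?m \<le> measure lborel ?E"
    unfolding \<kappa> by (rule content_ball_slab_ge[OF q r x0])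
  have "measure lborel (?E \<inter> ball y s) \<le> measure lborel (ball y s \<inter> slab q e (real k * r))"
    by (intro measure_mono_fmeasurable ball_fmeasurable_Int) auto
  also have "\<dots> \<le> ((1 + real ?m) * s) ^ ?d * ?w * (min r s / s) ^ ?m"
    using q r s by (intro content_ball_slab_le[where a = a]) (auto simp: freq_def)
  finally have up: "measure lborel (?E \<inter> ball y s) \<le> ((1 + real ?m) * s) ^ ?d * ?w * (min r s / s) ^ ?m" .
  have "measure lborel (cball x0 (2 * \<kappa> * R)) * measure lborel (?E \<inter> ball y s)
     \<le> ((2 * \<kappa>) ^ ?d * R ^ ?d * ?w) * (((1 + real ?m) * s) ^ ?d * ?w * (min r s / s) ^ ?m)"
    unfolding B using up \<kappa>0 R0 w by (intro mult_left_mono) auto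
  also have "\<dots> = (2 * \<kappa> * (1 + real ?m)) ^ ?d * (real CARD('n) + 2) ^ ?m * ?w * (R ^ ?m * s ^ ?d / max r s ^ ?m)
      * (R ^ ?d * ?w * (r / ((real CARD('n) + 2) * R)) ^ ?m)"
  proof -
    have alg: "(a * b * w) * ((c * e) * w * (X / Y)) = (a * c) * N * w * (M * e / Y) * (b * w * (X / (N * M)))"
      if "N > 0" "M > 0" for a b c e w X Y N M :: real
      using that by simp
    have e1: "((1 + real ?m) * s) ^ ?d = (1 + real ?m) ^ ?d * s ^ ?d" by (rule power_mult_distrib)
    have e2: "(2 * \<kappa> * (1 + real ?m)) ^ ?d = (2 * \<kappa>) ^ ?d * (1 + real ?m) ^ ?d" by (rule power_mult_distrib)
    have e3: "(r / ((real CARD('n) + 2) * R)) ^ ?m = r ^ ?m / ((real CARD('n) + 2) ^ ?m * R ^ ?m)"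
      by (simp only: power_divide power_mult_distrib)
    have "min r s / s = r / max r s" using r s by (auto simp: min_def max_def)
    then have e4: "(min r s / s) ^ ?m = r ^ ?m / max r s ^ ?m" by (simp only: power_divide)
    show ?thesis
      unfolding e1 e2 e3 e4 by (rule alg) (use R0 in \<open>simp_all add: add_pos_pos\<close>)
  qed
  also have "\<dots> \<le> (2 * \<kappa> * (1 + real ?m)) ^ ?d * (real CARD('n) + 2) ^ ?m * ?w * (R ^ ?m * s ^ ?d / max r s ^ ?m) * measure lborel ?E"
    using low \<kappa>0 R0 w r s by (intro mult_left_mono) auto
  finally show ?thesis .
qed

lemma sphere_null_lborel: "sphere x r \<in> null_sets lborel" for x :: "'a::euclidean_space"
  using negligible_sphere[of x r] by (simp add: negligible_iff_null_sets null_sets_completion_iff borel_closed)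

text \<open>One stage of the nested construction, by contradiction: if the cover contained every
  open piece of a late slab in \<open>Q\<close> up to a null set, the redistributed volume of such
  pieces would be at most the mass seen by the covering balls, which the choice of \<open>M\<close>
  makes too small.\<close>

lemma mtp_step:
  fixes c :: "nat \<Rightarrow> real ^ 'm" and r :: "nat \<Rightarrow> real" and f g :: "real \<Rightarrow> real" and a :: "'n::finite"
    and b :: "nat \<Rightarrow> real ^ 'm ^ 'n" and \<rho> :: "nat \<Rightarrow> real" and Q :: "(real ^ 'm ^ 'n) set" and N :: nat
  defines "d \<equiv> DIM(real ^ 'm ^ 'n)" and "U \<equiv> \<Union>l. ball (b l) (\<rho> l)"
  assumes r: "\<And>k. k \<ge> 1 \<Longrightarrow> 0 < r k" "\<And>k. k \<ge> 1 \<Longrightarrow> r k \<le> 1 / real k"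
    and g: "mono_on {0<..} g" "\<And>s. s > 0 \<Longrightarrow> g s > 0" "(g \<longlongrightarrow> 0) (at_right 0)"
    and f: "mono_on {0<..} f" "\<And>s. s > 0 \<Longrightarrow> f s > 0"
    and fg: "\<And>s. s > 0 \<Longrightarrow> f s * s ^ CARD('m) = g s * s ^ d"
    and anti: "\<And>s t. 0 < s \<Longrightarrow> s \<le> t \<Longrightarrow> f t / t ^ d \<le> f s / s ^ d"
    and inf: "\<And>M. \<exists>r0>0. \<forall>s. 0 < s \<and> s < r0 \<longrightarrow> M \<le> f s / s ^ d"
    and div: "\<not> summable (\<lambda>k. real (Suc k) ^ (CARD('n) + CARD('m) - 1) * g (r (Suc k)))"
    and dim: "CARD('n) + CARD('m) \<ge> 4"
    and \<rho>: "\<And>l. \<rho> l > 0" "summable (\<lambda>l. f (\<rho> l))"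
    and Q: "open Q" "Q \<subseteq> box 0 One" "Q - U \<notin> null_sets lborel"
  obtains k q z E where "k \<ge> N" "k \<ge> 1" "q \<in> freq a k" "z \<in> int_lattice" "open E"
    "E \<subseteq> Q \<inter> slab q (c k - z) (real k * r k)" "E - U \<notin> null_sets lborel"
proof (rule ccontr)
  assume "\<not> thesis"
  with that have null: "E - U \<in> null_sets lborel"
    if "k \<ge> N" "k \<ge> 1" "q \<in> freq a k" "z \<in> int_lattice" "open E" "E \<subseteq> Q \<inter> slab q (c k - z) (real k * r k)" for k q z E
    using that by blast
  let ?m = "CARD('m)"
  have Ub: "open U" unfolding U_def by (intro open_UN ballI open_ball)
  have QUf: "Q - U \<in> fmeasurable lborel"
    using Q Ub by (intro fmeasurable_subset_unit_box) auto
  define \<delta> where "\<delta> = measure lborel (Q - U)"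
  have "\<delta> > 0"
  proof -
    have "\<delta> \<noteq> 0"
    proof
      assume "\<delta> = 0"
      then have "emeasure lborel (Q - U) = 0"
        using emeasure_eq_measure2[OF QUf] by (simp add: \<delta>_def)
      then show False using Q(3) fmeasurableD[OF QUf] by (simp add: null_sets_def)
    qed
    then show ?thesis by (simp add: \<delta>_def less_le)
  qed
  define \<kappa> where "\<kappa> = 1 + real ?m * (real CARD('n) + 2)"
  have \<kappa>: "\<kappa> \<ge> 1" by (simp add: \<kappa>_def)
  define w where "w = measure lborel (ball (0 :: real ^ 'm ^ 'n) 1)"
  have w: "w > 0" by (simp add: w_def content_ball_pos)
  define A where "A = (2 * \<kappa> * (1 + real ?m)) ^ d * (real CARD('n) + 2) ^ ?m * w"
  have A: "A > 0" using \<kappa> w by (simp add: A_def add_pos_nonneg)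
  define C where "C = 2 ^ d * A + (1 + 3 * \<kappa>) ^ d * w"
  have C: "C > 0" using A \<kappa> w by (simp add: C_def add_pos_nonneg)
  define T where "T = (\<Sum>l. f (\<rho> l))"
  have T: "T \<ge> 0" unfolding T_def using \<rho> f(2) by (intro suminf_nonneg) (auto simp: less_imp_le)
  \<comment> \<open>Makes \<open>C * T / M\<close>, the most the cover can account for, at most
    \<open>\<delta> / (4 * 5 ^ d)\<close>, which the volume selected by Vitali's lemma
    exceeds.\<close>
  define M where "M = 1 + 4 * 5 ^ d * C * T / \<delta>"
  have M: "M \<ge> 1" using T C \<open>\<delta> > 0\<close> by (simp add: M_def)
  have CTM: "C * T / M \<le> \<delta> / (4 * 5 ^ d)"
  proof -
    have "\<delta> / (4 * 5 ^ d) * M = \<delta> / (4 * 5 ^ d) + C * T"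
      using \<open>\<delta> > 0\<close> by (simp add: M_def field_simps)
    then have "C * T \<le> \<delta> / (4 * 5 ^ d) * M" using \<open>\<delta> > 0\<close> by simp
    then show ?thesis using M by (simp add: pos_divide_le_eq)
  qed
  obtain r0 where r0: "r0 > 0" "\<And>s. 0 < s \<Longrightarrow> s < r0 \<Longrightarrow> M \<le> f s / s ^ d" using inf[of M] by blast
  \<comment> \<open>Covering balls too large for \<open>M * s ^ d \<le> f s\<close>. They are
    finitely many, since \<open>f (\<rho> l)\<close> tends to 0 but is at least \<open>f r0\<close>
    on them, and they are cut out of \<open>Q\<close>.\<close>
  define L0 where "L0 = {l. r0 \<le> \<rho> l}"
  have "finite L0"
  proof -
    have "(\<lambda>l. f (\<rho> l)) \<longlonglongrightarrow> 0" by (rule summable_LIMSEQ_zero[OF \<rho>(2)])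
    then have "\<forall>\<^sub>F l in sequentially. f (\<rho> l) < f r0" using f(2)[OF r0(1)] by (rule order_tendstoD)
    then obtain l0 where l0: "\<And>l. l \<ge> l0 \<Longrightarrow> f (\<rho> l) < f r0" by (auto simp: eventually_sequentially)
    have "L0 \<subseteq> {..<l0}"
    proof
      fix l assume "l \<in> L0"
      then have "f r0 \<le> f (\<rho> l)" using f(1) r0(1) \<rho>(1)[of l] by (auto simp: L0_def intro: mono_onD)
      then show "l \<in> {..<l0}" using l0[of l] by (auto simp: not_le[symmetric])
    qed
    then show ?thesis by (rule finite_subset) simp
  qed
  \<comment> \<open>Closed balls are removed to keep \<open>W\<close> open; their spheres are null,
    so \<open>W\<close> still has measure at least \<open>\<delta>\<close>.\<close>
  define W where "W = Q - (\<Union>l\<in>L0. cball (b l) (\<rho> l))"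
  have W: "open W" "W \<subseteq> Q"
    unfolding W_def using \<open>finite L0\<close> Q(1) by (auto intro!: open_Diff closed_UN)
  have Wf: "W \<in> fmeasurable lborel" using W Q(2) by (intro fmeasurable_subset_unit_box) auto
  have \<delta>W: "\<delta> \<le> measure lborel W"
  proof -
    define Z where "Z = (\<Union>l\<in>L0. sphere (b l) (\<rho> l))"
    have Z: "Z \<in> null_sets lborel"
      unfolding Z_def using \<open>finite L0\<close> by (intro null_sets.finite_UN sphere_null_lborel) auto
    have sub: "Q - U \<subseteq> W \<union> Z"
      by (auto simp: W_def Z_def U_def sphere_def not_less) (metis order_antisym)
    have "emeasure lborel (Q - U) \<le> emeasure lborel (W \<union> Z)"
      using sub W Z by (intro emeasure_mono) (auto simp: null_sets_def)
    also have "\<dots> = emeasure lborel W"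
      using W Z by (intro emeasure_Un_null_set) auto
    finally show ?thesis
      using emeasure_eq_measure2[OF QUf] emeasure_eq_measure2[OF Wf] by (simp add: \<delta>_def)
  qed
  obtain K \<rho>0 where K: "K \<in> sets borel" "\<rho>0 > 0" "K \<subseteq> W" "\<And>x. x \<in> K \<Longrightarrow> ball x \<rho>0 \<subseteq> W"
    "measure lborel W - \<delta> / 2 < measure lborel K"
    using open_erosion[OF W(1), of "\<delta> / 2"] Wf \<open>\<delta> > 0\<close> by (auto simp: fmeasurable_def)
  have Kf: "K \<in> fmeasurable lborel" using K(1,3) W(2) Q(2) by (intro fmeasurable_subset_unit_box) auto
  \<comment> \<open>The enlarged radius, with \<open>R k ^ CARD('m) = g (r k) / M\<close>: the
    Lebesgue series for the radii \<open>k * R k\<close> is \<open>1 / M\<close> times the given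
    divergent series.\<close>
  define R where "R k = root ?m (g (r k) / M)" for k
  have R: "R k > 0" "R k ^ ?m = g (r k) / M" if "k \<ge> 1" for k
    using g(2)[OF r(1)[OF that]] M by (auto simp: R_def real_root_pow_pos2)
  define \<epsilon> where "\<epsilon> = \<rho>0 / (4 * \<kappa>)"
  have \<epsilon>: "\<epsilon> > 0" using K(2) \<kappa> by (simp add: \<epsilon>_def)
  have "\<forall>\<^sub>F s in at_right 0. g s < M * \<epsilon> ^ ?m"
    using g(3) by (rule order_tendstoD) (use M \<epsilon> in auto)
  then obtain s0 where s0: "s0 > 0" "\<And>s. 0 < s \<Longrightarrow> s < s0 \<Longrightarrow> g s < M * \<epsilon> ^ ?m"
    by (auto simp: eventually_at_right_field)
  obtain N1 :: nat where N1: "1 / min s0 r0 < N1" using reals_Archimedean2 by blast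
  define N2 where "N2 = max (max N N1) 1"
  have small: "r k < s0" "r k < r0" if "k \<ge> N2" for k
  proof -
    have k: "k \<ge> 1" "real N1 \<le> real k" using that by (auto simp: N2_def)
    then have "1 / min s0 r0 < real k" using N1 by linarith
    moreover have "min s0 r0 > 0" using s0(1) r0(1) by simp
    ultimately have "1 / real k < min s0 r0" using k(1) by (simp only: pos_divide_less_eq mult.commute)
    then show "r k < s0" "r k < r0" using r(2)[OF k(1)] by auto
  qed
  have Rsmall: "R k < \<epsilon>" if "k \<ge> N2" for k
  proof -
    have k: "k \<ge> 1" using that by (auto simp: N2_def)
    have "R k ^ ?m < \<epsilon> ^ ?m"
      using s0(2)[OF r(1)[OF k] small(1)[OF that]] M by (simp add: R(2)[OF k] pos_divide_less_eq mult.commute)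
    then show ?thesis using \<epsilon> by (simp add: power_less_imp_less_base)
  qed
  \<comment> \<open>For small \<open>r k\<close>, the bound \<open>M \<le> f s / s ^ d\<close> says
    \<open>M * r k ^ CARD('m) \<le> g (r k)\<close>: the thin slab lies inside the enlarged
    one.\<close>
  have rR: "r k \<le> R k" if "k \<ge> N2" for k
  proof -
    have k: "k \<ge> 1" using that by (auto simp: N2_def)
    have rk: "r k > 0" by (rule r(1)[OF k])
    have "M * r k ^ d \<le> f (r k)" using r0(2)[OF rk small(2)[OF that]] rk by (simp add: pos_le_divide_eq)
    then have "M * r k ^ d * r k ^ ?m \<le> g (r k) * r k ^ d"
      using rk by (simp flip: fg[OF rk])
    then have "M * r k ^ ?m \<le> g (r k)" using rk by (simp add: mult.assoc mult.commute[of _ "r k ^ d"] mult.left_commute[of _ "r k ^ d"])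
    then have "r k ^ ?m \<le> R k ^ ?m" using M by (simp add: R(2)[OF k] pos_le_divide_eq mult.commute)
    then show ?thesis using R(1)[OF k] by (simp add: power_mono_iff[of "r k" "R k" ?m] rk less_imp_le)
  qed
  \<comment> \<open>The value at 0 serves positivity at all indices; the frequencies start at
    \<open>N2 \<ge> 1\<close>.\<close>
  define \<psi> where "\<psi> k = (if k = 0 then 1 else real k * R k)" for k
  define V where "V = (\<Union>k\<in>{N2..}. \<Union>q\<in>freq a k. resonant q (c k) (\<psi> k) :: (real ^ 'm ^ 'n) set)"
  have full: "box 0 One - V \<in> null_sets lborel"
    unfolding V_def
  proof (rule resonant_tail_full[OF _ _ dim])
    show "\<psi> k > 0" for k using R(1)[of k] by (auto simp: \<psi>_def)
    have eq: "M * (real (Suc k) ^ (CARD('n) - 1) * \<psi> (Suc k) ^ ?m) = real (Suc k) ^ (CARD('n) + ?m - 1) * g (r (Suc k))" for k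
    proof -
      have "CARD('n) + ?m - 1 = (CARD('n) - 1) + ?m" by simp
      then have "real (Suc k) ^ (CARD('n) + ?m - 1) = real (Suc k) ^ (CARD('n) - 1) * real (Suc k) ^ ?m" by (simp only: power_add)
      moreover have "\<psi> (Suc k) ^ ?m = real (Suc k) ^ ?m * (g (r (Suc k)) / M)"
        unfolding \<psi>_def using R(2)[of "Suc k"] by (simp add: power_mult_distrib)
      ultimately show ?thesis using M by simp
    qed
    show "\<not> summable (\<lambda>k. real (Suc k) ^ (CARD('n) - 1) * \<psi> (Suc k) ^ ?m)"
    proof
      assume "summable (\<lambda>k. real (Suc k) ^ (CARD('n) - 1) * \<psi> (Suc k) ^ ?m)"
      then have "summable (\<lambda>k. M * (real (Suc k) ^ (CARD('n) - 1) * \<psi> (Suc k) ^ ?m))" by (rule summable_mult)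
      then show False using div by (simp only: eq)
    qed
  qed
  have Vo: "open V" unfolding V_def by (intro open_UN ballI open_resonant)
  define K' where "K' = K \<inter> V"
  have K'f: "K' \<in> fmeasurable lborel" unfolding K'_def using Kf Vo by (intro fmeasurable_Int_fmeasurable) auto
  have K'\<delta>: "\<delta> / 2 < measure lborel K'"
  proof -
    have "K - K' \<in> null_sets lborel"
    proof (rule null_sets_subset[OF full])
      show "K - K' \<subseteq> box 0 One - V" using K(3) W(2) Q(2) by (auto simp: K'_def)
    qed (use K(1) Vo in \<open>auto simp: K'_def\<close>)
    then have "measure lborel (K' \<union> (K - K')) = measure lborel K'"
      using K'f by (intro measure_Un_null_set) auto
    moreover have "K' \<union> (K - K') = K" by (auto simp: K'_def)
    ultimately show ?thesis using K(5) \<delta>W by simp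
  qed
  have "\<forall>x\<in>K'. \<exists>k q z. k \<ge> N2 \<and> q \<in> freq a k \<and> z \<in> int_lattice \<and> x \<in> slab q (c k - z) (real k * R k)"
    by (auto simp: K'_def V_def resonant_eq_slabs \<psi>_def N2_def split: if_splits) (metis Suc_leI le0 max.bounded_iff not_less_eq_eq)+
  then obtain kk qq zz where kqz: "\<And>x. x \<in> K' \<Longrightarrow> kk x \<ge> N2" "\<And>x. x \<in> K' \<Longrightarrow> qq x \<in> freq a (kk x)" "\<And>x. x \<in> K' \<Longrightarrow> zz x \<in> int_lattice"
    "\<And>x. x \<in> K' \<Longrightarrow> x \<in> slab (qq x) (c (kk x) - zz x) (real (kk x) * R (kk x))"
    by metis
  have kk1: "kk x \<ge> 1" "kk x \<ge> N" if "x \<in> K'" for x using kqz(1)[OF that] by (auto simp: N2_def)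
  define t where "t x = 2 * \<kappa> * R (kk x)" for x
  have t: "0 < t x \<and> t x \<le> \<rho>0" if "x \<in> K'" for x
  proof -
    have "t x \<le> 2 * \<kappa> * \<epsilon>" unfolding t_def using Rsmall[OF kqz(1)[OF that]] \<kappa> by (intro mult_left_mono) auto
    also have "\<dots> \<le> \<rho>0" using \<kappa> K(2) by (simp add: \<epsilon>_def)
    finally show ?thesis using R(1)[OF kk1(1)[OF that]] \<kappa> by (simp add: t_def)
  qed
  obtain D where D: "countable D" "D \<subseteq> K'" "pairwise (\<lambda>i j. disjnt (cball i (t i)) (cball j (t j))) D"
    "K' \<subseteq> (\<Union>i\<in>D. cball i (5 * t i))"
  proof (rule Vitali_covering_lemma_cballs[of K' "\<lambda>x. x" t K' \<rho>0])
    show "K' \<subseteq> (\<Union>i\<in>K'. cball i (t i))" using t by (force simp: less_imp_le)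
  qed (use t in auto)
  have "K' \<noteq> {}" using K'\<delta> \<open>\<delta> > 0\<close> by auto
  then have "D \<noteq> {}" using D(4) by auto
  \<comment> \<open>Initial segments of an enumeration of \<open>D\<close> give a finite subfamily
    whose fivefold balls still meet \<open>K'\<close> in measure above
    \<open>\<delta> / 4\<close>.\<close>
  define F where "F j = from_nat_into D ` {..<j}" for j
  have Ffin: "finite (F j)" "F j \<subseteq> D" for j
    using from_nat_into[OF \<open>D \<noteq> {}\<close>] by (auto simp: F_def)
  have UF: "(\<Union>j. F j) = D"
  proof
    show "D \<subseteq> (\<Union>j. F j)"
    proof
      fix x assume "x \<in> D"
      then obtain j where "x = from_nat_into D j"
        using range_from_nat_into[OF \<open>D \<noteq> {}\<close> D(1)] by (metis rangeE)
      then have "x \<in> F (Suc j)" by (auto simp: F_def)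
      then show "x \<in> (\<Union>j. F j)" by blast
    qed
  qed (use Ffin in auto)
  define Y where "Y j = K' \<inter> (\<Union>i\<in>F j. cball i (5 * t i))" for j
  have Ys: "Y j \<in> sets lborel" for j
    unfolding Y_def using K'f Ffin by (intro sets.Int sets.finite_UN) auto
  have UY: "(\<Union>j. Y j) = K'" unfolding Y_def using D(4) UF by blast
  have "(\<lambda>j. measure lborel (Y j)) \<longlonglongrightarrow> measure lborel (\<Union>j. Y j)"
  proof (rule Lim_measure_incseq)
    show "incseq Y" unfolding Y_def F_def by (intro monoI) fastforce
    show "emeasure lborel (\<Union>j. Y j) \<noteq> \<infinity>" using K'f by (simp add: UY fmeasurable_def less_top)
  qed (use Ys in auto)
  then have "\<forall>\<^sub>F j in sequentially. \<delta> / 4 < measure lborel (Y j)"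
    unfolding UY by (rule order_tendstoD) (use K'\<delta> \<open>\<delta> > 0\<close> in linarith)
  then obtain j where j: "\<delta> / 4 < measure lborel (Y j)" by (auto simp: eventually_sequentially)
  define I where "I = F j"
  have I: "finite I" "I \<subseteq> K'" "I \<subseteq> D" using Ffin[of j] D(2) by (auto simp: I_def)
  have sumB: "\<delta> / (4 * 5 ^ d) < (\<Sum>i\<in>I. measure lborel (cball i (t i)))"
  proof -
    have "\<delta> / 4 < measure lborel (\<Union>i\<in>I. cball i (5 * t i))"
    proof -
      have "measure lborel (Y j) \<le> measure lborel (\<Union>i\<in>I. cball i (5 * t i))"
        using I Ys[of j] by (intro measure_mono_fmeasurable fmeasurable.finite_UN) (auto simp: Y_def I_def intro!: fmeasurableI emeasure_lborel_cball_finite)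
      then show ?thesis using j by linarith
    qed
    also have "\<dots> \<le> (\<Sum>i\<in>I. measure lborel (cball i (5 * t i)))"
      using I by (intro measure_UNION_le) auto
    also have "\<dots> = (\<Sum>i\<in>I. 5 ^ d * measure lborel (cball i (t i)))"
    proof (rule sum.cong[OF refl])
      fix i assume "i \<in> I"
      then have "t i \<ge> 0" using t[of i] I by auto
      then show "measure lborel (cball i (5 * t i)) = 5 ^ d * measure lborel (cball i (t i))"
        by (simp add: content_cball_conv_ball content_ball_conv_unit_ball[of "5 * t i"] content_ball_conv_unit_ball[of "t i"] power_mult_distrib d_def)
    qed
    also have "\<dots> = 5 ^ d * (\<Sum>i\<in>I. measure lborel (cball i (t i)))" by (rule sum_distrib_left[symmetric])
    finally show ?thesis by (simp add: pos_divide_less_eq mult_ac)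
  qed
  \<comment> \<open>The piece that receives the volume of the ball about \<open>x\<close>: the slab
    of the true width \<open>r\<close>, cut to radius \<open>\<kappa> * R\<close>, where
    \<open>content_ball_slab_ge\<close> bounds it from below.\<close>
  define E where "E x = ball x (\<kappa> * R (kk x)) \<inter> slab (qq x) (c (kk x) - zz x) (real (kk x) * r (kk x))" for x
  have Eo: "open (E x)" for x unfolding E_def by (intro open_Int open_ball open_slab)
  have EW: "E x \<subseteq> W" if "x \<in> K'" for x
  proof -
    have "0 \<le> \<kappa> * R (kk x)" using \<kappa> R(1)[OF kk1(1)[OF that]] by simp
    then have "\<kappa> * R (kk x) \<le> \<rho>0" using t[OF that] unfolding t_def by linarith
    then have "ball x (\<kappa> * R (kk x)) \<subseteq> ball x \<rho>0" by (rule subset_ball)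
    then show ?thesis using K(4)[of x] that by (auto simp: E_def K'_def)
  qed
  have Efm: "E x \<in> fmeasurable lborel" for x unfolding E_def by (rule ball_fmeasurable_Int) simp
  have Epos: "measure lborel (E x) > 0" if "x \<in> K'" for x
  proof -
    let ?k = "kk x"
    have "R ?k ^ DIM(real ^ 'm ^ 'n) * w * (r ?k / ((real CARD('n) + 2) * R ?k)) ^ ?m \<le> measure lborel (E x)"
      unfolding E_def \<kappa>_def w_def
      using kqz[OF that] kk1[OF that] r(1)[of ?k] rR[of ?k] by (intro content_ball_slab_ge) auto
    moreover have "0 < R ?k ^ DIM(real ^ 'm ^ 'n) * w * (r ?k / ((real CARD('n) + 2) * R ?k)) ^ ?m"
      using R(1)[OF kk1(1)[OF that]] r(1)[OF kk1(1)[OF that]] w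
      by (intro mult_pos_pos zero_less_power divide_pos_pos) (auto simp: add_pos_pos)
    ultimately show ?thesis by linarith
  qed
  have EU: "E x - U \<in> null_sets lborel" if "x \<in> K'" for x
    using kqz[OF that] kk1[OF that] EW[OF that] W(2) Eo
    by (intro null[of "kk x" "qq x" "zz x"]) (auto simp: E_def)
  define wt where "wt x = measure lborel (cball x (t x)) / measure lborel (E x)" for x
  have wt0: "wt x \<ge> 0" for x by (simp add: wt_def)
  have inner: "(\<Sum>x\<in>I. wt x * measure lborel (E x \<inter> ball (b l) (\<rho> l))) \<le> C * (f (\<rho> l) / M)" for l
  proof (cases "l \<in> L0")
    case True
    have "E x \<inter> ball (b l) (\<rho> l) = {}" if "x \<in> I" for x
    proof -
      have "E x \<subseteq> W" using that I by (intro EW) auto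
      then have "E x \<inter> cball (b l) (\<rho> l) = {}" using True unfolding W_def by blast
      then show ?thesis using ball_subset_cball[of "b l" "\<rho> l"] by blast
    qed
    then have "(\<Sum>x\<in>I. wt x * measure lborel (E x \<inter> ball (b l) (\<rho> l))) = 0" by simp
    also have "0 \<le> C * (f (\<rho> l) / M)" using C M f(2)[OF \<rho>(1)[of l]] by simp
    finally show ?thesis .
  next
    case False
    define s where "s = \<rho> l"
    have s: "0 < s" "s < r0" using False \<rho>(1)[of l] by (auto simp: s_def L0_def)
    have Ms: "s ^ d \<le> f s / M"
      using r0(2)[OF s] s M by (simp add: pos_le_divide_eq mult.commute)
    show ?thesis
      unfolding wt_def t_def s_def[symmetric] C_def d_def w_def
    proof (rule weighted_pieces_sum_le[OF I(1) _ \<kappa> s(1)])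
      show "R (kk x) > 0" if "x \<in> I" for x using R(1) kk1 that I by auto
      show "A \<ge> 0" using A by simp
      show "s ^ DIM(real ^ 'm ^ 'n) \<le> f s / M" using Ms by (simp add: d_def)
      show "disjoint_family_on (\<lambda>x. cball x (2 * \<kappa> * R (kk x))) I"
        using D(3) I(3) unfolding disjoint_family_on_def pairwise_def t_def disjnt_def by blast
      show "E x \<in> sets borel" for x using Eo[of x] by simp
      show "E x \<subseteq> ball x (\<kappa> * R (kk x))" for x by (auto simp: E_def)
      show "measure lborel (E x) > 0" if "x \<in> I" for x using Epos that I by auto
      fix x assume xI: "x \<in> I" and sR: "s \<le> R (kk x)"
      then have xK: "x \<in> K'" using I by auto
      let ?k = "kk x"
      have rk: "r ?k > 0" by (rule r(1)[OF kk1(1)[OF xK]])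
      have "measure lborel (cball x (2 * \<kappa> * R ?k)) * measure lborel (E x \<inter> ball (b l) s)
        \<le> A * (R ?k ^ ?m * s ^ d / max (r ?k) s ^ ?m) * measure lborel (E x)"
        unfolding E_def A_def d_def w_def
        by (rule piece_mass_le[OF kqz(2)[OF xK] kk1(1)[OF xK] rk rR[OF kqz(1)[OF xK]] kqz(4)[OF xK] s(1) sR \<kappa>_def])
      also have "\<dots> \<le> A * (f s / M) * measure lborel (E x)"
      proof (intro mult_right_mono mult_left_mono)
        \<comment> \<open>Both monotonicity hypotheses meet here. For \<open>r \<le> s\<close>
          replace \<open>g r\<close> by \<open>g s\<close> and use
          \<open>g s * s ^ d = f s * s ^ m\<close>; for \<open>s < r\<close> the left side is
          \<open>s ^ d * (f r / r ^ d)\<close>, and \<open>f t / t ^ d\<close> is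
          non-increasing.\<close>
        have "g (r ?k) * s ^ d / max (r ?k) s ^ ?m \<le> f s"
        proof (cases "r ?k \<le> s")
          case True
          then have "g (r ?k) \<le> g s" using g(1) rk s by (auto intro: mono_onD)
          then have "g (r ?k) * s ^ d \<le> g s * s ^ d" using s by (intro mult_right_mono) auto
          also have "\<dots> = f s * s ^ ?m" using fg[OF s(1)] by simp
          finally show ?thesis using True s by (simp add: max_def pos_divide_le_eq)
        next
          case False
          have "g (r ?k) * r ?k ^ d = f (r ?k) * r ?k ^ ?m" using fg[OF rk] by simp
          then have "g (r ?k) / r ?k ^ ?m = f (r ?k) / r ?k ^ d" using rk by (simp add: field_simps)
          also have "\<dots> \<le> f s / s ^ d" using anti[of s "r ?k"] s False by simp
          finally show ?thesis using False s by (simp add: max_def pos_le_divide_eq)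
        qed
        then have "g (r ?k) * s ^ d / max (r ?k) s ^ ?m / M \<le> f s / M" using M by (intro divide_right_mono) auto
        then show "R ?k ^ ?m * s ^ d / max (r ?k) s ^ ?m \<le> f s / M"
          by (simp add: R(2)[OF kk1(1)[OF xK]] mult.commute)
      qed (use A in auto)
      finally show "measure lborel (cball x (2 * \<kappa> * R ?k)) * measure lborel (E x \<inter> ball (b l) s) \<le> A * (f s / M) * measure lborel (E x)" .
    qed
  qed
  have "ennreal (\<Sum>i\<in>I. measure lborel (cball i (t i))) = (\<Sum>i\<in>I. ennreal (wt i) * emeasure lborel (E i))"
  proof -
    have "measure lborel (cball i (t i)) = wt i * measure lborel (E i)" if "i \<in> I" for i
      using Epos[of i] that I by (auto simp: wt_def)
    then have "ennreal (\<Sum>i\<in>I. measure lborel (cball i (t i))) = ennreal (\<Sum>i\<in>I. wt i * measure lborel (E i))" by simp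
    also have "\<dots> = (\<Sum>i\<in>I. ennreal (wt i * measure lborel (E i)))" using wt0 by (intro sum_ennreal[symmetric]) auto
    also have "\<dots> = (\<Sum>i\<in>I. ennreal (wt i) * emeasure lborel (E i))"
      by (simp add: ennreal_mult wt0 emeasure_eq_measure2[OF Efm])
    finally show ?thesis .
  qed
  \<comment> \<open>By assumption the cover contains each piece up to a null set, so countable
    subadditivity distributes its mass among the covering balls.\<close>
  also have "\<dots> \<le> (\<Sum>i\<in>I. \<Sum>l. ennreal (wt i) * emeasure lborel (E i \<inter> ball (b l) (\<rho> l)))"
  proof (rule sum_mono)
    fix i assume "i \<in> I"
    then have iK: "i \<in> K'" using I by auto
    have "E i = (E i \<inter> U) \<union> (E i - U)" by auto
    then have "emeasure lborel (E i) = emeasure lborel (E i \<inter> U)"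
      using emeasure_Un_null_set[of "E i \<inter> U" lborel "E i - U"] EU[OF iK] Eo Ub by (metis borel_open open_Int sets_lborel)
    also have "E i \<inter> U = (\<Union>l. E i \<inter> ball (b l) (\<rho> l))" by (auto simp: U_def)
    also have "emeasure lborel \<dots> \<le> (\<Sum>l. emeasure lborel (E i \<inter> ball (b l) (\<rho> l)))"
      using Eo by (intro emeasure_subadditive_countably) auto
    finally have "ennreal (wt i) * emeasure lborel (E i) \<le> ennreal (wt i) * (\<Sum>l. emeasure lborel (E i \<inter> ball (b l) (\<rho> l)))"
      by (rule mult_left_mono) simp
    then show "ennreal (wt i) * emeasure lborel (E i) \<le> (\<Sum>l. ennreal (wt i) * emeasure lborel (E i \<inter> ball (b l) (\<rho> l)))"
      by simp
  qed
  also have "\<dots> = (\<Sum>l. \<Sum>i\<in>I. ennreal (wt i) * emeasure lborel (E i \<inter> ball (b l) (\<rho> l)))"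
    by (rule suminf_sum[symmetric]) auto
  also have "\<dots> \<le> (\<Sum>l. ennreal (C * (f (\<rho> l) / M)))"
  proof (rule suminf_le)
    fix l
    have "(\<Sum>i\<in>I. ennreal (wt i) * emeasure lborel (E i \<inter> ball (b l) (\<rho> l))) = (\<Sum>i\<in>I. ennreal (wt i * measure lborel (E i \<inter> ball (b l) (\<rho> l))))"
    proof (rule sum.cong[OF refl])
      fix i
      have "E i \<inter> ball (b l) (\<rho> l) \<in> fmeasurable lborel" by (intro fmeasurable.Int Efm ball_fmeasurable)
      then show "ennreal (wt i) * emeasure lborel (E i \<inter> ball (b l) (\<rho> l)) = ennreal (wt i * measure lborel (E i \<inter> ball (b l) (\<rho> l)))"
        by (simp add: ennreal_mult wt0 emeasure_eq_measure2)
    qed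
    also have "\<dots> = ennreal (\<Sum>i\<in>I. wt i * measure lborel (E i \<inter> ball (b l) (\<rho> l)))"
      using wt0 by (intro sum_ennreal) auto
    also have "\<dots> \<le> ennreal (C * (f (\<rho> l) / M))" by (rule ennreal_leI, rule inner)
    finally show "(\<Sum>i\<in>I. ennreal (wt i) * emeasure lborel (E i \<inter> ball (b l) (\<rho> l))) \<le> ennreal (C * (f (\<rho> l) / M))" .
  qed auto
  also have "\<dots> = ennreal (\<Sum>l. C * (f (\<rho> l) / M))"
    using \<rho> f(2) C M by (intro suminf_ennreal2 summable_mult summable_divide) (auto simp: less_imp_le)
  also have "(\<Sum>l. C * (f (\<rho> l) / M)) = C * T / M"
    using \<rho>(2) by (simp add: T_def suminf_mult summable_divide suminf_divide)
  finally have "ennreal (\<Sum>i\<in>I. measure lborel (cball i (t i))) \<le> ennreal (C * T / M)" .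
  then have "(\<Sum>i\<in>I. measure lborel (cball i (t i))) \<le> C * T / M"
    using C T M by (subst (asm) ennreal_le_iff) auto
  then show False using sumB CTM by linarith
qed

section \<open>Hausdorff measure\<close>

text \<open>The content is defined by sequences of balls of positive radius. A countable family is
  placed at the indices \<open>to_nat_on I\<close>, and vacant indices get dummy balls of total mass
  at most \<open>e\<close>, which exist because \<open>f\<close> tends to 0.\<close>

lemma hausdorff_content_le_sum:
  fixes x :: "'i \<Rightarrow> 'a::metric_space" and r :: "'i \<Rightarrow> real"
  assumes I: "countable I" and cov: "F \<subseteq> (\<Union>i\<in>I. ball (x i) (r i))"
    and r: "\<And>i. i \<in> I \<Longrightarrow> 0 < r i \<and> r i < \<rho>" and \<rho>: "\<rho> > 0" and lim: "(f \<longlongrightarrow> 0) (at_right 0)"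
  shows "hausdorff_content f \<rho> F \<le> (\<integral>\<^sup>+i. ennreal (f (r i)) \<partial>count_space I)"
proof (rule ennreal_le_epsilon)
  fix e :: real assume e: "e > 0"
  have "\<exists>t. 0 < t \<and> t < \<rho> \<and> f t < e * (1/2) ^ Suc j" for j
  proof -
    have "\<forall>\<^sub>F t in at_right 0. f t < e * (1/2) ^ Suc j"
      using lim by (rule order_tendstoD) (use e in auto)
    then obtain b where b: "b > 0" "\<And>t. 0 < t \<Longrightarrow> t < b \<Longrightarrow> f t < e * (1/2) ^ Suc j"
      by (auto simp: eventually_at_right_field)
    show ?thesis using b \<rho> by (intro exI[of _ "min b \<rho> / 2"]) auto
  qed
  then obtain t where t: "\<And>j. 0 < t j" "\<And>j. t j < \<rho>" "\<And>j. f (t j) < e * (1/2) ^ Suc j" by metis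
  define J where "J = to_nat_on I ` I"
  have bij: "bij_betw (to_nat_on I) I J"
    unfolding J_def using I by (intro bij_betw_imageI) auto
  have bij': "bij_betw (from_nat_into I) J I"
    by (rule bij_betw_byWitness[where f' = "to_nat_on I"]) (auto simp: J_def I)
  define x' r' where "x' j = x (from_nat_into I j)" and "r' j = (if j \<in> J then r (from_nat_into I j) else t j)" for j
  have "hausdorff_content f \<rho> F \<le> (\<Sum>j. ennreal (f (r' j)))"
  proof -
    have "(x', r') \<in> {(c, r). (\<forall>i::nat. 0 < r i \<and> r i < \<rho>) \<and> F \<subseteq> (\<Union>i. ball (c i) (r i))}"
    proof (clarify, intro conjI allI subsetI)
      fix j show "0 < r' j" "r' j < \<rho>"
        using t r bij_betwE[OF bij'] by (auto simp: r'_def)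
    next
      fix y assume "y \<in> F"
      then obtain i where i: "i \<in> I" "y \<in> ball (x i) (r i)" using cov by blast
      then have "y \<in> ball (x' (to_nat_on I i)) (r' (to_nat_on I i))"
        using I by (simp add: x'_def r'_def J_def)
      then show "y \<in> (\<Union>j. ball (x' j) (r' j))" by blast
    qed
    then show ?thesis unfolding hausdorff_content_def by (rule INF_lower2) simp
  qed
  also have "\<dots> \<le> (\<Sum>j. ennreal (f (r (from_nat_into I j))) * indicator J j + ennreal (e * (1/2) ^ Suc j))"
  proof (intro suminf_le)
    fix j
    have "ennreal (f (t j)) \<le> ennreal (e * (1/2) ^ Suc j)" using t(3)[of j] by (intro ennreal_leI) simp
    then show "ennreal (f (r' j)) \<le> ennreal (f (r (from_nat_into I j))) * indicator J j + ennreal (e * (1/2) ^ Suc j)"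
      by (auto simp: r'_def indicator_def)
  qed auto
  also have "\<dots> = (\<Sum>j. ennreal (f (r (from_nat_into I j))) * indicator J j) + (\<Sum>j. ennreal (e * (1/2) ^ Suc j))"
    by (rule suminf_add[symmetric]) auto
  also have "(\<Sum>j. ennreal (e * (1/2) ^ Suc j)) = ennreal e"
  proof -
    have "(\<lambda>j. e * (1/2) ^ Suc j) sums (e * 1)" by (intro sums_mult power_half_series)
    then show ?thesis using e by (intro sums_unique[symmetric]) (auto simp: sums_ennreal)
  qed
  also have "(\<Sum>j. ennreal (f (r (from_nat_into I j))) * indicator J j) = (\<integral>\<^sup>+i. ennreal (f (r i)) \<partial>count_space I)"
  proof -
    have "(\<Sum>j. ennreal (f (r (from_nat_into I j))) * indicator J j) = (\<integral>\<^sup>+j. ennreal (f (r (from_nat_into I j))) * indicator J j \<partial>count_space UNIV)"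
      by (rule nn_integral_count_space_nat[symmetric])
    also have "\<dots> = (\<integral>\<^sup>+j. ennreal (f (r (from_nat_into I j))) \<partial>count_space J)"
      by (rule nn_integral_count_space_indicator[symmetric]) simp
    also have "\<dots> = (\<integral>\<^sup>+i. ennreal (f (r i)) \<partial>count_space I)"
      by (rule nn_integral_bij_count_space[OF bij'])
    finally show ?thesis .
  qed
  finally show "hausdorff_content f \<rho> F \<le> (\<integral>\<^sup>+i. ennreal (f (r i)) \<partial>count_space I) + ennreal e" .
qed

lemma hausdorff_measure_le: "(\<And>\<rho>. \<rho> > 0 \<Longrightarrow> hausdorff_content f \<rho> F \<le> B) \<Longrightarrow> hausdorff_measure_f f F \<le> B"
  unfolding hausdorff_measure_f_def by (rule SUP_least) simp

lemma hausdorff_content_le_measure: "\<rho> > 0 \<Longrightarrow> hausdorff_content f \<rho> F \<le> hausdorff_measure_f f F"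
  unfolding hausdorff_measure_f_def by (rule SUP_upper) simp

lemma hausdorff_content_mono: "F \<subseteq> G \<Longrightarrow> hausdorff_content f \<rho> F \<le> hausdorff_content f \<rho> G"
  unfolding hausdorff_content_def by (rule INF_superset_mono) auto

lemma hausdorff_measure_mono: "F \<subseteq> G \<Longrightarrow> hausdorff_measure_f f F \<le> hausdorff_measure_f f G"
  unfolding hausdorff_measure_f_def by (rule SUP_mono) (use hausdorff_content_mono in blast)

lemma hausdorff_content_cover:
  assumes "hausdorff_content f \<rho> F < s"
  shows "\<exists>c r. (\<forall>i::nat. 0 < r i \<and> r i < \<rho>) \<and> F \<subseteq> (\<Union>i. ball (c i) (r i)) \<and> (\<Sum>i. ennreal (f (r i))) < s"
  using assms unfolding hausdorff_content_def INF_less_iff by auto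

lemma hausdorff_content_Un_le:
  assumes \<rho>: "\<rho> > 0" and lim: "(f \<longlongrightarrow> 0) (at_right 0)"
  shows "hausdorff_content f \<rho> (F \<union> G) \<le> hausdorff_content f \<rho> F + hausdorff_content f \<rho> G"
proof (cases "hausdorff_content f \<rho> F = \<infinity> \<or> hausdorff_content f \<rho> G = \<infinity>")
  case False
  show ?thesis
  proof (rule ennreal_le_epsilon)
    fix e :: real assume e: "e > 0"
    have lt: "hausdorff_content f \<rho> H < hausdorff_content f \<rho> H + ennreal (e / 2)" if "hausdorff_content f \<rho> H \<noteq> \<infinity>" for H :: "'a set"
      using that e by (cases "hausdorff_content f \<rho> H") (auto simp flip: ennreal_plus simp: ennreal_less_iff)
    have fin: "hausdorff_content f \<rho> F \<noteq> \<infinity>" "hausdorff_content f \<rho> G \<noteq> \<infinity>" using False by auto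
    obtain c1 r1 where 1: "\<And>i::nat. 0 < r1 i" "\<And>i. r1 i < \<rho>" "F \<subseteq> (\<Union>i. ball (c1 i) (r1 i))" "(\<Sum>i. ennreal (f (r1 i))) < hausdorff_content f \<rho> F + ennreal (e/2)"
      using hausdorff_content_cover[OF lt[OF fin(1)]] by metis
    obtain c2 r2 where 2: "\<And>i::nat. 0 < r2 i" "\<And>i. r2 i < \<rho>" "G \<subseteq> (\<Union>i. ball (c2 i) (r2 i))" "(\<Sum>i. ennreal (f (r2 i))) < hausdorff_content f \<rho> G + ennreal (e/2)"
      using hausdorff_content_cover[OF lt[OF fin(2)]] by metis
    define x r where "x = (\<lambda>(b, i). if b then c1 i else c2 i)" and "r = (\<lambda>(b, i::nat). if b then r1 i else r2 i)"
    have "hausdorff_content f \<rho> (F \<union> G) \<le> (\<integral>\<^sup>+i. ennreal (f (r i)) \<partial>count_space UNIV)"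
    proof (rule hausdorff_content_le_sum[OF _ _ _ \<rho> lim])
      show "F \<union> G \<subseteq> (\<Union>i\<in>UNIV. ball (x i) (r i))"
      proof
        fix y assume "y \<in> F \<union> G"
        then consider i where "y \<in> ball (c1 i) (r1 i)" | i where "y \<in> ball (c2 i) (r2 i)" using 1(3) 2(3) by blast
        then show "y \<in> (\<Union>i\<in>UNIV. ball (x i) (r i))"
        proof cases
          case (1 i) then show ?thesis by (intro UN_I[of "(True, i)"]) (auto simp: x_def r_def)
        next
          case (2 i) then show ?thesis by (intro UN_I[of "(False, i)"]) (auto simp: x_def r_def)
        qed
      qed
    qed (use 1 2 in \<open>auto simp: r_def split: prod.splits\<close>)
    also have "\<dots> = (\<integral>\<^sup>+b. \<integral>\<^sup>+i. ennreal (f (r (b, i))) \<partial>count_space UNIV \<partial>count_space UNIV)"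
      by (rule nn_integral_fst_count_space[symmetric])
    also have "\<dots> = (\<Sum>i. ennreal (f (r1 i))) + (\<Sum>i. ennreal (f (r2 i)))"
      by (simp add: nn_integral_count_space_finite UNIV_bool r_def nn_integral_count_space_nat add.commute)
    also have "\<dots> \<le> (hausdorff_content f \<rho> F + ennreal (e/2)) + (hausdorff_content f \<rho> G + ennreal (e/2))"
      using 1(4) 2(4) by (intro add_mono less_imp_le)
    also have "\<dots> = hausdorff_content f \<rho> F + hausdorff_content f \<rho> G + (ennreal (e/2) + ennreal (e/2))"
      by (simp add: add_ac)
    also have "ennreal (e/2) + ennreal (e/2) = ennreal e" using e by (simp flip: ennreal_plus)
    finally show "hausdorff_content f \<rho> (F \<union> G) \<le> hausdorff_content f \<rho> F + hausdorff_content f \<rho> G + ennreal e" .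
  qed
qed auto

lemma hausdorff_measure_Un_null:
  assumes lim: "(f \<longlongrightarrow> 0) (at_right 0)" and "hausdorff_measure_f f G = 0"
  shows "hausdorff_measure_f f (F \<union> G) \<le> hausdorff_measure_f f F"
proof (rule hausdorff_measure_le)
  fix \<rho> :: real assume \<rho>: "\<rho> > 0"
  have "hausdorff_content f \<rho> (F \<union> G) \<le> hausdorff_content f \<rho> F + hausdorff_content f \<rho> G"
    by (rule hausdorff_content_Un_le[OF \<rho> lim])
  also have "\<dots> \<le> hausdorff_measure_f f F + hausdorff_measure_f f G"
    by (intro add_mono hausdorff_content_le_measure \<rho>)
  finally show "hausdorff_content f \<rho> (F \<union> G) \<le> hausdorff_measure_f f F" using assms(2) by simp
qed

text \<open>Vitali's lemma gives disjoint closed balls of radius \<open>t\<close> inside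
  \<open>G\<close> whose fivefold enlargements cover \<open>S\<close>. Open balls of radius
  \<open>10 * t\<close> contain these, at a mass proportional to the volume of the disjoint
  balls.\<close>

lemma hausdorff_content_le_volume:
  fixes S G :: "'a::euclidean_space set"
  assumes G: "open G" "S \<subseteq> G" and \<rho>: "\<rho> > 0" and lim: "(f \<longlongrightarrow> 0) (at_right 0)"
    and f: "s1 > 0" "\<And>s. 0 < s \<Longrightarrow> s < s1 \<Longrightarrow> f s \<le> \<eta> * s ^ DIM('a)" and \<eta>: "\<eta> \<ge> 0"
  shows "hausdorff_content f \<rho> S \<le> ennreal (\<eta> * 10 ^ DIM('a) / measure lborel (ball (0::'a) 1)) * emeasure lborel G"
proof -
  let ?w = "measure lborel (ball (0::'a) 1)"
  have w: "?w > 0" by (simp add: content_ball_pos)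
  define b where "b = min \<rho> s1 / 20"
  have b: "b > 0" "10 * b < \<rho>" "10 * b < s1" using \<rho> f(1) by (auto simp: b_def)
  have "\<forall>x\<in>S. \<exists>t. 0 < t \<and> t \<le> b \<and> cball x t \<subseteq> G"
  proof
    fix x assume "x \<in> S"
    then obtain e where "e > 0" "cball x e \<subseteq> G" using G open_contains_cball by blast
    then show "\<exists>t. 0 < t \<and> t \<le> b \<and> cball x t \<subseteq> G"
      using b by (intro exI[of _ "min e b"]) auto
  qed
  then obtain t where t: "\<And>x. x \<in> S \<Longrightarrow> 0 < t x \<and> t x \<le> b" "\<And>x. x \<in> S \<Longrightarrow> cball x (t x) \<subseteq> G" by metis
  obtain D where D: "countable D" "D \<subseteq> S" "pairwise (\<lambda>i j. disjnt (cball i (t i)) (cball j (t j))) D"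
    "S \<subseteq> (\<Union>i\<in>D. cball i (5 * t i))"
  proof (rule Vitali_covering_lemma_cballs[of S "\<lambda>x. x" t S b])
    show "S \<subseteq> (\<Union>i\<in>S. cball i (t i))" using t by (force simp: less_imp_le)
  qed (use t in auto)
  have tD: "0 < t i" "10 * t i < \<rho>" "10 * t i < s1" if "i \<in> D" for i
    using t(1)[of i] that D(2) b by auto
  have "hausdorff_content f \<rho> S \<le> (\<integral>\<^sup>+i. ennreal (f (10 * t i)) \<partial>count_space D)"
  proof (rule hausdorff_content_le_sum[OF D(1) _ _ \<rho> lim])
    show "S \<subseteq> (\<Union>i\<in>D. ball i (10 * t i))"
    proof
      fix y assume "y \<in> S"
      then obtain i where "i \<in> D" "y \<in> cball i (5 * t i)" using D(4) by blast
      then show "y \<in> (\<Union>i\<in>D. ball i (10 * t i))" using tD[of i] by (intro UN_I[of i]) auto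
    qed
  qed (use tD in auto)
  also have "\<dots> \<le> (\<integral>\<^sup>+i. ennreal (\<eta> * 10 ^ DIM('a) / ?w) * emeasure lborel (cball i (t i)) \<partial>count_space D)"
  proof (rule nn_integral_mono)
    fix i assume "i \<in> space (count_space D)"
    then have i: "i \<in> D" by simp
    have "f (10 * t i) \<le> \<eta> * (10 * t i) ^ DIM('a)" using tD[OF i] by (intro f(2)) auto
    also have "\<dots> = (\<eta> * 10 ^ DIM('a) / ?w) * measure lborel (cball i (t i))"
      using w tD[OF i] by (simp add: content_cball_conv_ball content_ball_conv_unit_ball[of "t i"] power_mult_distrib)
    finally have "ennreal (f (10 * t i)) \<le> ennreal ((\<eta> * 10 ^ DIM('a) / ?w) * measure lborel (cball i (t i)))"
      by (rule ennreal_leI)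
    also have "\<dots> = ennreal (\<eta> * 10 ^ DIM('a) / ?w) * emeasure lborel (cball i (t i))"
      using \<eta> w by (subst ennreal_mult) (auto simp: emeasure_eq_measure2[OF fmeasurableI[OF _ emeasure_lborel_cball_finite]])
    finally show "ennreal (f (10 * t i)) \<le> ennreal (\<eta> * 10 ^ DIM('a) / ?w) * emeasure lborel (cball i (t i))" .
  qed
  also have "\<dots> = ennreal (\<eta> * 10 ^ DIM('a) / ?w) * (\<integral>\<^sup>+i. emeasure lborel (cball i (t i)) \<partial>count_space D)"
    by (rule nn_integral_cmult) simp
  also have "(\<integral>\<^sup>+i. emeasure lborel (cball i (t i)) \<partial>count_space D) = emeasure lborel (\<Union>i\<in>D. cball i (t i))"
  proof (rule emeasure_UN_countable[symmetric])
    show "disjoint_family_on (\<lambda>i. cball i (t i)) D"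
      using D(3) unfolding disjoint_family_on_def pairwise_def disjnt_def by blast
  qed (use D in auto)
  also have "\<dots> \<le> emeasure lborel G"
    using t(2) D(2) G(1) by (intro emeasure_mono) auto
  finally show ?thesis by (simp add: mult_left_mono)
qed

text \<open>Where \<open>f\<close> is dominated by volume, open sets of small measure around
  \<open>S\<close> yield covers of small mass.\<close>

lemma hausdorff_measure_null_set:
  fixes S :: "'a::euclidean_space set"
  assumes S: "S \<in> null_sets lborel" and lim: "(f \<longlongrightarrow> 0) (at_right 0)"
    and f: "s1 > 0" "\<And>s. 0 < s \<Longrightarrow> s < s1 \<Longrightarrow> f s \<le> \<eta> * s ^ DIM('a)" and \<eta>: "\<eta> \<ge> 0"
  shows "hausdorff_measure_f f S = 0"
proof -
  have "hausdorff_measure_f f S \<le> 0"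
  proof (rule hausdorff_measure_le, rule ennreal_le_epsilon)
    fix \<rho> e :: real assume \<rho>: "\<rho> > 0" and e: "e > 0"
    define B where "B = \<eta> * 10 ^ DIM('a) / measure lborel (ball (0::'a) 1)"
    have B: "B \<ge> 0" using \<eta> by (simp add: B_def)
    have e': "e / (B + 1) > 0" using e B by simp
    obtain G where G: "open G" "S \<subseteq> G" "emeasure lborel (G - S) < ennreal (e / (B + 1))"
      using outer_regular_lborel[OF _ e', of S] S by (auto simp: null_sets_def)
    have "emeasure lborel G = emeasure lborel (G - S)"
      using S G(1) by (intro emeasure_Diff_null_set[symmetric]) auto
    then have "emeasure lborel G \<le> ennreal (e / (B + 1))" using G(3) by simp
    then have "ennreal B * emeasure lborel G \<le> ennreal B * ennreal (e / (B + 1))" by (rule mult_left_mono) simp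
    also have "\<dots> = ennreal (B * (e / (B + 1)))" using B e by (subst ennreal_mult) auto
    also have "\<dots> \<le> ennreal e" using B e by (intro ennreal_leI) (simp add: field_simps)
    finally show "hausdorff_content f \<rho> S \<le> 0 + ennreal e"
      using hausdorff_content_le_volume[OF G(1,2) \<rho> lim f \<eta>] by (simp add: B_def)
  qed
  then show ?thesis by simp
qed

section \<open>The limsup set\<close>

lemma int_vec_norm_freq:
  fixes q :: "int ^ 'n"
  assumes "q \<in> freq a k" shows "int_vec_norm q = k"
proof -
  have *: "q $ a = int k" "1 \<le> q $ i" "q $ i \<le> int k" for i using assms by (auto simp: freq_def)
  have "Max (range (\<lambda>i. \<bar>q $ i\<bar>)) = int k"
  proof (rule Max_eqI)
    show "y \<le> int k" if y: "y \<in> range (\<lambda>i. \<bar>q $ i\<bar>)" for y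
    proof -
      obtain i where "y = \<bar>q $ i\<bar>" using y by auto
      then show ?thesis using *(2,3)[of i] by simp
    qed
    show "int k \<in> range (\<lambda>i. \<bar>q $ i\<bar>)" using *(1) by (intro image_eqI[of _ _ a]) auto
  qed simp
  then show ?thesis by (simp add: int_vec_norm_def)
qed

text \<open>Each \<open>k\<close> yields a pair \<open>(p, q)\<close>, and different
  \<open>k\<close> yield different pairs because \<open>k\<close> is the norm of
  \<open>q\<close>.\<close>

lemma A_setI:
  fixes x :: "real ^ 'm ^ 'n"
  assumes x: "x \<in> unit_cube_mat" and inf: "infinite {k. \<exists>q\<in>freq a k. x \<in> resonant q (c k) (rad k)}"
  shows "x \<in> A_set c rad"
proof -
  define S where "S = {k. \<exists>q\<in>freq a k. x \<in> resonant q (c k) (rad k)} - {0}"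
  have infS: "infinite S" using inf by (simp add: S_def)
  have "\<exists>p q. q \<in> freq a k \<and> (\<forall>j. \<bar>(real_vec q v* x) $ j + of_int (p $ j) - c k $ j\<bar> < rad k)" if kS: "k \<in> S" for k
  proof -
    obtain q z where q: "q \<in> freq a k" "z \<in> int_lattice" "real_vec q v* x + z \<in> open_cube (c k) (rad k)"
      using kS by (auto simp: S_def resonant_def target_def)
    have "z $ j = of_int \<lfloor>z $ j\<rfloor>" for j using q(2) by (simp add: int_lattice_vec)
    then have "\<forall>j. \<bar>(real_vec q v* x) $ j + of_int ((\<chi> j. \<lfloor>z $ j\<rfloor>) $ j) - c k $ j\<bar> < rad k"
      using q(3) by (simp add: open_cube_def)
    then show ?thesis using q(1) by blast
  qed
  then obtain p q where pq: "\<And>k. k \<in> S \<Longrightarrow> q k \<in> freq a k"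
    "\<And>k j. k \<in> S \<Longrightarrow> \<bar>(real_vec (q k) v* x) $ j + of_int (p k $ j) - c k $ j\<bar> < rad k"
    by metis
  have "inj_on (\<lambda>k. (p k, q k)) S"
    by (rule inj_onI) (metis pq(1) int_vec_norm_freq prod.inject)
  then have "infinite ((\<lambda>k. (p k, q k)) ` S)" using infS by (simp add: finite_image_iff)
  moreover have "(\<lambda>k. (p k, q k)) ` S \<subseteq> {(p :: int ^ 'm, q :: int ^ 'n). q \<noteq> 0 \<and>
        (\<forall>j. \<bar>((\<chi> i. of_int (q $ i)) v* x) $ j + of_int (p $ j) - c (int_vec_norm q) $ j\<bar> < rad (int_vec_norm q))}"
  proof (rule image_subsetI)
    fix k assume k: "k \<in> S"
    then have "k \<ge> 1" by (auto simp: S_def)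
    then show "(p k, q k) \<in> {(p :: int ^ 'm, q :: int ^ 'n). q \<noteq> 0 \<and>
        (\<forall>j. \<bar>((\<chi> i. of_int (q $ i)) v* x) $ j + of_int (p $ j) - c (int_vec_norm q) $ j\<bar> < rad (int_vec_norm q))}"
      using pq[OF k] freq_nonzero[OF pq(1)[OF k]] int_vec_norm_freq[OF pq(1)[OF k]] by (simp add: real_vec_def)
  qed
  ultimately show ?thesis using x unfolding A_set_def by (auto dest: finite_subset)
qed

section \<open>Nested construction of a point outside a cover\<close>

lemma open_shrink:
  fixes E U :: "'a::euclidean_space set"
  assumes E: "open E" "emeasure lborel E < \<infinity>" and U: "open U" and "E - U \<notin> null_sets lborel"
  obtains G where "open G" "closure G \<subseteq> E" "G - U \<notin> null_sets lborel"
proof -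
  have fm: "E \<in> fmeasurable lborel" using E by (simp add: fmeasurable_def)
  have fmD: "E - U \<in> fmeasurable lborel" using fm U by (intro fmeasurable_Diff) auto
  have pos: "measure lborel (E - U) > 0"
  proof -
    have "measure lborel (E - U) \<noteq> 0"
      using assms(4) fmD emeasure_eq_measure2[OF fmD] by (auto simp: null_sets_def fmeasurable_def)
    then show ?thesis by (simp add: less_le)
  qed
  \<comment> \<open>\<open>K\<close> loses less of \<open>E\<close> than
    \<open>measure lborel (E - U)\<close>, so it is not contained in \<open>U\<close> up to a null
    set. Its neighbourhood of radius \<open>\<rho> / 2\<close> inherits this and has its closure in
    \<open>E\<close>.\<close>
  obtain K \<rho> where K: "K \<in> sets borel" "\<rho> > 0" "K \<subseteq> E" "\<And>x. x \<in> K \<Longrightarrow> ball x \<rho> \<subseteq> E"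
    "measure lborel E - measure lborel (E - U) < measure lborel K"
    using open_erosion[OF E pos] by blast
  define G where "G = (\<Union>x\<in>K. ball x (\<rho> / 2))"
  have "open G" by (auto simp: G_def)
  moreover have "closure G \<subseteq> E"
  proof
    fix y assume "y \<in> closure G"
    then obtain v where v: "v \<in> G" "dist v y < \<rho> / 2"
      using K(2) closure_approachable[of y G] by (meson half_gt_zero)
    then obtain x where x: "x \<in> K" "dist x v < \<rho> / 2" by (auto simp: G_def)
    have "dist x y < \<rho>" using v x dist_triangle[of x y v] by linarith
    then show "y \<in> E" using K(4)[OF x(1)] by auto
  qed
  moreover have "G - U \<notin> null_sets lborel"
  proof
    assume null: "G - U \<in> null_sets lborel"
    have "K - U \<in> null_sets lborel"
      by (rule null_sets_subset[OF null]) (use K U in \<open>auto simp: G_def\<close>)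
    then have "measure lborel ((K \<inter> U) \<union> (K - U)) = measure lborel (K \<inter> U)"
      using K(1) U by (intro measure_Un_null_set) auto
    moreover have "(K \<inter> U) \<union> (K - U) = K" by auto
    ultimately have "measure lborel K = measure lborel (K \<inter> U)" by simp
    also have "\<dots> \<le> measure lborel (E \<inter> U)"
      using K fm U by (intro measure_mono_fmeasurable fmeasurable_Int_fmeasurable) auto
    also have "E \<inter> U = E - (E - U)" by auto
    also have "measure lborel (E - (E - U)) = measure lborel E - measure lborel (E - U)"
      using fm fmD by (intro measurable_measure_Diff) (auto simp: fmeasurable_def)
    finally show False using K(5) by simp
  qed
  ultimately show ?thesis using that by blast
qed

lemma box_subset_unit_cube: "box 0 One \<subseteq> (unit_cube_mat :: (real ^ 'm ^ 'n) set)"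
proof
  fix x :: "real ^ 'm ^ 'n" assume "x \<in> box 0 One"
  then have "x \<in> half_open_cube" by (auto simp: half_open_cube_def mem_box less_imp_le)
  then show "x \<in> unit_cube_mat" by (auto simp: half_open_cube_mat unit_cube_mat_def less_imp_le)
qed

theorem A_set_not_covered:
  fixes c :: "nat \<Rightarrow> real ^ 'm" and rad :: "nat \<Rightarrow> real" and f g :: "real \<Rightarrow> real"
    and b :: "nat \<Rightarrow> real ^ 'm ^ 'n" and \<rho> :: "nat \<Rightarrow> real"
  defines "d \<equiv> DIM(real ^ 'm ^ 'n)" and "U \<equiv> \<Union>l. ball (b l) (\<rho> l)"
  assumes rad: "\<And>k. 0 < rad k" "\<And>k. rad k \<le> 1"
    and g: "mono_on {0<..} g" "\<And>s. s > 0 \<Longrightarrow> g s > 0" "(g \<longlongrightarrow> 0) (at_right 0)"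
    and f: "mono_on {0<..} f" "\<And>s. s > 0 \<Longrightarrow> f s > 0"
    and fg: "\<And>s. s > 0 \<Longrightarrow> f s * s ^ CARD('m) = g s * s ^ d"
    and anti: "\<And>s t. 0 < s \<Longrightarrow> s \<le> t \<Longrightarrow> f t / t ^ d \<le> f s / s ^ d"
    and inf: "\<And>M. \<exists>r0>0. \<forall>s. 0 < s \<and> s < r0 \<longrightarrow> M \<le> f s / s ^ d"
    and div: "\<not> summable (\<lambda>k. real (Suc k) ^ (CARD('n) + CARD('m) - 1) * g (rad (Suc k) / real (Suc k)))"
    and dim: "CARD('n) + CARD('m) \<ge> 4"
    and \<rho>: "\<And>l. \<rho> l > 0" "summable (\<lambda>l. f (\<rho> l))"
    and U: "box 0 One - U \<notin> null_sets lborel"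
  shows "\<not> A_set c rad \<subseteq> U"
proof -
  define a :: 'n where "a = undefined"
  have Uo: "open U" unfolding U_def by auto
  \<comment> \<open>The state is an open set that \<open>U\<close> does not cover up to a null set,
    together with the last norm reached. In \<open>S\<close>, the closure condition serves
    compactness and \<open>k < k'\<close> produces infinitely many norms.\<close>
  define P where "P = (\<lambda>(n::nat) (Q :: (real ^ 'm ^ 'n) set, k::nat). open Q \<and> Q \<subseteq> box 0 One \<and> Q - U \<notin> null_sets lborel)"
  define S where "S = (\<lambda>(n::nat) (Q :: (real ^ 'm ^ 'n) set, k) (Q', k'). closure Q' \<subseteq> Q \<and> k < k' \<and>
      (\<exists>q\<in>freq a k'. Q' \<subseteq> resonant q (c k') (rad k')))"
  have "\<exists>h. \<forall>n. P n (h n) \<and> S n (h n) (h (Suc n))"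
  proof (rule dependent_nat_choice)
    show "\<exists>x. P 0 x" using U by (intro exI[of _ "(box 0 One, 0)"]) (simp add: P_def open_box)
    fix x n assume "P n x"
    then obtain Q k where x: "x = (Q, k)" and Q: "open Q" "Q \<subseteq> box 0 One" "Q - U \<notin> null_sets lborel"
      by (cases x) (auto simp: P_def)
    \<comment> \<open>Here \<open>rad k \<le> 1\<close> matters: \<open>mtp_step\<close> takes radii
      at most \<open>1 / k\<close>, which tend to 0.\<close>
    have r: "0 < rad k / real k" "rad k / real k \<le> 1 / real k" if "k \<ge> 1" for k
      using rad[of k] that by (auto simp: divide_right_mono)
    obtain k' q z E where E: "k' \<ge> Suc k" "k' \<ge> 1" "q \<in> freq a k'" "z \<in> int_lattice" "open E"
      "E \<subseteq> Q \<inter> slab q (c k' - z) (real k' * (rad k' / real k'))" "E - U \<notin> null_sets lborel"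
      by (rule mtp_step[where r = "\<lambda>k. rad k / real k" and b = b and \<rho> = \<rho> and N = "Suc k" and a = a and c = c,
            folded U_def d_def, OF r g f fg anti inf div dim \<rho> Q])
    have "emeasure lborel E \<le> emeasure lborel (box 0 (One :: real ^ 'm ^ 'n))"
      using E(5,6) Q(2) by (intro emeasure_mono) auto
    then have "emeasure lborel E < \<infinity>" using emeasure_lborel_box_finite by (rule le_less_trans)
    from open_shrink[OF E(5) this Uo E(7)] obtain G where G: "open G" "closure G \<subseteq> E" "G - U \<notin> null_sets lborel" .
    have GE: "G \<subseteq> E" using G(2) closure_subset by blast
    have "E \<subseteq> resonant q (c k') (rad k')"
      using E(2,4,6) by (auto simp: resonant_eq_slabs)
    then have "P (Suc n) (G, k') \<and> S n x (G, k')"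
      using G GE E(1,3,6) Q(2) by (auto simp: P_def S_def x)
    then show "\<exists>y. P (Suc n) y \<and> S n x y" by blast
  qed
  then obtain h where h: "\<And>n. P n (h n)" "\<And>n. S n (h n) (h (Suc n))" by blast
  define Q k where "Q n = fst (h n)" and "k n = snd (h n)" for n
  have Q: "open (Q n)" "Q n \<subseteq> box 0 One" "Q n - U \<notin> null_sets lborel" for n
    using h(1)[of n] by (auto simp: P_def Q_def split: prod.splits)
  have step: "closure (Q (Suc n)) \<subseteq> Q n" "k n < k (Suc n)" "\<exists>q\<in>freq a (k (Suc n)). Q (Suc n) \<subseteq> resonant q (c (k (Suc n))) (rad (k (Suc n)))" for n
    using h(2)[of n] by (auto simp: S_def Q_def k_def split: prod.splits)
  \<comment> \<open>Removing the open set \<open>U\<close> preserves compactness, and the sets are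
    nonempty because \<open>Q n - U\<close> is not null; a common point therefore avoids
    \<open>U\<close>.\<close>
  define F where "F n = closure (Q n) - U" for n
  have "\<Inter>(range F) \<noteq> {}"
  proof (rule compact_nest)
    fix n
    have "bounded (Q n)" using Q(2)[of n] bounded_box bounded_subset by blast
    then show "compact (F n)" unfolding F_def using Uo by (intro compact_diff) (auto simp: compact_closure)
    have "Q n - U \<noteq> {}" using Q(3)[of n] by (metis null_sets.empty_sets)
    then show "F n \<noteq> {}" using closure_subset[of "Q n"] by (auto simp: F_def)
  next
    have "F (Suc n) \<subseteq> F n" for n using step(1)[of n] closure_subset[of "Q n"] by (auto simp: F_def)
    then show "F n \<subseteq> F m" if "m \<le> n" for m n using that by (rule lift_Suc_antimono_le)
  qed
  then obtain x where x: "\<And>n. x \<in> F n" by blast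
  have xQ: "x \<in> Q n" for n using x[of "Suc n"] step(1)[of n] by (auto simp: F_def)
  have "x \<in> A_set c rad"
  proof (rule A_setI)
    have "x \<in> box 0 One" using xQ[of 0] Q(2)[of 0] by auto
    then show "x \<in> unit_cube_mat" using box_subset_unit_cube by blast
    have mono: "strict_mono k" using step(2) by (rule strict_mono_Suc_iff[THEN iffD2, rule_format])
    have "range (\<lambda>n. k (Suc n)) \<subseteq> {k. \<exists>q\<in>freq a k. x \<in> resonant q (c k) (rad k)}"
      using step(3) xQ by blast
    moreover have "infinite (range (\<lambda>n. k (Suc n)))"
      using mono by (intro range_inj_infinite) (auto simp: inj_def strict_mono_eq)
    ultimately show "infinite {k. \<exists>q\<in>freq a k. x \<in> resonant q (c k) (rad k)}"
      using finite_subset by blast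
  qed
  moreover have "x \<notin> U" using x[of 0] by (simp add: F_def)
  ultimately show ?thesis by blast
qed

section \<open>The convergence case\<close>

lemma int_vec_norm_bounds:
  fixes q :: "int ^ 'n"
  shows "\<bar>q $ i\<bar> \<le> int (int_vec_norm q)" "\<exists>i. \<bar>q $ i\<bar> = int (int_vec_norm q)"
proof -
  have "\<bar>q $ j\<bar> \<le> Max (range (\<lambda>i. \<bar>q $ i\<bar>))" for j by (rule Max_ge) auto
  then have *: "\<bar>q $ j\<bar> \<le> Max (range (\<lambda>i. \<bar>q $ i\<bar>))" for j .
  then have "0 \<le> Max (range (\<lambda>i. \<bar>q $ i\<bar>))" using order_trans[OF abs_ge_zero] by blast
  then have eq: "int (int_vec_norm q) = Max (range (\<lambda>i. \<bar>q $ i\<bar>))" by (simp add: int_vec_norm_def)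
  show "\<bar>q $ i\<bar> \<le> int (int_vec_norm q)" using * eq by simp
  have "Max (range (\<lambda>i. \<bar>q $ i\<bar>)) \<in> range (\<lambda>i. \<bar>q $ i\<bar>)" by (rule Max_in) auto
  then obtain j where "Max (range (\<lambda>i. \<bar>q $ i\<bar>)) = \<bar>q $ j\<bar>" by (rule rangeE)
  then show "\<exists>i. \<bar>q $ i\<bar> = int (int_vec_norm q)" using eq by (intro exI[of _ j]) simp
qed

lemma finite_int_vec_norm_eq: "finite {q :: int ^ 'n. int_vec_norm q = k}"
proof (rule finite_subset)
  show "{q :: int ^ 'n. int_vec_norm q = k} \<subseteq> {q. \<forall>i. q $ i \<in> {- int k..int k}}"
  proof clarify
    fix q :: "int ^ 'n" and i assume "k = int_vec_norm q"
    then show "q $ i \<in> {- int (int_vec_norm q)..int (int_vec_norm q)}"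
      using int_vec_norm_bounds(1)[of q i] by (auto simp: abs_le_iff)
  qed
  show "finite {q :: int ^ 'n. \<forall>i. q $ i \<in> {- int k..int k}}" by (rule card_int_vec) simp
qed

text \<open>Some coordinate attains the norm and has two possible values; the others have at most
  \<open>2 * k + 1 \<le> 3 * k\<close>. The choice of that coordinate costs the factor
  \<open>CARD('n)\<close>.\<close>

lemma card_int_vec_norm_eq_le:
  assumes "k \<ge> 1"
  shows "real (card {q :: int ^ 'n. int_vec_norm q = k}) \<le> (2 * CARD('n) * 3 ^ (CARD('n) - 1)) * real k ^ (CARD('n) - 1)"
proof -
  define T where "T a i = (if i = a then {- int k, int k} else {- int k..int k})" for a i :: 'n
  have fin: "finite (T a i)" for a i by (simp add: T_def)
  have sub: "{q :: int ^ 'n. int_vec_norm q = k} \<subseteq> (\<Union>a. {q. \<forall>i. q $ i \<in> T a i})"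
  proof clarify
    fix q :: "int ^ 'n" assume k: "k = int_vec_norm q"
    obtain a where a: "\<bar>q $ a\<bar> = int (int_vec_norm q)" using int_vec_norm_bounds(2) by blast
    have "q $ i \<in> T a i" for i
      using a int_vec_norm_bounds(1)[of q i] by (auto simp: T_def k abs_le_iff abs_if split: if_splits)
    then show "q \<in> (\<Union>a. {q. \<forall>i. q $ i \<in> T a i})" by blast
  qed
  have cardT: "card {q :: int ^ 'n. \<forall>i. q $ i \<in> T a i} = 2 * (2 * k + 1) ^ (CARD('n) - 1)" for a
  proof -
    have "card {q :: int ^ 'n. \<forall>i. q $ i \<in> T a i} = (\<Prod>i\<in>UNIV. card (T a i))"
      by (rule card_int_vec(2), rule fin)
    also have "\<dots> = card (T a a) * (\<Prod>i\<in>UNIV - {a}. card (T a i))"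
      by (rule prod.remove) auto
    also have "(\<Prod>i\<in>UNIV - {a}. card (T a i)) = (\<Prod>i\<in>UNIV - {a}. 2 * k + 1)"
      by (rule prod.cong) (auto simp: T_def)
    also have "\<dots> = (2 * k + 1) ^ (CARD('n) - 1)" by simp
    also have "card (T a a) = 2" using assms by (simp add: T_def)
    finally show ?thesis .
  qed
  have "card {q :: int ^ 'n. int_vec_norm q = k} \<le> card (\<Union>a. {q :: int ^ 'n. \<forall>i. q $ i \<in> T a i})"
    using sub by (intro card_mono finite_UN_I card_int_vec(1)) (auto simp: fin)
  also have "\<dots> \<le> (\<Sum>a\<in>UNIV. card {q :: int ^ 'n. \<forall>i. q $ i \<in> T a i})"
    by (rule card_UN_le) simp
  also have "\<dots> = CARD('n) * (2 * (2 * k + 1) ^ (CARD('n) - 1))" by (simp add: cardT)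
  also have "\<dots> \<le> CARD('n) * (2 * (3 * k) ^ (CARD('n) - 1))"
    using assms by (intro mult_left_mono power_mono) auto
  finally have "real (card {q :: int ^ 'n. int_vec_norm q = k}) \<le> real (CARD('n) * (2 * (3 * k) ^ (CARD('n) - 1)))"
    by (rule of_nat_mono)
  then show ?thesis by (simp add: power_mult_distrib mult_ac)
qed

text \<open>Averaging over a full period of the form, along displacements of length at most
  \<open>CARD('m)\<close>, replaces the resonance condition by the measure of \<open>target\<close>.
  No smallness of \<open>\<psi>\<close> enters, because \<open>emeasure_target_le\<close> may
  overcount.\<close>

lemma emeasure_resonant_ball_le:
  fixes c :: "real ^ 'm" and q :: "int ^ 'n"
  assumes \<psi>: "\<psi> \<ge> 0" and q: "q $ i \<noteq> 0"
  shows "emeasure lborel (ball 0 t \<inter> resonant q c \<psi>) \<le> emeasure lborel (ball (0 :: real ^ 'm ^ 'n) (t + real CARD('m))) * ennreal ((2 * \<psi>) ^ CARD('m))"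
proof -
  define w where "w = axis i (1 / real_of_int (q $ i))"
  have qw: "real_vec q \<bullet> w = 1" using q by (simp add: w_def inner_axis)
  let ?I = "emeasure lborel (ball 0 t \<inter> resonant q c \<psi>)" and ?B = "ball (0 :: real ^ 'm ^ 'n) (t + real CARD('m))"
  let ?F = "indicator (target c \<psi>) :: real ^ 'm \<Rightarrow> ennreal"
  have [measurable]: "?B \<in> sets borel" by simp
  have "?I = (\<integral>\<^sup>+u. indicator (half_open_cube :: (real ^ 'm) set) u * ?I \<partial>lborel)"
    by (subst nn_integral_multc) (simp_all add: emeasure_half_open_cube)
  also have "\<dots> \<le> (\<integral>\<^sup>+u. \<integral>\<^sup>+x. indicator ?B x * (indicator half_open_cube u * ?F (u + real_vec q v* x)) \<partial>lborel \<partial>lborel)"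
  proof (rule nn_integral_mono)
    fix u :: "real ^ 'm"
    show "indicator half_open_cube u * ?I \<le> (\<integral>\<^sup>+x. indicator ?B x * (indicator half_open_cube u * ?F (u + real_vec q v* x)) \<partial>lborel)"
    proof (cases "u \<in> half_open_cube")
      case True
      have "1 \<le> \<bar>q $ i\<bar>" using q by linarith
      then have "1 \<le> \<bar>real_of_int (q $ i)\<bar>" by (metis of_int_1_le_iff of_int_abs)
      then have "\<bar>1 / real_of_int (q $ i)\<bar> \<le> 1" by simp
      then have "norm (tensor w u) \<le> 1 * real CARD('m)"
        unfolding w_def norm_tensor_axis by (intro mult_mono norm_half_open_cube_le True) auto
      then have tw: "norm (tensor w u) \<le> CARD('m)" by simp
      have "?I = (\<integral>\<^sup>+x. indicator (ball 0 t \<inter> resonant q c \<psi>) (x + tensor w u) \<partial>lborel)"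
      proof -
        have m: "ball (0 :: real ^ 'm ^ 'n) t \<inter> resonant q c \<psi> \<in> sets borel" by (intro sets.Int) auto
        then have i: "indicator (ball 0 t \<inter> resonant q c \<psi>) \<in> borel_measurable (borel :: (real ^ 'm ^ 'n) measure)"
          by (rule borel_measurable_indicator)
        show ?thesis
          unfolding nn_integral_lborel_shift[OF i] using m by simp
      qed
      also have "\<dots> \<le> (\<integral>\<^sup>+x. indicator ?B x * (indicator half_open_cube u * ?F (u + real_vec q v* x)) \<partial>lborel)"
      proof (rule nn_integral_mono)
        fix x
        have "norm x \<le> norm (x + tensor w u) + norm (tensor w u)"
          using norm_triangle_ineq4[of "x + tensor w u" "tensor w u"] by (simp only: add_diff_cancel_right')
        then have "x + tensor w u \<in> ball 0 t \<Longrightarrow> x \<in> ?B"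
          using tw unfolding mem_ball_0 by linarith
        then show "indicator (ball 0 t \<inter> resonant q c \<psi>) (x + tensor w u)
           \<le> indicator ?B x * (indicator half_open_cube u * ?F (u + real_vec q v* x))"
          using True by (auto simp: indicator_def resonant_def vec_mat_add_tensor qw add.commute)
      qed
      finally show ?thesis using True by simp
    qed simp
  qed
  also have "\<dots> = (\<integral>\<^sup>+x. \<integral>\<^sup>+u. indicator ?B x * (indicator half_open_cube u * ?F (u + real_vec q v* x)) \<partial>lborel \<partial>lborel)"
    by (rule nn_integral_swap[symmetric]) (simp add: borel_prod[symmetric])
  also have "\<dots> = (\<integral>\<^sup>+x. indicator ?B x * (\<integral>\<^sup>+u. indicator half_open_cube u * ?F (u + real_vec q v* x) \<partial>lborel) \<partial>lborel)"
    by (rule nn_integral_cong, rule nn_integral_cmult) measurable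
  also have "\<dots> = (\<integral>\<^sup>+x. indicator ?B x * (\<integral>\<^sup>+u. indicator half_open_cube u * ?F u \<partial>lborel) \<partial>lborel)"
    by (intro nn_integral_cong arg_cong2[where f = "(*)"] refl nn_integral_torus_shift)
       (simp_all add: indicator_target_periodic)
  also have "\<dots> \<le> (\<integral>\<^sup>+x. indicator ?B x * ennreal ((2 * \<psi>) ^ CARD('m)) \<partial>lborel)"
    by (intro nn_integral_mono mult_left_mono emeasure_target_le \<psi>) auto
  also have "\<dots> = emeasure lborel ?B * ennreal ((2 * \<psi>) ^ CARD('m))"
    by (subst nn_integral_multc) simp_all
  finally show ?thesis .
qed

lemma unit_cube_norm_le: "x \<in> unit_cube_mat \<Longrightarrow> norm x \<le> CARD('n) * CARD('m)" for x :: "real ^ 'm ^ 'n"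
proof -
  assume x: "x \<in> unit_cube_mat"
  have "norm (x $ i) \<le> CARD('m)" for i
  proof -
    have "(\<Sum>j\<in>UNIV. \<bar>x $ i $ j\<bar>) \<le> (\<Sum>j\<in>(UNIV :: 'm set). 1)"
      using x by (intro sum_mono) (simp add: unit_cube_mat_def)
    then show ?thesis using norm_le_l1_cart[of "x $ i"] by simp
  qed
  then have "(\<Sum>i\<in>UNIV. norm (x $ i)) \<le> (\<Sum>i\<in>(UNIV :: 'n set). real CARD('m))" by (intro sum_mono)
  moreover have "norm x \<le> (\<Sum>i\<in>UNIV. norm (x $ i))" unfolding norm_vec_def by (rule L2_set_le_sum) simp
  ultimately show ?thesis by simp
qed

text \<open>A maximal \<open>r\<close>-separated subset covers at scale \<open>r\<close>. The balls
  of radius \<open>r / 2\<close> about its points are disjoint and lie in a slightly wider resonant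
  set, whose volume bounds their number.\<close>

lemma resonant_finite_cover:
  fixes q :: "int ^ 'n"
  obtains C :: real where "C > 0" "\<And>(q :: int ^ 'n) (c :: real ^ 'm) k r. int_vec_norm q = k \<Longrightarrow> k \<ge> 1 \<Longrightarrow> 0 < r \<Longrightarrow> r \<le> 1 \<Longrightarrow>
    \<exists>Y. finite Y \<and> unit_cube_mat \<inter> resonant q c (real k * r) \<subseteq> (\<Union>y\<in>Y. ball y r) \<and>
      real (card Y) * r ^ DIM(real ^ 'm ^ 'n) \<le> C * (real k * r) ^ CARD('m)"
proof -
  let ?d = "DIM(real ^ 'm ^ 'n)" and ?w = "measure lborel (ball (0 :: real ^ 'm ^ 'n) 1)"
  define t where "t = real CARD('n) * real CARD('m) + 1"
  define V where "V = measure lborel (ball (0 :: real ^ 'm ^ 'n) (t + real CARD('m)))"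
  have w: "?w > 0" by (simp add: content_ball_pos)
  have V: "V > 0" unfolding V_def t_def by (intro content_ball_pos) (simp add: add_pos_nonneg)
  define C where "C = V * (2 * (1 + real CARD('n))) ^ CARD('m) * 2 ^ ?d / ?w"
  have C: "C > 0" using V w by (simp add: C_def)
  show ?thesis
  proof (rule that[OF C])
    fix q :: "int ^ 'n" and c :: "real ^ 'm" and k :: nat and r :: real
    assume q: "int_vec_norm q = k" "k \<ge> 1" and r: "0 < r" "r \<le> 1"
    obtain i where i: "\<bar>q $ i\<bar> = int k" using int_vec_norm_bounds(2)[of q] q by blast
    have qi: "q $ i \<noteq> 0" using i q(2) by auto
    define X where "X = unit_cube_mat \<inter> resonant q c (real k * r)"
    \<comment> \<open>Within distance \<open>r\<close> each entry of the form changes by at most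
      \<open>CARD('n) * k * r\<close>.\<close>
    define \<psi> where "\<psi> = (1 + real CARD('n)) * (real k * r)"
    define sep where "sep Y \<longleftrightarrow> finite Y \<and> Y \<subseteq> X \<and> (\<forall>y\<in>Y. \<forall>z\<in>Y. y \<noteq> z \<longrightarrow> r \<le> dist y z)" for Y
    have bound: "real (card Y) * r ^ ?d \<le> C * (real k * r) ^ CARD('m)" if Y: "sep Y" for Y
    proof -
      have sub: "ball y (r / 2) \<subseteq> ball 0 t \<inter> resonant q c \<psi>" if "y \<in> Y" for y
      proof
        fix x assume x: "x \<in> ball y (r / 2)"
        have y: "y \<in> unit_cube_mat" "y \<in> resonant q c (real k * r)" using Y that by (auto simp: sep_def X_def)
        have "norm x \<le> norm y + dist y x" using norm_triangle_ineq2[of x y] by (simp add: dist_norm norm_minus_commute)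
        then have "x \<in> ball 0 t" using x r unit_cube_norm_le[OF y(1)] by (simp add: t_def)
        moreover have "x \<in> resonant q c \<psi>"
        proof -
          obtain z where z: "z \<in> int_lattice" "real_vec q v* y + z \<in> open_cube c (real k * r)"
            using y(2) by (auto simp: resonant_def target_def)
          have "real_vec q v* x + z \<in> open_cube c \<psi>"
            unfolding open_cube_def
          proof (intro CollectI allI)
            fix j
            have "\<bar>(real_vec q v* x) $ j - (real_vec q v* y) $ j\<bar> \<le> CARD('n) * real k * dist x y"
            proof (rule vec_mat_nth_diff_le)
              fix l
              have "of_int \<bar>q $ l\<bar> \<le> (of_int (int k) :: real)"
                using int_vec_norm_bounds(1)[of q l] q(1) by (simp only: of_int_le_iff)
              then show "\<bar>real_vec q $ l\<bar> \<le> real k" by simp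
            qed
            also have "\<dots> \<le> CARD('n) * real k * r"
              using x r by (intro mult_left_mono) (auto simp: dist_commute)
            finally have "\<bar>(real_vec q v* x) $ j - (real_vec q v* y) $ j\<bar> \<le> CARD('n) * real k * r" .
            moreover have "\<bar>(real_vec q v* y) $ j + z $ j - c $ j\<bar> < real k * r"
              using z(2) by (simp add: open_cube_def)
            ultimately have "\<bar>(real_vec q v* x) $ j + z $ j - c $ j\<bar> < real k * r + CARD('n) * real k * r"
              by linarith
            then show "\<bar>(real_vec q v* x + z) $ j - c $ j\<bar> < \<psi>" by (simp add: \<psi>_def distrib_right mult.assoc)
          qed
          then show ?thesis using z(1) by (auto simp: resonant_def target_def)
        qed
        ultimately show "x \<in> ball 0 t \<inter> resonant q c \<psi>" by blast
      qed
      have disj: "disjoint_family_on (\<lambda>y. ball y (r / 2)) Y"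
        unfolding disjoint_family_on_def
      proof (intro ballI impI)
        fix y z assume "y \<in> Y" "z \<in> Y" "y \<noteq> z"
        then have "r \<le> dist y z" using Y by (auto simp: sep_def)
        then show "ball y (r / 2) \<inter> ball z (r / 2) = {}" by (intro disjoint_ballI) simp
      qed
      have fY: "finite Y" using Y by (simp add: sep_def)
      have "real (card Y) * ((r / 2) ^ ?d * ?w) = (\<Sum>y\<in>Y. measure lborel (ball y (r / 2)))"
        using r by (simp only: content_ball_conv_unit_ball[of "r / 2"] sum_constant less_imp_le half_gt_zero)
      also have "\<dots> = measure lborel (\<Union>y\<in>Y. ball y (r / 2))"
        using fY disj by (intro measure_finite_Union[symmetric]) (auto simp: fmeasurableD2[OF ball_fmeasurable])
      also have "\<dots> \<le> measure lborel (ball 0 t \<inter> resonant q c \<psi>)"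
        using sub fY by (intro measure_mono_fmeasurable ball_fmeasurable_Int) auto
      also have "\<dots> \<le> V * (2 * \<psi>) ^ CARD('m)"
      proof -
        have \<psi>0: "\<psi> \<ge> 0" using r by (simp add: \<psi>_def)
        have "emeasure lborel (ball 0 t \<inter> resonant q c \<psi>) \<le> ennreal (V * (2 * \<psi>) ^ CARD('m))"
          using emeasure_resonant_ball_le[OF \<psi>0 qi, of t c] V \<psi>0
          by (simp add: V_def ennreal_mult emeasure_eq_measure2[OF ball_fmeasurable])
        then show ?thesis unfolding measure_def[of lborel "ball 0 t \<inter> resonant q c \<psi>"] using V \<psi>0 by (intro enn2real_leI) auto
      qed
      also have "(2 * \<psi>) ^ CARD('m) = (2 * (1 + real CARD('n))) ^ CARD('m) * (real k * r) ^ CARD('m)"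
      proof -
        have "2 * \<psi> = (2 * (1 + real CARD('n))) * (real k * r)" by (simp add: \<psi>_def)
        then show ?thesis by (simp only: power_mult_distrib)
      qed
      finally have "real (card Y) * (r / 2) ^ ?d * ?w \<le> (V * (2 * (1 + real CARD('n))) ^ CARD('m)) * (real k * r) ^ CARD('m)"
        by (simp only: mult.assoc)
      then have "real (card Y) * r ^ ?d * ?w \<le> (V * (2 * (1 + real CARD('n))) ^ CARD('m) * 2 ^ ?d) * (real k * r) ^ CARD('m)"
        by (simp add: power_divide field_simps)
      then show ?thesis using w by (simp add: C_def field_simps)
    qed
    \<comment> \<open>A uniform bound on the size of separated sets, so that one of largest
      cardinality exists.\<close>
    define B where "B = nat \<lceil>C * (real k * r) ^ CARD('m) / r ^ ?d\<rceil>"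
    have cardB: "card Y \<le> B" if "sep Y" for Y
    proof -
      have "real (card Y) \<le> C * (real k * r) ^ CARD('m) / r ^ ?d" using bound[OF that] r by (simp add: pos_le_divide_eq)
      then show ?thesis unfolding B_def by linarith
    qed
    have "sep {}" by (simp add: sep_def)
    then obtain Y where Y: "sep Y" "\<And>Z. sep Z \<Longrightarrow> card Z \<le> card Y"
      using ex_has_greatest_nat[of sep "{}" card "Suc B"] cardB by (metis le_imp_less_Suc)
    have "X \<subseteq> (\<Union>y\<in>Y. ball y r)"
    proof
      fix x assume x: "x \<in> X"
      show "x \<in> (\<Union>y\<in>Y. ball y r)"
      proof (rule ccontr)
        assume "x \<notin> (\<Union>y\<in>Y. ball y r)"
        then have far: "r \<le> dist y x" if "y \<in> Y" for y using that by (auto simp: not_less)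
        then have "x \<notin> Y" using r by force
        have "sep (insert x Y)" using Y(1) x far by (auto simp: sep_def dist_commute)
        then have "card (insert x Y) \<le> card Y" by (rule Y(2))
        then show False using \<open>x \<notin> Y\<close> Y(1) by (simp add: sep_def)
      qed
    qed
    then show "\<exists>Y. finite Y \<and> unit_cube_mat \<inter> resonant q c (real k * r) \<subseteq> (\<Union>y\<in>Y. ball y r) \<and>
      real (card Y) * r ^ ?d \<le> C * (real k * r) ^ CARD('m)"
      using Y(1) bound[OF Y(1)] by (intro exI[of _ Y]) (auto simp: sep_def X_def)
  qed
qed

text \<open>Each \<open>q\<close> admits finitely many \<open>p\<close>, and each norm belongs to
  finitely many \<open>q\<close>; infinitely many pairs therefore force arbitrarily large
  norms.\<close>

lemma A_set_subset_tail:
  "A_set c rad \<subseteq> (\<Union>k\<in>{Suc N..}. \<Union>q\<in>{q :: int ^ 'n. int_vec_norm q = k}. unit_cube_mat \<inter> resonant q (c k :: real ^ 'm) (rad k))"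
proof
  fix x :: "real ^ 'm ^ 'n" assume x: "x \<in> A_set c rad"
  define S where "S = {(p :: int ^ 'm, q :: int ^ 'n). q \<noteq> 0 \<and>
        (\<forall>j. \<bar>(real_vec q v* x) $ j + of_int (p $ j) - c (int_vec_norm q) $ j\<bar> < rad (int_vec_norm q))}"
  have xc: "x \<in> unit_cube_mat" and inf: "infinite S"
    using x by (auto simp: A_set_def S_def real_vec_def)
  have fin: "finite {p. (p, q) \<in> S}" for q
  proof (cases "rad (int_vec_norm q) > 0")
    case True
    define T where "T j = {i :: int. c (int_vec_norm q) $ j - (real_vec q v* x) $ j - rad (int_vec_norm q) < i \<and>
        i < c (int_vec_norm q) $ j - (real_vec q v* x) $ j + rad (int_vec_norm q)}" for j
    have "finite (T j)" for j unfolding T_def using True by (intro card_int_between) simp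
    then have "finite {p :: int ^ 'm. \<forall>j. p $ j \<in> T j}" by (rule card_int_vec)
    moreover have "{p. (p, q) \<in> S} \<subseteq> {p. \<forall>j. p $ j \<in> T j}"
      by (auto simp: S_def T_def abs_less_iff algebra_simps)
    ultimately show ?thesis using finite_subset by blast
  next
    case False
    then have "{p. (p, q) \<in> S} = {}" by (auto simp: S_def not_less intro: order_trans[OF _ abs_ge_zero])
    then show ?thesis by simp
  qed
  have "\<exists>p q. (p, q) \<in> S \<and> int_vec_norm q \<ge> Suc N"
  proof (rule ccontr)
    assume "\<not> ?thesis"
    then have sub: "S \<subseteq> (\<Union>q\<in>(\<Union>k\<in>{..N}. {q. int_vec_norm q = k}). (\<lambda>p. (p, q)) ` {p. (p, q) \<in> S})"
      by (auto simp: not_less_eq_eq)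
    have "finite (\<Union>q\<in>(\<Union>k\<in>{..N}. {q :: int ^ 'n. int_vec_norm q = k}). (\<lambda>p. (p, q)) ` {p. (p, q) \<in> S})"
      by (intro finite_UN_I finite_imageI fin finite_int_vec_norm_eq finite_atMost)
    then show False using inf sub finite_subset by blast
  qed
  then obtain p q where pq: "(p, q) \<in> S" "int_vec_norm q \<ge> Suc N" by blast
  have "real_vec q v* x + real_vec p \<in> open_cube (c (int_vec_norm q)) (rad (int_vec_norm q))"
    using pq(1) by (simp add: S_def open_cube_def)
  moreover have "real_vec p \<in> int_lattice" by (simp add: int_lattice_vec)
  ultimately have "x \<in> resonant q (c (int_vec_norm q)) (rad (int_vec_norm q))"
    by (auto simp: resonant_def target_def)
  then show "x \<in> (\<Union>k\<in>{Suc N..}. \<Union>q\<in>{q :: int ^ 'n. int_vec_norm q = k}. unit_cube_mat \<inter> resonant q (c k) (rad k))"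
    using pq(2) xc by auto
qed

theorem hausdorff_measure_A_set_convergent:
  fixes c :: "nat \<Rightarrow> real ^ 'm" and rad :: "nat \<Rightarrow> real" and f g :: "real \<Rightarrow> real"
  defines "d \<equiv> DIM(real ^ 'm ^ 'n)"
  assumes rad: "\<And>k. 0 < rad k"
    and g: "mono_on {0<..} g" "\<And>s. s > 0 \<Longrightarrow> g s > 0"
    and f: "\<And>s. s > 0 \<Longrightarrow> f s > 0" "(f \<longlongrightarrow> 0) (at_right 0)"
    and fg: "\<And>s. s > 0 \<Longrightarrow> f s * s ^ CARD('m) = g s * s ^ d"
    and conv: "summable (\<lambda>k. real (Suc k) ^ (CARD('n) + CARD('m) - 1) * g (rad (Suc k) / real (Suc k)))"
  shows "hausdorff_measure_f f (A_set c rad :: (real ^ 'm ^ 'n) set) = 0"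
proof -
  let ?m = "CARD('m)" and ?n = "CARD('n)"
  define r where "r k = rad k / real k" for k
  define G where "G k = real k ^ (?n + ?m - 1) * g (r k)" for k
  have r0: "r (Suc k) > 0" for k using rad by (simp add: r_def)
  have G0: "G (Suc k) \<ge> 0" for k using g(2)[OF r0[of k]] by (simp add: G_def less_imp_le)
  have conv': "summable (\<lambda>k. G (Suc k))" using conv by (simp add: G_def r_def)
  obtain C :: real where C: "C > 0" "\<And>(q :: int ^ 'n) (c :: real ^ 'm) k r. int_vec_norm q = k \<Longrightarrow> k \<ge> 1 \<Longrightarrow> 0 < r \<Longrightarrow> r \<le> 1 \<Longrightarrow>
    \<exists>Y. finite Y \<and> unit_cube_mat \<inter> resonant q c (real k * r) \<subseteq> (\<Union>y\<in>Y. ball y r) \<and>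
      real (card Y) * r ^ d \<le> C * (real k * r) ^ ?m"
    using resonant_finite_cover[where 'n = 'n and 'm = 'm] unfolding d_def by blast
  define Cq :: real where "Cq = 2 * ?n * 3 ^ (?n - 1)"
  define D where "D = Cq * C"
  have D: "D > 0" using C by (simp add: D_def Cq_def)
  have "hausdorff_measure_f f (A_set c rad :: (real ^ 'm ^ 'n) set) \<le> 0"
  proof (rule hausdorff_measure_le, rule ennreal_le_epsilon)
    fix \<rho> e :: real assume \<rho>: "\<rho> > 0" and e: "e > 0"
    obtain N1 where N1: "\<And>n. n \<ge> N1 \<Longrightarrow> norm (\<Sum>i. G (Suc (i + n))) < e / D"
      using suminf_exist_split[OF _ conv', of "e / D"] e D by auto
    have "(\<lambda>k. G (Suc k)) \<longlonglongrightarrow> 0" by (rule summable_LIMSEQ_zero[OF conv'])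
    then have "\<forall>\<^sub>F k in sequentially. G (Suc k) < g (min \<rho> 1)"
      by (rule order_tendstoD) (use g(2) \<rho> in auto)
    then obtain N2 where N2: "\<And>k. k \<ge> N2 \<Longrightarrow> G (Suc k) < g (min \<rho> 1)" by (auto simp: eventually_sequentially)
    define N where "N = max N1 N2"
    define K where "K j = Suc (j + N)" for j
    \<comment> \<open>Small terms force small radii: \<open>g (r (K j)) \<le> G (K j)\<close>, so
      \<open>r (K j) \<ge> min \<rho> 1\<close> would contradict the monotonicity of
      \<open>g\<close>.\<close>
    have rK: "0 < r (K j)" "r (K j) < min \<rho> 1" for j
    proof -
      show 1: "0 < r (K j)" using r0 by (simp add: K_def)
      show "r (K j) < min \<rho> 1"
      proof (rule ccontr)
        assume "\<not> r (K j) < min \<rho> 1"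
        then have "g (min \<rho> 1) \<le> g (r (K j))" using g(1) \<rho> 1 by (auto intro: mono_onD)
        also have "\<dots> \<le> G (K j)"
          using g(2)[OF 1] mult_right_mono[of 1 "real (K j) ^ (?n + ?m - 1)" "g (r (K j))"] by (simp add: G_def K_def)
        finally have "g (min \<rho> 1) \<le> G (Suc (j + N))" by (simp only: K_def)
        moreover have "N2 \<le> j + N" by (simp add: N_def)
        ultimately show False using N2[of "j + N"] by simp
      qed
    qed
    define good where "good j q Y \<longleftrightarrow> finite Y \<and> unit_cube_mat \<inter> resonant q (c (K j)) (rad (K j)) \<subseteq> (\<Union>y\<in>Y. ball y (r (K j))) \<and>
      real (card Y) * r (K j) ^ d \<le> C * (real (K j) * r (K j)) ^ ?m" for j and q :: "int ^ 'n" and Y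
    have "\<exists>Y. good j q Y" if "int_vec_norm q = K j" for j q
    proof -
      have "rad (K j) = real (K j) * r (K j)" by (simp add: r_def K_def)
      then show ?thesis
        using C(2)[OF that _ rK(1)[of j], of "c (K j)"] rK(2)[of j] unfolding good_def by (simp add: K_def)
    qed
    note ex = this
    define Y where "Y j q = (SOME Y. good j q Y)" for j q
    have Y0: "good j q (Y j q)" if "int_vec_norm q = K j" for j q
      unfolding Y_def by (rule someI_ex) (rule ex[OF that])
    have Y: "finite (Y j q)"
      "unit_cube_mat \<inter> resonant q (c (K j)) (rad (K j)) \<subseteq> (\<Union>y\<in>Y j q. ball y (r (K j)))"
      "real (card (Y j q)) * r (K j) ^ d \<le> C * (real (K j) * r (K j)) ^ ?m" if "int_vec_norm q = K j" for j q
      using Y0[OF that] by (simp_all only: good_def)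
    define Qs where "Qs j = {q :: int ^ 'n. int_vec_norm q = K j}" for j
    define P where "P j = Sigma (Qs j) (Y j)" for j
    have finP: "finite (P j)" for j
      unfolding P_def using finite_int_vec_norm_eq Y(1) by (intro finite_SigmaI) (auto simp: Qs_def)
    \<comment> \<open>Triples of a level \<open>j\<close>, a frequency of norm \<open>K j\<close>
      and a centre; the radius depends on \<open>j\<close> alone.\<close>
    define I where "I = Sigma UNIV P"
    have "hausdorff_content f \<rho> (A_set c rad :: (real ^ 'm ^ 'n) set) \<le> (\<integral>\<^sup>+i. ennreal (f (r (K (fst i)))) \<partial>count_space I)"
    proof (rule hausdorff_content_le_sum[OF _ _ _ \<rho> f(2)])
      show "countable I" unfolding I_def using finP by (intro countable_SIGMA) (auto intro: countable_finite)
      show "A_set c rad \<subseteq> (\<Union>i\<in>I. ball (snd (snd i)) (r (K (fst i))))"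
      proof
        fix x :: "real ^ 'm ^ 'n" assume "x \<in> A_set c rad"
        then obtain k q where k: "k \<ge> Suc N" "int_vec_norm q = k" "x \<in> unit_cube_mat \<inter> resonant q (c k) (rad k)"
          using A_set_subset_tail[of c rad N] by blast
        define j where "j = k - Suc N"
        have "k = K j" using k(1) by (simp add: j_def K_def)
        then obtain y where "y \<in> Y j q" "x \<in> ball y (r (K j))" using Y(2)[of q j] k by blast
        moreover have "(j, q, y) \<in> I" using \<open>y \<in> Y j q\<close> k(2) \<open>k = K j\<close> by (simp add: I_def P_def Qs_def)
        ultimately show "x \<in> (\<Union>i\<in>I. ball (snd (snd i)) (r (K (fst i))))" by force
      qed
    qed (use rK in auto)
    also have "\<dots> = (\<integral>\<^sup>+i. ennreal (f (r (K (fst i)))) * indicator I i \<partial>count_space UNIV)"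
      by (rule nn_integral_count_space_indicator) simp
    also have "\<dots> = (\<integral>\<^sup>+j. \<integral>\<^sup>+p. ennreal (f (r (K j))) * indicator I (j, p) \<partial>count_space UNIV \<partial>count_space UNIV)"
      by (subst nn_integral_fst_count_space[symmetric]) simp
    also have "\<dots> = (\<integral>\<^sup>+j. ennreal (f (r (K j)) * card (P j)) \<partial>count_space UNIV)"
    proof (rule nn_integral_cong)
      fix j
      have "(\<integral>\<^sup>+p. ennreal (f (r (K j))) * indicator I (j, p) \<partial>count_space UNIV)
        = (\<integral>\<^sup>+p. ennreal (f (r (K j))) * indicator (P j) p \<partial>count_space UNIV)"
        by (rule nn_integral_cong) (simp add: I_def indicator_def)
      also have "\<dots> = ennreal (f (r (K j))) * emeasure (count_space UNIV) (P j)"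
        by (rule nn_integral_cmult_indicator) simp
      also have "\<dots> = ennreal (f (r (K j))) * ennreal (real (card (P j)))"
        using finP[of j] by (simp add: emeasure_count_space_finite ennreal_of_nat_eq_real_of_nat)
      also have "\<dots> = ennreal (f (r (K j)) * card (P j))"
        using f(1)[OF rK(1)[of j]] by (subst ennreal_mult) auto
      finally show "(\<integral>\<^sup>+p. ennreal (f (r (K j))) * indicator I (j, p) \<partial>count_space UNIV) = ennreal (f (r (K j)) * card (P j))" .
    qed
    also have "\<dots> \<le> (\<integral>\<^sup>+j. ennreal (D * G (K j)) \<partial>count_space UNIV)"
    proof (rule nn_integral_mono, rule ennreal_leI)
      fix j
      define R k where "R = r (K j)" and "k = real (K j)"
      have R: "R > 0" using rK by (simp add: R_def)
      have k: "k > 0" by (simp add: k_def K_def)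
      have "real (card (P j)) * R ^ d = (\<Sum>q\<in>Qs j. real (card (Y j q)) * R ^ d)"
        unfolding P_def using finite_int_vec_norm_eq Y(1)
        by (subst card_SigmaI) (auto simp: Qs_def sum_distrib_right)
      also have "\<dots> \<le> (\<Sum>q\<in>Qs j. C * (k * R) ^ ?m)"
        unfolding R_def k_def by (intro sum_mono Y(3)) (simp add: Qs_def)
      also have "\<dots> = real (card (Qs j)) * (C * (k * R) ^ ?m)" by simp
      also have "\<dots> \<le> (Cq * k ^ (?n - 1)) * (C * (k * R) ^ ?m)"
      proof (rule mult_right_mono)
        show "real (card (Qs j)) \<le> Cq * k ^ (?n - 1)"
          unfolding Qs_def Cq_def k_def using card_int_vec_norm_eq_le[of "K j", where 'n = 'n] by (simp add: K_def)
      qed (use C k R in auto)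
      also have "\<dots> = D * (k ^ (?n - 1) * k ^ ?m) * R ^ ?m" by (simp add: D_def power_mult_distrib)
      also have "k ^ (?n - 1) * k ^ ?m = k ^ (?n + ?m - 1)"
      proof -
        have "?n + ?m - 1 = (?n - 1) + ?m" by simp
        then show ?thesis by (simp only: power_add)
      qed
      finally have card: "real (card (P j)) * R ^ d \<le> D * k ^ (?n + ?m - 1) * R ^ ?m" .
      \<comment> \<open>The relation between \<open>f\<close> and \<open>g\<close> turns the number
        of balls times \<open>f R\<close> into the general term of the series.\<close>
      have "f R * real (card (P j)) * R ^ d \<le> f R * (D * k ^ (?n + ?m - 1) * R ^ ?m)"
        using mult_left_mono[OF card, of "f R"] f(1)[OF R] by (simp add: mult.assoc)
      also have "\<dots> = D * k ^ (?n + ?m - 1) * (f R * R ^ ?m)" by simp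
      also have "\<dots> = D * (k ^ (?n + ?m - 1) * g R) * R ^ d" by (simp add: fg[OF R])
      finally have "f R * real (card (P j)) \<le> D * (k ^ (?n + ?m - 1) * g R)"
        using R by (simp only: mult_le_cancel_right_pos zero_less_power)
      then show "f (r (K j)) * card (P j) \<le> D * G (K j)" by (simp add: R_def k_def G_def)
    qed
    also have "\<dots> = (\<Sum>j. ennreal (D * G (K j)))" by (rule nn_integral_count_space_nat)
    also have "\<dots> = ennreal (\<Sum>j. D * G (K j))"
    proof (rule suminf_ennreal2)
      show "0 \<le> D * G (K j)" for j using D G0 by (simp add: K_def)
      have "summable (\<lambda>j. G (Suc (j + N)))" using conv' by (subst summable_iff_shift) 
      then show "summable (\<lambda>j. D * G (K j))" unfolding K_def by (rule summable_mult)
    qed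
    also have "(\<Sum>j. D * G (K j)) = D * (\<Sum>j. G (Suc (j + N)))"
      unfolding K_def using conv' by (intro suminf_mult) (subst summable_iff_shift)
    also have "ennreal \<dots> \<le> ennreal e"
    proof (rule ennreal_leI)
      have "(\<Sum>j. G (Suc (j + N))) < e / D" using N1[of N] by (simp add: N_def abs_less_iff)
      then show "D * (\<Sum>j. G (Suc (j + N))) \<le> e" using D by (simp add: pos_less_divide_eq mult.commute)
    qed
    finally show "hausdorff_content f \<rho> (A_set c rad :: (real ^ 'm ^ 'n) set) \<le> 0 + ennreal e" by simp
  qed
  then show ?thesis by simp
qed

section \<open>Infinite measure, full measure and the dichotomy\<close>

theorem hausdorff_measure_A_set_infinite:
  fixes c :: "nat \<Rightarrow> real ^ 'm" and rad :: "nat \<Rightarrow> real" and f g :: "real \<Rightarrow> real"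
  defines "d \<equiv> DIM(real ^ 'm ^ 'n)"
  assumes rad: "\<And>k. 0 < rad k" "\<And>k. rad k \<le> 1"
    and g: "mono_on {0<..} g" "\<And>s. s > 0 \<Longrightarrow> g s > 0" "(g \<longlongrightarrow> 0) (at_right 0)"
    and f: "mono_on {0<..} f" "\<And>s. s > 0 \<Longrightarrow> f s > 0"
    and fg: "\<And>s. s > 0 \<Longrightarrow> f s * s ^ CARD('m) = g s * s ^ d"
    and anti: "\<And>s t. 0 < s \<Longrightarrow> s \<le> t \<Longrightarrow> f t / t ^ d \<le> f s / s ^ d"
    and inf: "\<And>M. \<exists>r0>0. \<forall>s. 0 < s \<and> s < r0 \<longrightarrow> M \<le> f s / s ^ d"
    and div: "\<not> summable (\<lambda>k. real (Suc k) ^ (CARD('n) + CARD('m) - 1) * g (rad (Suc k) / real (Suc k)))"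
    and dim: "CARD('n) + CARD('m) \<ge> 4"
  shows "hausdorff_measure_f f (A_set c rad :: (real ^ 'm ^ 'n) set) = \<infinity>"
proof (rule ccontr)
  assume fin: "hausdorff_measure_f f (A_set c rad :: (real ^ 'm ^ 'n) set) \<noteq> \<infinity>"
  define H where "H = enn2real (hausdorff_measure_f f (A_set c rad :: (real ^ 'm ^ 'n) set))"
  have H: "H \<ge> 0" "hausdorff_measure_f f (A_set c rad :: (real ^ 'm ^ 'n) set) = ennreal H"
    using fin by (auto simp: H_def less_top)
  define w where "w = measure lborel (ball (0 :: real ^ 'm ^ 'n) 1)"
  have w: "w > 0" by (simp add: w_def content_ball_pos)
  \<comment> \<open>A cover of mass below \<open>H + 1\<close> by balls with
    \<open>M * s ^ d \<le> f s\<close> has volume at most \<open>w * (H + 1) / M = 1 / 2\<close>, so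
    at least half of the unit box stays uncovered.\<close>
  define M where "M = 2 * w * (H + 1)"
  have M: "M > 0" using w H by (simp add: M_def)
  obtain r0 where r0: "r0 > 0" "\<And>s. 0 < s \<Longrightarrow> s < r0 \<Longrightarrow> M \<le> f s / s ^ d" using inf[of M] by blast
  have "hausdorff_content f r0 (A_set c rad :: (real ^ 'm ^ 'n) set) \<le> ennreal H"
    using hausdorff_content_le_measure[OF r0(1), of f "A_set c rad :: (real ^ 'm ^ 'n) set"] H(2) by simp
  also have "\<dots> < ennreal (H + 1)" using H(1) by (simp add: ennreal_less_iff)
  finally have "hausdorff_content f r0 (A_set c rad :: (real ^ 'm ^ 'n) set) < ennreal (H + 1)" .
  from hausdorff_content_cover[OF this]
  obtain b \<rho> where cover: "\<forall>i::nat. 0 < \<rho> i \<and> \<rho> i < r0" "A_set c rad \<subseteq> (\<Union>i. ball (b i :: real ^ 'm ^ 'n) (\<rho> i))"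
    "(\<Sum>i. ennreal (f (\<rho> i))) < ennreal (H + 1)"
    by (elim exE conjE)
  have b: "0 < \<rho> i" "\<rho> i < r0" for i using cover(1) by auto
  have f0: "f (\<rho> i) \<ge> 0" for i using f(2)[OF b(1)[of i]] by simp
  have sum: "summable (\<lambda>i. f (\<rho> i))"
    using cover(3) by (intro summable_suminf_not_top f0) (auto simp: less_top[symmetric] dest: less_trans[OF _ ennreal_less_top])
  have sumle: "(\<Sum>i. f (\<rho> i)) < H + 1"
  proof -
    have "ennreal (\<Sum>i. f (\<rho> i)) < ennreal (H + 1)"
      using cover(3) unfolding suminf_ennreal2[OF f0 sum] .
    then show ?thesis using suminf_nonneg[OF sum f0] by (simp only: ennreal_less_iff)
  qed
  define U where "U = (\<Union>i. ball (b i) (\<rho> i))"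
  have "emeasure lborel U \<le> (\<Sum>i. emeasure lborel (ball (b i) (\<rho> i)))"
    unfolding U_def by (rule emeasure_subadditive_countably) (simp add: image_subset_iff)
  also have "\<dots> \<le> (\<Sum>i. ennreal (w / M * f (\<rho> i)))"
  proof (intro suminf_le)
    fix i
    have "M * \<rho> i ^ d \<le> f (\<rho> i)" using r0(2)[OF b(1,2)[of i]] b(1)[of i] by (simp add: pos_le_divide_eq)
    then have "\<rho> i ^ d * w \<le> w / M * f (\<rho> i)" using M w by (simp add: field_simps)
    moreover have "emeasure lborel (ball (b i) (\<rho> i)) = ennreal (\<rho> i ^ d * w)"
      using content_ball_conv_unit_ball[OF less_imp_le[OF b(1)[of i]], of "b i"]
      by (simp add: emeasure_eq_measure2[OF ball_fmeasurable] w_def d_def)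
    ultimately show "emeasure lborel (ball (b i) (\<rho> i)) \<le> ennreal (w / M * f (\<rho> i))" by (simp add: ennreal_leI)
  qed auto
  also have "\<dots> = ennreal (\<Sum>i. w / M * f (\<rho> i))"
    using w M f0 by (intro suminf_ennreal2 summable_mult sum) auto
  also have "(\<Sum>i. w / M * f (\<rho> i)) = w / M * (\<Sum>i. f (\<rho> i))" by (rule suminf_mult[OF sum])
  also have "\<dots> \<le> w / M * (H + 1)" using sumle w M by (intro mult_left_mono) auto
  also have "\<dots> = 1 / 2" using w H by (simp add: M_def)
  finally have U: "emeasure lborel U \<le> ennreal (1/2)" by (simp add: ennreal_leI)
  have Uo: "open U" by (auto simp: U_def)
  have "box 0 One - U \<notin> null_sets lborel"
  proof
    assume null: "box 0 One - U \<in> null_sets lborel"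
    have "(1 :: ennreal) = emeasure lborel (box 0 (One :: real ^ 'm ^ 'n))" by (simp add: emeasure_lborel_box_eq)
    also have "\<dots> \<le> emeasure lborel (U \<union> (box 0 One - U))" using Uo by (intro emeasure_mono) auto
    also have "\<dots> = emeasure lborel U" using Uo null by (intro emeasure_Un_null_set) auto
    also note U
    finally have "ennreal 1 \<le> ennreal (1/2)" by simp
    then show False by (subst (asm) ennreal_le_iff) auto
  qed
  then have "\<not> A_set c rad \<subseteq> U"
    unfolding U_def
    by (intro A_set_not_covered[OF rad g f fg[unfolded d_def] anti[unfolded d_def] inf[unfolded d_def] div dim b(1) sum])
  then show False using cover(2) by (simp add: U_def)
qed

text \<open>Every tail union of resonant sets is full in the open box; the countably many
  exceptional sets and the boundary of the cube make up \<open>Z\<close>.\<close>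

theorem A_set_full_measure:
  fixes c :: "nat \<Rightarrow> real ^ 'm" and rad :: "nat \<Rightarrow> real"
  assumes "\<And>k. 0 < rad k"
    and "\<not> summable (\<lambda>k. real (Suc k) ^ (CARD('n) - 1) * rad (Suc k) ^ CARD('m))"
    and "CARD('n) + CARD('m) \<ge> 4"
  obtains Z where "Z \<in> null_sets lborel" "unit_cube_mat \<subseteq> A_set c rad \<union> (Z :: (real ^ 'm ^ 'n) set)"
proof -
  define a :: 'n where "a = undefined"
  define V where "V N = (\<Union>k\<in>{N..}. \<Union>q\<in>freq a k. resonant q (c k) (rad k) :: (real ^ 'm ^ 'n) set)" for N
  define Z where "Z = (cbox 0 One - box 0 (One :: real ^ 'm ^ 'n)) \<union> (\<Union>N. box 0 One - V N)"
  have "box 0 One - V N \<in> null_sets lborel" for N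
    unfolding V_def using assms by (rule resonant_tail_full)
  moreover have "cbox 0 One - box 0 (One :: real ^ 'm ^ 'n) \<in> null_sets lborel"
  proof -
    have "emeasure lborel (cbox 0 One - box 0 (One :: real ^ 'm ^ 'n)) = emeasure lborel (cbox 0 (One :: real ^ 'm ^ 'n)) - emeasure lborel (box 0 (One :: real ^ 'm ^ 'n))"
      by (intro emeasure_Diff box_subset_cbox) (auto simp: emeasure_lborel_box_eq)
    also have "\<dots> = 0" by (simp add: emeasure_lborel_box_eq emeasure_lborel_cbox_eq)
    finally show ?thesis by (auto simp: null_sets_def)
  qed
  ultimately have "Z \<in> null_sets lborel" unfolding Z_def by (intro null_sets.Un null_sets_UN) auto
  moreover have "unit_cube_mat \<subseteq> A_set c rad \<union> Z"
  proof
    fix x :: "real ^ 'm ^ 'n" assume x: "x \<in> unit_cube_mat"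
    show "x \<in> A_set c rad \<union> Z"
    proof (cases "x \<in> Z")
      case False
      have "0 \<le> x \<bullet> e \<and> x \<bullet> e \<le> 1" if "e \<in> Basis" for e
        using that x by (auto simp: unit_cube_mat_def Basis_vec_def inner_axis)
      then have "x \<in> cbox 0 One" by (simp add: mem_box)
      then have xV: "x \<in> V N" for N using False by (auto simp: Z_def)
      have "\<forall>N. \<exists>k\<ge>N. \<exists>q\<in>freq a k. x \<in> resonant q (c k) (rad k)"
      proof
        fix N show "\<exists>k\<ge>N. \<exists>q\<in>freq a k. x \<in> resonant q (c k) (rad k)"
          using xV[of N] unfolding V_def by auto
      qed
      then have "infinite {k. \<exists>q\<in>freq a k. x \<in> resonant q (c k) (rad k)}"
        unfolding infinite_nat_iff_unbounded_le by simp
      then show ?thesis using A_setI[OF x] by blast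
    qed simp
  qed
  ultimately show ?thesis by (rule that)
qed

lemma A_set_mono: "(\<And>k. rad k \<le> rad' k) \<Longrightarrow> A_set c rad \<subseteq> A_set c rad'"
proof
  fix x assume le: "\<And>k. rad k \<le> rad' k" and x: "x \<in> A_set c rad"
  have "{(p, q). q \<noteq> 0 \<and> (\<forall>j. \<bar>((\<chi> i. of_int (q $ i)) v* x) $ j + of_int (p $ j) - c (int_vec_norm q) $ j\<bar> < rad (int_vec_norm q))}
     \<subseteq> {(p, q). q \<noteq> 0 \<and> (\<forall>j. \<bar>((\<chi> i. of_int (q $ i)) v* x) $ j + of_int (p $ j) - c (int_vec_norm q) $ j\<bar> < rad' (int_vec_norm q))}"
    using le by (auto intro: less_le_trans)
  then show "x \<in> A_set c rad'" using x unfolding A_set_def by (auto dest: finite_subset)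
qed

lemma A_set_subset: "A_set c rad \<subseteq> unit_cube_mat"
  by (auto simp: A_set_def)

text \<open>\<open>rad q\<close> stands for |B_q|^(1/m) / 2, the radius of the ball, and
  \<open>Suc\<close> starts the series at q = 1.\<close>

theorem theorem7:
  fixes c :: "nat \<Rightarrow> real ^ 'm" and rad :: "nat \<Rightarrow> real" and f :: "real \<Rightarrow> real"
  defines "n \<equiv> CARD('n)" and "m \<equiv> CARD('m)"
  defines "g \<equiv> (\<lambda>r. f r / r ^ (m * (n - 1)))"
  assumes nm: "n * m > 2"
    and rad_pos: "\<And>q. rad q > 0"
    and f_dim: "dimension_function f"
    and g_dim: "dimension_function g"
    and mon: "monotonic_on {0<..} (\<lambda>r. f r / r ^ (n * m))"
  shows "(summable (\<lambda>q. real (Suc q) ^ (n + m - 1) * g (rad (Suc q) / real (Suc q)))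
            \<longrightarrow> hausdorff_measure_f f (A_set c rad :: (real ^ 'm ^ 'n) set) = 0)
       \<and> (\<not> summable (\<lambda>q. real (Suc q) ^ (n + m - 1) * g (rad (Suc q) / real (Suc q)))
            \<longrightarrow> hausdorff_measure_f f (A_set c rad :: (real ^ 'm ^ 'n) set)
                = hausdorff_measure_f f (unit_cube_mat :: (real ^ 'm ^ 'n) set))"
proof -
  have d: "DIM(real ^ 'm ^ 'n) = n * m" by (simp add: n_def m_def)
  have nm1: "n \<ge> 1" "m \<ge> 1" by (auto simp: n_def m_def Suc_le_eq)
  \<comment> \<open>The form in which \<open>n * m > 2\<close> is used: it makes the exponent n+m-1
    of the gcd sum at least 3.\<close>
  have dim: "n + m \<ge> 4"
  proof (rule ccontr)
    assume "\<not> n + m \<ge> 4"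
    then have "(n = 1 \<and> m \<le> 2) \<or> (n \<le> 2 \<and> m = 1)" using nm1 by linarith
    then show False using nm by auto
  qed
  have f: "mono_on {0<..} f" "\<And>s. s > 0 \<Longrightarrow> f s > 0" "(f \<longlongrightarrow> 0) (at_right 0)"
    using f_dim by (auto simp: dimension_function_def)
  have g: "mono_on {0<..} g" "\<And>s. s > 0 \<Longrightarrow> g s > 0" "(g \<longlongrightarrow> 0) (at_right 0)"
    using g_dim by (auto simp: dimension_function_def)
  have fg: "f s * s ^ m = g s * s ^ (n * m)" if "s > 0" for s
  proof -
    have "n * m = m * (n - 1) + m" using nm1 by (cases n) auto
    then have "s ^ (n * m) = s ^ (m * (n - 1)) * s ^ m" by (simp only: power_add)
    then show ?thesis using that by (simp add: g_def)
  qed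
  have fg': "f s * s ^ CARD('m) = g s * s ^ DIM(real ^ 'm ^ 'n)" if "s > 0" for s
    unfolding d using fg[OF that] by (simp only: m_def)
  have "hausdorff_measure_f f (A_set c rad :: (real ^ 'm ^ 'n) set) = 0"
    if "summable (\<lambda>q. real (Suc q) ^ (n + m - 1) * g (rad (Suc q) / real (Suc q)))"
    by (rule hausdorff_measure_A_set_convergent[OF rad_pos g(1,2) f(2,3) fg' that[unfolded n_def m_def]])
  moreover have "hausdorff_measure_f f (A_set c rad :: (real ^ 'm ^ 'n) set) = hausdorff_measure_f f (unit_cube_mat :: (real ^ 'm ^ 'n) set)"
    if div: "\<not> summable (\<lambda>q. real (Suc q) ^ (n + m - 1) * g (rad (Suc q) / real (Suc q)))"
  proof (cases "\<exists>B s1. s1 > 0 \<and> (\<forall>s. 0 < s \<and> s < s1 \<longrightarrow> f s \<le> B * s ^ (n * m))")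
    case True
    then obtain B s1 where B': "s1 > 0" "\<And>s. 0 < s \<Longrightarrow> s < s1 \<Longrightarrow> f s \<le> B * s ^ (n * m)" by blast
    have B0: "B \<ge> 0"
    proof -
      have "0 < B * (s1 / 2) ^ (n * m)" using f(2)[of "s1 / 2"] B'(2)[of "s1 / 2"] B'(1) by auto
      then show ?thesis using B'(1) by (simp add: zero_less_mult_iff)
    qed
    \<comment> \<open>By \<open>g r \<le> B * r ^ m\<close> the given series is dominated by this
      one. That bound concerns small radii only, but summability would itself force
      \<open>rad (Suc k) < s1\<close> eventually.\<close>
    have "\<not> summable (\<lambda>k. real (Suc k) ^ (n - 1) * rad (Suc k) ^ m)"
    proof
      assume sum: "summable (\<lambda>k. real (Suc k) ^ (n - 1) * rad (Suc k) ^ m)"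
      then have "(\<lambda>k. real (Suc k) ^ (n - 1) * rad (Suc k) ^ m) \<longlonglongrightarrow> 0" by (rule summable_LIMSEQ_zero)
      then have "\<forall>\<^sub>F k in sequentially. real (Suc k) ^ (n - 1) * rad (Suc k) ^ m < s1 ^ m"
        by (rule order_tendstoD) (use B' in auto)
      then have "\<forall>\<^sub>F k in sequentially. norm (real (Suc k) ^ (n + m - 1) * g (rad (Suc k) / real (Suc k)))
          \<le> B * (real (Suc k) ^ (n - 1) * rad (Suc k) ^ m)"
      proof eventually_elim
        case (elim k)
        define K r where "K = real (Suc k)" and "r = rad (Suc k) / K"
        have K: "K \<ge> 1" by (simp add: K_def)
        have r: "r > 0" using rad_pos K by (simp add: r_def)
        have "1 * rad (Suc k) ^ m \<le> K ^ (n - 1) * rad (Suc k) ^ m"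
          using K rad_pos[of "Suc k"] by (intro mult_right_mono one_le_power) auto
        then have "rad (Suc k) ^ m < s1 ^ m" using elim by (simp add: K_def)
        then have "rad (Suc k) < s1" using B'(1) by (simp add: power_less_imp_less_base)
        moreover have "r \<le> rad (Suc k)" using K rad_pos[of "Suc k"] by (simp add: r_def divide_le_eq mult_left_le_one_le less_imp_le)
        ultimately have "f r \<le> B * r ^ (n * m)" using r by (intro B'(2)) auto
        then have "g r * r ^ (n * m) \<le> B * r ^ (n * m) * r ^ m"
          using r by (simp flip: fg[OF r])
        then have "g r \<le> B * r ^ m" using r by (simp add: mult.assoc mult.left_commute[of _ "r ^ (n * m)"] mult.commute[of _ "r ^ (n * m)"])
        then have "K ^ (n + m - 1) * g r \<le> K ^ (n + m - 1) * (B * r ^ m)" using K by (intro mult_left_mono) auto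
        also have "K ^ (n + m - 1) * (B * r ^ m) = B * (K ^ (n - 1) * rad (Suc k) ^ m)"
        proof -
          have "n + m - 1 = (n - 1) + m" using nm1 by simp
          then have "K ^ (n + m - 1) = K ^ (n - 1) * K ^ m" by (simp only: power_add)
          then show ?thesis using K by (simp add: r_def power_divide)
        qed
        finally have le: "K ^ (n + m - 1) * g r \<le> B * (K ^ (n - 1) * rad (Suc k) ^ m)" .
        have "0 \<le> K ^ (n + m - 1) * g r" using g(2)[OF r] K by simp
        with le show ?case unfolding K_def r_def by (simp only: real_norm_def abs_of_nonneg)
      qed
      moreover have "summable (\<lambda>k. B * (real (Suc k) ^ (n - 1) * rad (Suc k) ^ m))" using sum by (rule summable_mult)
      ultimately have "summable (\<lambda>q. real (Suc q) ^ (n + m - 1) * g (rad (Suc q) / real (Suc q)))"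
        by (rule summable_comparison_test_ev)
      with div show False by contradiction
    qed
    note div' = this[unfolded n_def m_def]
    obtain Z where Z: "Z \<in> null_sets lborel" "unit_cube_mat \<subseteq> A_set c rad \<union> (Z :: (real ^ 'm ^ 'n) set)"
      by (rule A_set_full_measure[where c = c, OF rad_pos div' dim[unfolded n_def m_def]])
    have "hausdorff_measure_f f Z = 0"
      by (rule hausdorff_measure_null_set[OF Z(1) f(3) B'(1) _ B0]) (simp only: d B'(2))
    then have "hausdorff_measure_f f (A_set c rad \<union> Z) \<le> hausdorff_measure_f f (A_set c rad :: (real ^ 'm ^ 'n) set)"
      by (rule hausdorff_measure_Un_null[OF f(3)])
    then have "hausdorff_measure_f f (unit_cube_mat :: (real ^ 'm ^ 'n) set) \<le> hausdorff_measure_f f (A_set c rad :: (real ^ 'm ^ 'n) set)"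
      using hausdorff_measure_mono[OF Z(2), of f] by (rule order_trans[rotated])
    with hausdorff_measure_mono[OF A_set_subset] show ?thesis by (rule antisym)
  next
    case False
    define h where "h r = f r / r ^ (n * m)" for r
    have unb: "\<exists>s. 0 < s \<and> s < s1 \<and> h s > B" if s1: "s1 > 0" for s1 B
    proof -
      obtain s where "0 < s" "s < s1" "\<not> f s \<le> B * s ^ (n * m)" using False s1 by blast
      then show ?thesis by (intro exI[of _ s]) (simp add: h_def pos_less_divide_eq)
    qed
    have anti: "h t \<le> h s" if "0 < s" "s \<le> t" for s t
    proof -
      \<comment> \<open>A non-decreasing \<open>h\<close> would be bounded by \<open>h 1\<close> on
        (0, 1), contradicting \<open>unb\<close>.\<close>
      have "\<not> mono_on {0<..} h"
      proof
        assume "mono_on {0<..} h"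
        obtain s where "0 < s" "s < 1" "h s > h 1" using unb[of 1 "h 1"] by auto
        with \<open>mono_on {0<..} h\<close> show False using mono_onD[of "{0<..}" h s 1] by auto
      qed
      then have "\<forall>x\<in>{0<..}. \<forall>y\<in>{0<..}. x \<le> y \<longrightarrow> h y \<le> h x"
        using mon unfolding monotonic_on_def h_def by blast
      then show ?thesis using that by auto
    qed
    have inf: "\<exists>r0>0. \<forall>s. 0 < s \<and> s < r0 \<longrightarrow> M \<le> h s" for M
    proof -
      obtain r0 where "0 < r0" "h r0 > M" using unb[of 1 M] by auto
      then show ?thesis using anti by (intro exI[of _ r0]) (auto intro: order_trans[of _ "h r0"] less_imp_le)
    qed
    \<comment> \<open>Truncation at 1 for the nested construction. It preserves divergence: a
      truncated term is at least \<open>h (1 / K) \<ge> h 1\<close>, whereas the terms of a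
      convergent series drop below \<open>h 1\<close>.\<close>
    define rad' where "rad' k = min (rad k) 1" for k
    have rad': "rad' k > 0" "rad' k \<le> 1" "rad' k \<le> rad k" for k using rad_pos[of k] by (auto simp: rad'_def)
    have "\<not> summable (\<lambda>q. real (Suc q) ^ (n + m - 1) * g (rad' (Suc q) / real (Suc q)))"
    proof
      assume sum: "summable (\<lambda>q. real (Suc q) ^ (n + m - 1) * g (rad' (Suc q) / real (Suc q)))"
      then have "(\<lambda>q. real (Suc q) ^ (n + m - 1) * g (rad' (Suc q) / real (Suc q))) \<longlonglongrightarrow> 0" by (rule summable_LIMSEQ_zero)
      moreover have "h 1 > 0" using f(2)[of 1] by (simp add: h_def)
      ultimately have "\<forall>\<^sub>F q in sequentially. real (Suc q) ^ (n + m - 1) * g (rad' (Suc q) / real (Suc q)) < h 1"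
        by (rule order_tendstoD)
      then have "\<forall>\<^sub>F q in sequentially. real (Suc q) ^ (n + m - 1) * g (rad' (Suc q) / real (Suc q))
          = real (Suc q) ^ (n + m - 1) * g (rad (Suc q) / real (Suc q))"
      proof eventually_elim
        case (elim q)
        have "rad (Suc q) \<le> 1"
        proof (rule ccontr)
          assume "\<not> rad (Suc q) \<le> 1"
          then have r1: "rad' (Suc q) = 1" by (simp add: rad'_def)
          define K where "K = real (Suc q)"
          have K: "K \<ge> 1" by (simp add: K_def)
          have "g (1 / K) * (1 / K) ^ (n * m) = f (1 / K) * (1 / K) ^ m" using fg[of "1 / K"] K by simp
          then have "g (1 / K) = h (1 / K) * (1 / K) ^ m" using K by (simp add: h_def field_simps)
          then have "K ^ m * g (1 / K) = h (1 / K)" using K by (simp add: power_divide)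
          moreover have "h 1 \<le> h (1 / K)" using K by (intro anti) auto
          moreover have "K ^ m * g (1 / K) \<le> K ^ (n + m - 1) * g (1 / K)"
            using K g(2)[of "1 / K"] nm1 by (intro mult_right_mono power_increasing) auto
          ultimately show False using elim by (simp add: K_def r1)
        qed
        then show ?case by (simp add: rad'_def min_def)
      qed
      from summable_cong[OF this] show False using sum div by blast
    qed
    note div' = this
    have "hausdorff_measure_f f (A_set c rad' :: (real ^ 'm ^ 'n) set) = \<infinity>"
    proof (rule hausdorff_measure_A_set_infinite[OF rad'(1,2) g f(1,2) fg' _ _ div'[unfolded n_def m_def] dim[unfolded n_def m_def]])
      show "f t / t ^ DIM(real ^ 'm ^ 'n) \<le> f s / s ^ DIM(real ^ 'm ^ 'n)" if "0 < s" "s \<le> t" for s t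
        unfolding d using anti[OF that] by (simp only: h_def)
      show "\<exists>r0>0. \<forall>s. 0 < s \<and> s < r0 \<longrightarrow> M \<le> f s / s ^ DIM(real ^ 'm ^ 'n)" for M
        unfolding d using inf[of M] by (simp only: h_def)
    qed
    moreover have "hausdorff_measure_f f (A_set c rad' :: (real ^ 'm ^ 'n) set) \<le> hausdorff_measure_f f (A_set c rad :: (real ^ 'm ^ 'n) set)"
      by (rule hausdorff_measure_mono) (rule A_set_mono, rule rad'(3))
    moreover have "hausdorff_measure_f f (A_set c rad :: (real ^ 'm ^ 'n) set) \<le> hausdorff_measure_f f (unit_cube_mat :: (real ^ 'm ^ 'n) set)"
      by (rule hausdorff_measure_mono) (rule A_set_subset)
    ultimately show ?thesis by (simp add: top_unique)
  qed
  ultimately show ?thesis by blast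
qed

end
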